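(* Let $M$ be an irreducible $\mathfrak L$-module having a weight space decomposition with respect to $\mathfrak h$ with finite dimensional weight spaces. Suppose that $j,j'\in\{1,2\}$ and $j\neq j'$. If $R(j)$ is up-nilpotent hybrid (resp. down-nilpotent hybrid), then $R(j')$ is either tight or up-nilpotent hybrid (resp. down-nilpotent hybrid).
   Context: **The algebra.** Ground field $\mathbb C$. Let $k,\ell$ be positive integers and let $\mathfrak L=\mathfrak L_0\oplus\mathfrak L_1$ be the twisted affine Lie superalgebra of one of the types $A(2k-1,2\ell-1)^{(2)}$ with $(k,\ell)\ne(1,1)$, $A(2k,2\ell)^{(4)}$, $A(2k,2\ell-1)^{(2)}$, $D(k+1,\ell)^{(2)}$, built from a finite-dimensional Lie superalgebra $\mathfrak g$ and an automorphism $\sigma$ of order $n$ as follows. $A$-types: $\mathfrak g=A(p,q)$ with $(p,q)=(2k-1,2\ell-1),(2k,2\ell),(2k,2\ell-1)$ and $n=2,4,2$ respectively, where $A(p,q)=\mathfrak{sl}(p+1,q+1)$ if $p\neq q$, and $A(p,p)=\mathfrak{sl}(p+1,p+1)$ modulo scalar matrices; $\sigma$ is (induced by) $\begin{pmatrix}A&B\\C&D\end{pmatrix}\mapsto\begin{pmatrix}-J_1A^tJ_1^{-1}&J_1C^tJ_2^{-1}\\-J_2B^tJ_1^{-1}&-J_2D^tJ_2^{-1}\end{pmatrix}$, where $J_1$ (size $p+1$) and $J_2$ (size $q+1$) are supported on the antidiagonal with $(J_a)_{r,N+1-r}=(-1)^r$ ($N$ the size), except: for $A(2k-1,2\ell-1)$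 the entries of $J_1$ with $r\le k$ are $(-1)^{r+1}$; for $A(2k,2\ell)$ the entry of $J_2$ with $r=\ell+1$ is $\sqrt{-1}$ and those with $r\ge \ell+2$ are $(-1)^{r+1}$. $D$-type: $\mathfrak g=\mathfrak{osp}(2k+2,2\ell)$, all matrices $\begin{pmatrix}x&y&m&n'\\ z&-x^t&p'&q'\\ -q'^t&-n'^t&r&s\\ p'^t&m^t&u&-r^t\end{pmatrix}$ with $x$ of size $(k+1)\times(k+1)$, $m$ of size $(k+1)\times \ell$, $r$ of size $\ell\times\ell$, $y,z$ skew-symmetric, $s,u$ symmetric; $n=2$ and $\sigma(X)=HXH^{-1}$, $H$ the permutation matrix exchanging the indices $k+1$ and $2k+2$. Let $\mathfrak t_1,\mathfrak t_2\subseteq\mathfrak g_0$ be the ideals of even matrices supported in the upper-left, resp. lower-right, diagonal block (traceless in the $A$-types), so $\mathfrak t_1\simeq\mathfrak{sl}(p+1),\mathfrak t_2\simeq\mathfrak{sl}(q+1)$ in $A$-types and $\mathfrak t_1\simeq\mathfrak{so}(2k+2),\mathfrak t_2\simeq\mathfrak{sp}(2\ell)$ in $D$-type; $\mathfrak d_a$ is the set of diagonal matrices in $\mathfrak t_a$. Let $\zeta_n$ be a primitive $n$-th root of unity, ${}^{[r]}\mathfrak g$ the $\zeta_n^r$-eigenspace of $\sigma$, ${}^{[r]}\mathfrak t_a={}^{[r]}\mathfrak g\cap\mathfrak t_a$, and $\kappa$ the nondegenerate supersymmetric invariant even bilinear form on $\mathfrak g$ (the supertrace form). Then $\mathfrak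 L=\bigoplus_{r=0}^{n-1}({}^{[r]}\mathfrak g\otimes t^r\mathbb C[t^{\pm n}])\oplus\mathbb Cc\oplus\mathbb Cd$ with $c,d$ even and $[x\otimes t^a+rc+sd,\,y\otimes t^b+r'c+s'd]=[x,y]\otimes t^{a+b}+a\kappa(x,y)\delta_{a+b,0}c+sb\,y\otimes t^b-s'a\,x\otimes t^a$. Put $\mathfrak h_a=(({}^{[0]}\mathfrak g\cap\mathfrak d_a)\otimes1)\oplus\mathbb Cc\oplus\mathbb Cd$; $\mathfrak h=\mathfrak h_1+\mathfrak h_2$ is the standard Cartan subalgebra of $\mathfrak L$. **Roots.** $\mathfrak L^\alpha=\{x\in\mathfrak L: [h,x]=\alpha(h)x\ \forall h\in\mathfrak h\}$; $R$ (containing $0$) is the set of $\alpha\in\mathfrak h^*$ with $\mathfrak L^\alpha\ne0$. The form $(x\otimes t^a+rc+sd,\,y\otimes t^b+r'c+s'd)=\delta_{a+b,0}\kappa(x,y)+rs'+sr'$ is nondegenerate invariant supersymmetric, nondegenerate on $\mathfrak h$, and is transferred to $\mathfrak h^*$. $R_{re}^\times=\{\alpha\in R:(\alpha,\alpha)\neq0\}$ (nonzero real roots), $R_{im}=\{\alpha\in R:(\alpha,R)=0\}$ (imaginary roots). $\delta\in\mathfrak h^*$ is given by $\delta(d)=1$, $\delta(c)=0$, $\delta(({}^{[0]}\mathfrak g\cap\mathfrak d_a)\otimes1)=0$; $R_{im}$ generates $\mathbb Z\delta$; $\dim\mathfrak L^\alpha=1$ for $\alpha\in R\setminus R_{im}$.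 **Hybrid.** $R^{in}$ (resp. $R^{ln}$) is the set of $\alpha\in R_{re}^\times$ such that nonzero $x\in\mathfrak L^\alpha$ act injectively (resp. locally nilpotently) on $M$. For $i=1,2$ let $\mathfrak L_0(i)=\bigoplus_{r=0}^{n-1}({}^{[r]}\mathfrak t_i\otimes t^r\mathbb C[t^{\pm n}])\oplus\mathbb Cc\oplus\mathbb Cd$ (an affine Lie algebra), let $R(i)$ be the set of weights of $\mathfrak L_0(i)+\mathfrak h$ with respect to $\mathfrak h$, and $R(i)_{re}^\times=R(i)\cap R_{re}^\times$. $R(i)$ is tight if there is $\alpha\in R(i)_{re}^\times$ with $(\alpha+\mathbb Z\delta)\cap R(i)\subseteq R^{ln}$ or $(\alpha+\mathbb Z\delta)\cap R(i)\subseteq R^{in}$; otherwise $R(i)$ is hybrid. Let $K_1=\{\alpha\in R_{re}^\times:\exists N,\ (\alpha+\mathbb Z^{\geq N}\delta)\cap R\subseteq R^{ln}\}$. If $R(i)$ is hybrid, it is called up-nilpotent hybrid if $R(i)\cap K_1=R(i)^\times_{re}$, and down-nilpotent hybrid otherwise. *)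

theory Defs
  imports Complex_Main "Jordan_Normal_Form.Gauss_Jordan_Elimination"
begin

section \<open>Lie superalgebras and their modules\<close>

text \<open>A Lie superalgebra over the complex numbers is stored in the record of HOL-Algebra for a
  vector space with a product: \<open>\<otimes>\<close> is the superbracket, and the field \<open>one\<close> has no meaning and is
  left undefined. The homogeneous components are indexed by the parities 0 (even) and 1 (odd).\<close>

record 'a lie_superalgebra = "(complex, 'a) module" +
  homog :: "nat \<Rightarrow> 'a set"

definition internal_direct_sum :: "'i set \<Rightarrow> ('i \<Rightarrow> 'v::ab_group_add set) \<Rightarrow> bool" where
  "internal_direct_sum I W \<longleftrightarrow>
     (\<forall>v. \<exists>!u. (\<forall>i. if i \<in> I then u i \<in> W i else u i = 0) \<and> finite {i. u i \<noteq> 0}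
               \<and> v = (\<Sum>i | u i \<noteq> 0. u i))"

text \<open>A module is a superspace: \<open>V 0\<close> and \<open>V 1\<close> are its even and its odd part. Nothing is assumed
  about \<open>act x\<close> for \<open>x\<close> outside the carrier of \<open>L\<close>.\<close>

definition lie_supermodule ::
  "'a lie_superalgebra \<Rightarrow> (complex \<Rightarrow> 'v::ab_group_add \<Rightarrow> 'v) \<Rightarrow> (nat \<Rightarrow> 'v set)
     \<Rightarrow> ('a \<Rightarrow> 'v \<Rightarrow> 'v) \<Rightarrow> bool" where
  "lie_supermodule L scale V act \<longleftrightarrow>
     vector_space scale \<and>
     (\<forall>i\<in>{0,1}. Modules.module.subspace scale (V i)) \<and>
     internal_direct_sum {0,1} V \<and>
     (\<forall>x\<in>carrier L. Vector_Spaces.linear scale scale (act x)) \<and>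
     (\<forall>x\<in>carrier L. \<forall>y\<in>carrier L. \<forall>v. act (x \<oplus>\<^bsub>L\<^esub> y) v = act x v + act y v) \<and>
     (\<forall>c. \<forall>x\<in>carrier L. \<forall>v. act (c \<odot>\<^bsub>L\<^esub> x) v = scale c (act x v)) \<and>
     (\<forall>i\<in>{0,1}. \<forall>j\<in>{0,1}. \<forall>x\<in>homog L i. \<forall>v\<in>V j. act x v \<in> V ((i + j) mod 2)) \<and>
     (\<forall>i\<in>{0,1}. \<forall>j\<in>{0,1}. \<forall>x\<in>homog L i. \<forall>y\<in>homog L j. \<forall>v.
        act (x \<otimes>\<^bsub>L\<^esub> y) v = act x (act y v) - scale ((-1) ^ (i * j)) (act y (act x v)))"

definition lie_subsupermodule ::
  "'a lie_superalgebra \<Rightarrow> (complex \<Rightarrow> 'v::ab_group_add \<Rightarrow> 'v) \<Rightarrow> (nat \<Rightarrow> 'v set)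
     \<Rightarrow> ('a \<Rightarrow> 'v \<Rightarrow> 'v) \<Rightarrow> 'v set \<Rightarrow> bool" where
  "lie_subsupermodule L scale V act W \<longleftrightarrow>
     Modules.module.subspace scale W \<and>
     (\<forall>w\<in>W. \<exists>w0\<in>W \<inter> V 0. \<exists>w1\<in>W \<inter> V 1. w = w0 + w1) \<and>
     (\<forall>x\<in>carrier L. \<forall>w\<in>W. act x w \<in> W)"

definition irreducible_lie_supermodule ::
  "'a lie_superalgebra \<Rightarrow> (complex \<Rightarrow> 'v::ab_group_add \<Rightarrow> 'v) \<Rightarrow> (nat \<Rightarrow> 'v set)
     \<Rightarrow> ('a \<Rightarrow> 'v \<Rightarrow> 'v) \<Rightarrow> bool" where
  "irreducible_lie_supermodule L scale V act \<longleftrightarrow>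
     lie_supermodule L scale V act \<and> (UNIV :: 'v set) \<noteq> {0} \<and>
     (\<forall>W. lie_subsupermodule L scale V act W \<longrightarrow> W = {0} \<or> W = UNIV)"


section \<open>Affinization\<close>

text \<open>The triple \<open>(f, r, s)\<close> stands for \<open>(\<Sum>a. f a \<otimes> t^a) + r c + s d\<close>.\<close>

type_synonym 'a affine = "(int \<Rightarrow> 'a) \<times> complex \<times> complex"

definition eigenspace :: "'a lie_superalgebra \<Rightarrow> ('a \<Rightarrow> 'a) \<Rightarrow> complex \<Rightarrow> 'a set" where
  "eigenspace G \<sigma> e = {x \<in> carrier G. \<sigma> x = e \<odot>\<^bsub>G\<^esub> x}"

definition affine_carrier ::
  "'a lie_superalgebra \<Rightarrow> ('a \<Rightarrow> 'a) \<Rightarrow> nat \<Rightarrow> complex \<Rightarrow> 'a affine set" where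
  "affine_carrier G \<sigma> n \<zeta> =
     {(f, r, s). finite {a. f a \<noteq> \<zero>\<^bsub>G\<^esub>} \<and> (\<forall>a. f a \<in> eigenspace G \<sigma> (\<zeta> ^ nat (a mod int n)))}"

fun affine_bracket ::
  "'a lie_superalgebra \<Rightarrow> ('a \<Rightarrow> 'a \<Rightarrow> complex) \<Rightarrow> 'a affine \<Rightarrow> 'a affine \<Rightarrow> 'a affine" where
  "affine_bracket G \<kappa> (f, r, s) (g, r', s') =
     ((\<lambda>m. finsum G (\<lambda>a. f a \<otimes>\<^bsub>G\<^esub> g (m - a)) {a. f a \<noteq> \<zero>\<^bsub>G\<^esub>}
             \<oplus>\<^bsub>G\<^esub> (s * of_int m) \<odot>\<^bsub>G\<^esub> g m \<oplus>\<^bsub>G\<^esub> (- s' * of_int m) \<odot>\<^bsub>G\<^esub> f m),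
      \<Sum>a | f a \<noteq> \<zero>\<^bsub>G\<^esub>. of_int a * \<kappa> (f a) (g (- a)),
      0)"

fun affine_form ::
  "'a lie_superalgebra \<Rightarrow> ('a \<Rightarrow> 'a \<Rightarrow> complex) \<Rightarrow> 'a affine \<Rightarrow> 'a affine \<Rightarrow> complex" where
  "affine_form G \<kappa> (f, r, s) (g, r', s') =
     (\<Sum>a | f a \<noteq> \<zero>\<^bsub>G\<^esub>. \<kappa> (f a) (g (- a))) + r * s' + s * r'"

definition twisted_affinization ::
  "'a lie_superalgebra \<Rightarrow> ('a \<Rightarrow> 'a \<Rightarrow> complex) \<Rightarrow> ('a \<Rightarrow> 'a) \<Rightarrow> nat \<Rightarrow> complex
     \<Rightarrow> 'a affine lie_superalgebra" where
  "twisted_affinization G \<kappa> \<sigma> n \<zeta> =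
     \<lparr>carrier = affine_carrier G \<sigma> n \<zeta>,
      mult = affine_bracket G \<kappa>,
      one = undefined,
      zero = (\<lambda>_. \<zero>\<^bsub>G\<^esub>, 0, 0),
      add = (\<lambda>(f, r, s) (g, r', s'). (\<lambda>a. f a \<oplus>\<^bsub>G\<^esub> g a, r + r', s + s')),
      smult = (\<lambda>z (f, r, s). (\<lambda>a. z \<odot>\<^bsub>G\<^esub> f a, z * r, z * s)),
      homog = (\<lambda>i. {(f, r, s) \<in> affine_carrier G \<sigma> n \<zeta>.
                      (\<forall>a. f a \<in> homog G i) \<and> (i \<noteq> 0 \<longrightarrow> r = 0 \<and> s = 0)})\<rparr>"


section \<open>Matrices in blocks\<close>

text \<open>Throughout, the first \<open>m\<close> rows and columns of a square matrix form its upper-left block.\<close>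

definition supertrace :: "nat \<Rightarrow> complex mat \<Rightarrow> complex" where
  "supertrace m X = (\<Sum>i<m. X $$ (i, i)) - (\<Sum>i\<in>{m..<dim_row X}. X $$ (i, i))"

definition even_part :: "nat \<Rightarrow> complex mat \<Rightarrow> complex mat" where
  "even_part m X =
     mat (dim_row X) (dim_col X) (\<lambda>(i, j). if i < m \<longleftrightarrow> j < m then X $$ (i, j) else 0)"

definition odd_part :: "nat \<Rightarrow> complex mat \<Rightarrow> complex mat" where
  "odd_part m X =
     mat (dim_row X) (dim_col X) (\<lambda>(i, j). if i < m \<longleftrightarrow> j < m then 0 else X $$ (i, j))"

text \<open>The bilinear extension of \<open>[X, Y] = X Y - (-1)^(|X| |Y|) Y X\<close>.\<close>

definition superbracket :: "nat \<Rightarrow> complex mat \<Rightarrow> complex mat \<Rightarrow> complex mat" where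
  "superbracket m X Y =
     X * Y - Y * even_part m X - even_part m Y * odd_part m X + odd_part m Y * odd_part m X"

definition matrix_inverse :: "complex mat \<Rightarrow> complex mat" where
  "matrix_inverse A = the (mat_inverse A)"

text \<open>The entry of \<open>antidiagonal N e\<close> in row \<open>r\<close> and column \<open>N + 1 - r\<close> is \<open>e r\<close>, where \<open>r\<close> counts
  from 1.\<close>

definition antidiagonal :: "nat \<Rightarrow> (nat \<Rightarrow> complex) \<Rightarrow> complex mat" where
  "antidiagonal N e = mat N N (\<lambda>(i, j). if i + j + 1 = N then e (i + 1) else 0)"


section \<open>The finite-dimensional superalgebras and their automorphisms\<close>

text \<open>The constructors stand for \<open>A(2k-1,2l-1)^(2)\<close>, \<open>A(2k,2l)^(4)\<close>, \<open>A(2k,2l-1)^(2)\<close> and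
  \<open>D(k+1,l)^(2)\<close>.\<close>

datatype twisted_type = A_odd_odd | A_even_even | A_even_odd | D_type

fun twist_order :: "twisted_type \<Rightarrow> nat" where
  "twist_order A_even_even = 4"
| "twist_order _ = 2"

fun upper_size :: "twisted_type \<Rightarrow> nat \<Rightarrow> nat" where
  "upper_size A_odd_odd k = 2 * k"
| "upper_size A_even_even k = 2 * k + 1"
| "upper_size A_even_odd k = 2 * k + 1"
| "upper_size D_type k = 2 * k + 2"

fun lower_size :: "twisted_type \<Rightarrow> nat \<Rightarrow> nat" where
  "lower_size A_even_even l = 2 * l + 1"
| "lower_size _ l = 2 * l"

definition sl_matrices :: "nat \<Rightarrow> nat \<Rightarrow> complex mat set" where
  "sl_matrices m n = {X \<in> carrier_mat (m + n) (m + n). supertrace m X = 0}"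

definition osp_matrices :: "nat \<Rightarrow> nat \<Rightarrow> complex mat set" where
  "osp_matrices h l =
     {four_block_mat
        (four_block_mat x y z (- x\<^sup>T)) (four_block_mat m n p q)
        (four_block_mat (- q\<^sup>T) (- n\<^sup>T) p\<^sup>T m\<^sup>T) (four_block_mat r s u (- r\<^sup>T))
      | x y z m n p q r s u.
        {x, y, z} \<subseteq> carrier_mat h h \<and> {m, n, p, q} \<subseteq> carrier_mat h l \<and>
        {r, s, u} \<subseteq> carrier_mat l l \<and>
        y\<^sup>T = - y \<and> z\<^sup>T = - z \<and> s\<^sup>T = s \<and> u\<^sup>T = u}"

fun J1_entry :: "twisted_type \<Rightarrow> nat \<Rightarrow> nat \<Rightarrow> complex" where
  "J1_entry A_odd_odd k r = (if r \<le> k then (-1) ^ (r + 1) else (-1) ^ r)"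
| "J1_entry _ k r = (-1) ^ r"

fun J2_entry :: "twisted_type \<Rightarrow> nat \<Rightarrow> nat \<Rightarrow> complex" where
  "J2_entry A_even_even l r =
     (if r = l + 1 then \<i> else if r \<ge> l + 2 then (-1) ^ (r + 1) else (-1) ^ r)"
| "J2_entry _ l r = (-1) ^ r"

locale twisted_affine =
  fixes T :: twisted_type and k l :: nat and \<zeta> :: complex
begin

abbreviation m1 :: nat where "m1 \<equiv> upper_size T k"
abbreviation m2 :: nat where "m2 \<equiv> lower_size T l"

definition matrices :: "complex mat set" where
  "matrices = (if T = D_type then osp_matrices (k + 1) l else sl_matrices m1 m2)"

text \<open>The algebra \<open>\<gg>\<close> is the quotient of the matrix algebra by this equivalence relation, which is
  equality except for \<open>A(p,p)\<close>, where matrices are identified modulo scalar matrices. Elements of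
  \<open>\<gg>\<close> are thus equivalence classes of matrices in all types.\<close>

definition congr :: "(complex mat \<times> complex mat) set" where
  "congr = {(X, Y). X \<in> matrices \<and> Y \<in> matrices \<and>
              (if T \<noteq> D_type \<and> m1 = m2 then \<exists>c. X - Y = c \<cdot>\<^sub>m 1\<^sub>m (m1 + m2) else X = Y)}"

abbreviation cls :: "complex mat \<Rightarrow> complex mat set" where
  "cls X \<equiv> congr `` {X}"

definition fin_alg :: "complex mat set lie_superalgebra" where
  "fin_alg =
     \<lparr>carrier = matrices // congr,
      mult = (\<lambda>S S'. \<Union>X\<in>S. \<Union>Y\<in>S'. cls (superbracket m1 X Y)),
      one = undefined,
      zero = cls (0\<^sub>m (m1 + m2) (m1 + m2)),
      add = (\<lambda>S S'. \<Union>X\<in>S. \<Union>Y\<in>S'. cls (X + Y)),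
      smult = (\<lambda>c S. \<Union>X\<in>S. cls (c \<cdot>\<^sub>m X)),
      homog = (\<lambda>i. {cls X | X. X \<in> matrices \<and>
                      (if i = 0 then odd_part m1 X else even_part m1 X) = 0\<^sub>m (m1 + m2) (m1 + m2)})\<rparr>"

definition kappa :: "complex mat set \<Rightarrow> complex mat set \<Rightarrow> complex" where
  "kappa S S' = the_elem (\<Union>X\<in>S. \<Union>Y\<in>S'. {supertrace m1 (X * Y)})"

definition J1 :: "complex mat" where "J1 = antidiagonal m1 (J1_entry T k)"
definition J2 :: "complex mat" where "J2 = antidiagonal m2 (J2_entry T l)"

text \<open>Rows and columns count from 0, so that \<open>H\<close> exchanges the indices \<open>k + 1\<close> and \<open>2 k + 2\<close> of the
  count from 1.\<close>

definition H :: "complex mat" where "H = swaprows_mat (m1 + m2) k (2 * k + 1)"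

definition sigma_matrix :: "complex mat \<Rightarrow> complex mat" where
  "sigma_matrix X =
     (if T = D_type then H * X * matrix_inverse H
      else case split_block X m1 m1 of (A, B, C, E) \<Rightarrow>
        four_block_mat
          (- (J1 * A\<^sup>T * matrix_inverse J1)) (J1 * C\<^sup>T * matrix_inverse J2)
          (- (J2 * B\<^sup>T * matrix_inverse J1)) (- (J2 * E\<^sup>T * matrix_inverse J2)))"

definition sigma :: "complex mat set \<Rightarrow> complex mat set" where
  "sigma S = (\<Union>X\<in>S. cls (sigma_matrix X))"

definition block_indices :: "nat \<Rightarrow> nat set" where
  "block_indices a = (if a = 1 then {0..<m1} else {m1..<m1 + m2})"

definition block_matrices :: "nat \<Rightarrow> complex mat set" where
  "block_matrices a =
     {X \<in> matrices. \<forall>i<m1 + m2. \<forall>j<m1 + m2.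
        X $$ (i, j) \<noteq> 0 \<longrightarrow> i \<in> block_indices a \<and> j \<in> block_indices a}"

text \<open>In the \<open>A\<close> types the elements of \<open>block_matrices a\<close> are traceless, having supertrace 0.\<close>

definition t_ideal :: "nat \<Rightarrow> complex mat set set" where
  "t_ideal a = {cls X | X. X \<in> block_matrices a}"

definition diag :: "nat \<Rightarrow> complex mat set set" where
  "diag a = {cls X | X. X \<in> block_matrices a \<and> diagonal_mat X}"


section \<open>The twisted affine superalgebra and its roots\<close>

definition L :: "complex mat set affine lie_superalgebra" where
  "L = twisted_affinization fin_alg kappa sigma (twist_order T) \<zeta>"

definition bform :: "complex mat set affine \<Rightarrow> complex mat set affine \<Rightarrow> complex" where
  "bform = affine_form fin_alg kappa"

definition h_part :: "nat \<Rightarrow> complex mat set affine set" where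
  "h_part a = {(f, r, s). f 0 \<in> eigenspace fin_alg sigma 1 \<inter> diag a \<and> (\<forall>b. b \<noteq> 0 \<longrightarrow> f b = \<zero>\<^bsub>fin_alg\<^esub>)}"

definition h :: "complex mat set affine set" where
  "h = {x \<oplus>\<^bsub>L\<^esub> y | x y. x \<in> h_part 1 \<and> y \<in> h_part 2}"

text \<open>Elements of the dual space of \<open>h\<close> are functions on the whole type that vanish outside \<open>h\<close>, so
  that they are determined by their values on \<open>h\<close> and can be added pointwise.\<close>

definition h_dual :: "(complex mat set affine \<Rightarrow> complex) set" where
  "h_dual = {\<alpha>. (\<forall>x\<in>h. \<forall>y\<in>h. \<alpha> (x \<oplus>\<^bsub>L\<^esub> y) = \<alpha> x + \<alpha> y) \<and>
                (\<forall>c. \<forall>x\<in>h. \<alpha> (c \<odot>\<^bsub>L\<^esub> x) = c * \<alpha> x) \<and> (\<forall>x. x \<notin> h \<longrightarrow> \<alpha> x = 0)}"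

definition delta :: "complex mat set affine \<Rightarrow> complex" where
  "delta x = (if x \<in> h then snd (snd x) else 0)"

definition shift :: "(complex mat set affine \<Rightarrow> complex) \<Rightarrow> int \<Rightarrow> complex mat set affine \<Rightarrow> complex" where
  "shift \<alpha> m = (\<lambda>x. \<alpha> x + of_int m * delta x)"

definition root_space :: "(complex mat set affine \<Rightarrow> complex) \<Rightarrow> complex mat set affine set" where
  "root_space \<alpha> = {x \<in> carrier L. \<forall>y\<in>h. y \<otimes>\<^bsub>L\<^esub> x = \<alpha> y \<odot>\<^bsub>L\<^esub> x}"

definition R :: "(complex mat set affine \<Rightarrow> complex) set" where
  "R = {\<alpha> \<in> h_dual. root_space \<alpha> \<noteq> {\<zero>\<^bsub>L\<^esub>}}"

definition dual_vector :: "(complex mat set affine \<Rightarrow> complex) \<Rightarrow> complex mat set affine" where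
  "dual_vector \<alpha> = (THE x. x \<in> h \<and> (\<forall>y\<in>h. \<alpha> y = bform x y))"

definition dual_form ::
  "(complex mat set affine \<Rightarrow> complex) \<Rightarrow> (complex mat set affine \<Rightarrow> complex) \<Rightarrow> complex" where
  "dual_form \<alpha> \<beta> = bform (dual_vector \<alpha>) (dual_vector \<beta>)"

definition R_re :: "(complex mat set affine \<Rightarrow> complex) set" where
  "R_re = {\<alpha> \<in> R. dual_form \<alpha> \<alpha> \<noteq> 0}"

definition L0 :: "nat \<Rightarrow> complex mat set affine set" where
  "L0 i = {(f, r, s) \<in> carrier L. \<forall>a. f a \<in> t_ideal i}"

definition R_part :: "nat \<Rightarrow> (complex mat set affine \<Rightarrow> complex) set" where
  "R_part i = {\<alpha> \<in> h_dual. root_space \<alpha> \<inter> {x \<oplus>\<^bsub>L\<^esub> y | x y. x \<in> L0 i \<and> y \<in> h} \<noteq> {\<zero>\<^bsub>L\<^esub>}}"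

definition R_part_re :: "nat \<Rightarrow> (complex mat set affine \<Rightarrow> complex) set" where
  "R_part_re i = R_part i \<inter> R_re"


section \<open>Weight modules and hybrid root systems\<close>

definition weight_space ::
  "(complex \<Rightarrow> 'v::ab_group_add \<Rightarrow> 'v) \<Rightarrow> (complex mat set affine \<Rightarrow> 'v \<Rightarrow> 'v)
     \<Rightarrow> (complex mat set affine \<Rightarrow> complex) \<Rightarrow> 'v set" where
  "weight_space scale act \<mu> = {v. \<forall>x\<in>h. act x v = scale (\<mu> x) v}"

definition finite_weight_module ::
  "(complex \<Rightarrow> 'v::ab_group_add \<Rightarrow> 'v) \<Rightarrow> (complex mat set affine \<Rightarrow> 'v \<Rightarrow> 'v) \<Rightarrow> bool" where
  "finite_weight_module scale act \<longleftrightarrow>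
     internal_direct_sum h_dual (weight_space scale act) \<and>
     (\<forall>\<mu>\<in>h_dual. \<exists>B. finite B \<and> weight_space scale act \<mu> = Modules.module.span scale B)"

definition R_in ::
  "(complex mat set affine \<Rightarrow> 'v::ab_group_add \<Rightarrow> 'v) \<Rightarrow> (complex mat set affine \<Rightarrow> complex) set" where
  "R_in act = {\<alpha> \<in> R_re. \<forall>x\<in>root_space \<alpha> - {\<zero>\<^bsub>L\<^esub>}. inj (act x)}"

definition R_ln ::
  "(complex mat set affine \<Rightarrow> 'v::ab_group_add \<Rightarrow> 'v) \<Rightarrow> (complex mat set affine \<Rightarrow> complex) set" where
  "R_ln act = {\<alpha> \<in> R_re. \<forall>x\<in>root_space \<alpha> - {\<zero>\<^bsub>L\<^esub>}. \<forall>v. \<exists>m. (act x ^^ m) v = 0}"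

definition tight :: "(complex mat set affine \<Rightarrow> 'v::ab_group_add \<Rightarrow> 'v) \<Rightarrow> nat \<Rightarrow> bool" where
  "tight act i \<longleftrightarrow>
     (\<exists>\<alpha>\<in>R_part_re i. range (shift \<alpha>) \<inter> R_part i \<subseteq> R_ln act \<or> range (shift \<alpha>) \<inter> R_part i \<subseteq> R_in act)"

definition hybrid :: "(complex mat set affine \<Rightarrow> 'v::ab_group_add \<Rightarrow> 'v) \<Rightarrow> nat \<Rightarrow> bool" where
  "hybrid act i \<longleftrightarrow> \<not> tight act i"

definition K1 ::
  "(complex mat set affine \<Rightarrow> 'v::ab_group_add \<Rightarrow> 'v) \<Rightarrow> (complex mat set affine \<Rightarrow> complex) set" where
  "K1 act = {\<alpha> \<in> R_re. \<exists>N. shift \<alpha> ` {N..} \<inter> R \<subseteq> R_ln act}"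

definition up_nilpotent_hybrid ::
  "(complex mat set affine \<Rightarrow> 'v::ab_group_add \<Rightarrow> 'v) \<Rightarrow> nat \<Rightarrow> bool" where
  "up_nilpotent_hybrid act i \<longleftrightarrow> hybrid act i \<and> R_part i \<inter> K1 act = R_part_re i"

definition down_nilpotent_hybrid ::
  "(complex mat set affine \<Rightarrow> 'v::ab_group_add \<Rightarrow> 'v) \<Rightarrow> nat \<Rightarrow> bool" where
  "down_nilpotent_hybrid act i \<longleftrightarrow> hybrid act i \<and> \<not> up_nilpotent_hybrid act i"

end

end

theory Submission
  imports Defs "Jordan_Normal_Form.Determinant"
begin

text \<open>
  Only the set \<open>S\<close> of weights of the module matters, together with three facts on the action of a
  root vector \<open>x\<close> for a root \<open>\<beta>\<close> that is not a multiple of \<open>\<delta>\<close>.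

  \<^item> If \<open>x\<close> is homogeneous, it acts injectively or locally nilpotently, since the vectors killed by
    some power of \<open>x\<close> form a submodule (\<open>injective_or_locally_nilpotent\<close>).

  \<^item> If \<open>x\<close> acts injectively, \<open>S\<close> is closed under adding \<open>\<beta>\<close> (\<open>supp_add_injective\<close>).

  \<^item> If \<open>x\<close> comes from one of the ideals \<open>t_i\<close> and acts locally nilpotently, then no string
    \<open>\<mu> + n \<beta>\<close>, \<open>n \<ge> 0\<close>, meets \<open>S\<close> in infinitely many points: \<open>x\<close> belongs to an \<open>sl(2)\<close> triple, and
    high up in an infinite string there would be infinitely many highest weight vectors, whose images
    in one weight space are independent (\<open>sl2_string_finite\<close>, \<open>locally_nilpotent_finite_string\<close>).

  Assume now that \<open>R(j)\<close> is up-nilpotent hybrid, and that \<open>R(j')\<close> is hybrid but has a root \<open>\<alpha>'\<close>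
  outside \<open>K1\<close>. There are arbitrarily large \<open>n1\<close> such that \<open>\<alpha>' + n1 \<delta>\<close> acts injectively, and being hybrid
  provides some \<open>n2\<close> such that \<open>- \<alpha>' + n2 \<delta>\<close> acts injectively. Hence \<open>S\<close> is closed under adding \<open>p \<delta>\<close>
  with \<open>p = n1 + n2 > 0\<close>. Likewise some translate \<open>\<alpha> + n0 \<delta>\<close> of a root \<open>\<alpha>\<close> of \<open>R(j)\<close> acts injectively.
  Then \<open>S\<close> is closed under adding \<open>\<alpha> + (n0 + q p) \<delta>\<close> for all \<open>q \<ge> 0\<close>, and by the third fact none of
  these can be locally nilpotent, which contradicts \<open>\<alpha> \<in> K1\<close>. The statement on down-nilpotent root
  systems is the contrapositive with \<open>j\<close> and \<open>j'\<close> exchanged.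

  Most of the work is to provide the structure of the superalgebra that this uses, without going through
  a list of the roots. The four types are treated together: in the \<open>A\<close> types the automorphism, and in type
  \<open>D\<close> the map whose fixed points form the orthosymplectic algebra, is the same kind of signed
  transposition \<open>theta\<close>. If a matrix \<open>X\<close> in one of the two blocks is a weight vector for the torus of
  diagonal matrices fixed by the automorphism, its conjugate transpose is one for the opposite weight,
  and the bracket of the two is diagonal because the torus tells the indices apart
  (\<open>coroot_diagonal\<close>). This bracket represents the weight under the supertrace form
  (\<open>supertrace_coroot\<close>), so a root of \<open>R(i)\<close> is real as soon as it does not vanish on the torus
  (\<open>dual_form_nonzero\<close>, \<open>dual_form_zero\<close>). Where the algebra is a quotient by scalars, matrices with
  vanishing trace in the upper block serve as canonical representatives (\<open>cls_eq_upper_trace\<close>).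
\<close>

section \<open>Strings of weights for an sl(2) triple\<close>

text \<open>The vectors killed by \<open>E\<close> are highest weight vectors. As \<open>E\<close> is locally nilpotent, a nonzero
vector high up in the string leads to a highest weight vector \<open>u\<close> even higher up, say in \<open>V m\<close>.
The powers of \<open>F\<close> bring \<open>u\<close> down to a fixed level \<open>V n1\<close>, and \<open>E\<close> brings the result back up to
a nonzero multiple of \<open>u\<close>; so its image in \<open>V n1\<close> is killed by \<open>E ^ (m - n1 + 1)\<close> but not by
\<open>E ^ (m - n1)\<close>. Images of highest weight vectors from different levels are separated in this way by
the kernels of the powers of \<open>E\<close>, hence independent, and \<open>V n1\<close> has room for finitely many only.\<close>

lemma sl2_string_finite:
  fixes scale :: "complex \<Rightarrow> 'v::ab_group_add \<Rightarrow> 'v" and V :: "nat \<Rightarrow> 'v set"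
  assumes vs: "vector_space scale"
    and linE: "Vector_Spaces.linear scale scale E" and linF: "Vector_Spaces.linear scale scale F"
    and fin: "\<And>n. \<exists>B. finite B \<and> V n \<subseteq> Modules.module.span scale B"
    and E: "\<And>n v. v \<in> V n \<Longrightarrow> E v \<in> V (Suc n)" and F: "\<And>n v. v \<in> V (Suc n) \<Longrightarrow> F v \<in> V n"
    and comm: "\<And>n v. v \<in> V n \<Longrightarrow> E (F v) - F (E v) = scale (a + of_nat n * b) v"
    and b: "b \<noteq> 0"
    and nil: "\<And>v. \<exists>m. (E ^^ m) v = 0"
  shows "finite {n. \<exists>v\<in>V n. v \<noteq> 0}"
proof (rule ccontr)
  assume inf: "infinite {n. \<exists>v\<in>V n. v \<noteq> 0}"
  interpret vector_space scale by (rule vs)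
  interpret E: Vector_Spaces.linear scale scale E by (rule linE)
  interpret F: Vector_Spaces.linear scale scale F by (rule linF)
  have Epow0: "(E ^^ i) 0 = 0" for i by (induction i) (simp_all add: E.zero)
  have Epow_add: "(E ^^ i) (x + y) = (E ^^ i) x + (E ^^ i) y" for i x y
    by (induction i) (simp_all add: E.add)
  have Epow_scale: "(E ^^ i) (scale c x) = scale c ((E ^^ i) x)" for i c x
    by (induction i) (simp_all add: E.scale)
  have Epow_mono: "(E ^^ j) v = 0" if "(E ^^ i) v = 0" "i \<le> j" for i j v
  proof -
    have "(E ^^ j) v = (E ^^ (j - i)) ((E ^^ i) v)"
      using that(2) by (metis comp_apply funpow_add le_add_diff_inverse2)
    then show ?thesis by (simp add: that(1) Epow0)
  qed
  \<comment> \<open>The real part of \<open>(a + b (m - i / 2)) / b\<close> is positive for \<open>n1 \<le> m\<close> and \<open>i < m - n1\<close>.\<close>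
  obtain n1 :: nat where n1: "- Re (a / b) < real n1" by (meson reals_Archimedean2)
  have step: "E ((F ^^ Suc i) u) =
      scale (of_nat (Suc i) * (a + b * (of_nat m - of_nat i / 2))) ((F ^^ i) u)"
    if u: "u \<in> V m" "E u = 0" and i: "i \<le> m" for m u i
    using i
  proof (induction i)
    case 0
    from comm[OF u(1)] u(2) show ?case by (simp add: F.zero mult.commute)
  next
    case (Suc i)
    have mem: "(F ^^ j) u \<in> V (m - j)" if "j \<le> m" for j
      using that
    proof (induction j)
      case 0 then show ?case using u by simp
    next
      case (Suc j)
      then show ?case using F[of "(F ^^ j) u" "m - Suc j"] by (simp add: Suc_diff_Suc)
    qed
    let ?w = "(F ^^ Suc i) u"
    have "E (F ?w) = F (E ?w) + scale (a + of_nat (m - Suc i) * b) ?w"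
      using comm[OF mem[OF Suc.prems]] by (simp add: algebra_simps)
    also have "F (E ?w) = scale (of_nat (Suc i) * (a + b * (of_nat m - of_nat i / 2))) ?w"
      using Suc by (simp add: F.scale)
    finally have "E (F ?w) = scale (of_nat (Suc i) * (a + b * (of_nat m - of_nat i / 2))
        + (a + of_nat (m - Suc i) * b)) ?w"
      by (simp add: scale_left_distrib)
    also have "of_nat (Suc i) * (a + b * (of_nat m - of_nat i / 2)) + (a + of_nat (m - Suc i) * b)
       = of_nat (Suc (Suc i)) * (a + b * (of_nat m - of_nat (Suc i) / 2))"
      using Suc.prems by (simp add: of_nat_diff field_simps)
    finally show ?case by simp
  qed
  have low: "\<exists>w\<in>V n1. (E ^^ (m - n1)) w \<noteq> 0 \<and> (E ^^ Suc (m - n1)) w = 0"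
    if u: "u \<in> V m" "E u = 0" "u \<noteq> 0" and m: "n1 \<le> m" for m u
  proof -
    have Fm: "(F ^^ j) u \<in> V (m - j)" if "j \<le> m" for j
      using that
    proof (induction j)
      case 0 then show ?case using u by simp
    next
      case (Suc j)
      then show ?case using F[of "(F ^^ j) u" "m - Suc j"] by (simp add: Suc_diff_Suc)
    qed
    have "\<exists>c. c \<noteq> 0 \<and> (E ^^ i) ((F ^^ i) u) = scale c u" if "i \<le> m - n1" for i
      using that
    proof (induction i)
      case 0 then show ?case by (intro exI[of _ 1]) simp
    next
      case (Suc i)
      then obtain c where c: "c \<noteq> 0" "(E ^^ i) ((F ^^ i) u) = scale c u" by auto
      let ?c = "of_nat (Suc i) * (a + b * (of_nat m - of_nat i / 2)) :: complex"
      have "(E ^^ Suc i) ((F ^^ Suc i) u) = (E ^^ i) (E ((F ^^ Suc i) u))"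
        by (simp only: funpow_Suc_right comp_apply)
      also have "\<dots> = scale (?c * c) u"
        using step[OF u(1,2), of i] Suc.prems by (simp add: Epow_scale c(2))
      finally have eq: "(E ^^ Suc i) ((F ^^ Suc i) u) = scale (?c * c) u" .
      have "real i < real m - real n1" using Suc.prems m by linarith
      then have "Re (a / b) + (real m - real i / 2) > 0" using n1 m by (simp add: field_simps)
      then have "Re (a / b + (of_nat m - of_nat i / 2)) \<noteq> 0" by (simp add: Re_divide_numeral)
      then have "a / b + (of_nat m - of_nat i / 2) \<noteq> 0" by (metis zero_complex.sel(1))
      then have "a + b * (of_nat m - of_nat i / 2) \<noteq> 0" using b
        by (metis (no_types, lifting) add_divide_distrib divide_eq_0_iff nonzero_mult_div_cancel_left)
      then have "?c * c \<noteq> 0" using c(1) by (simp del: of_nat_Suc)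
      with eq show ?case by blast
    qed
    then obtain c where c: "c \<noteq> 0" "(E ^^ (m - n1)) ((F ^^ (m - n1)) u) = scale c u" by blast
    have "(E ^^ Suc (m - n1)) ((F ^^ (m - n1)) u) = 0"
      using c(2) u(2) by (simp add: E.scale)
    then show ?thesis using c u(3) Fm[of "m - n1"] m by (intro bexI[of _ "(F ^^ (m - n1)) u"]) auto
  qed
  define S where "S = {m. n1 \<le> m \<and> (\<exists>u\<in>V m. E u = 0 \<and> u \<noteq> 0)}"
  have "\<exists>m\<in>S. n \<le> m" for n
  proof -
    obtain p v where pv: "max n n1 \<le> p" "v \<in> V p" "v \<noteq> 0"
      using inf[unfolded finite_nat_set_iff_bounded_le] nat_le_linear by blast
    \<comment> \<open>The last nonzero vector among the powers of \<open>E\<close> applied to \<open>v\<close> has highest weight.\<close>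
    define s where "s = (LEAST s. (E ^^ s) v = 0)"
    have s: "(E ^^ s) v = 0" unfolding s_def using nil[of v] by (rule LeastI_ex)
    have "s \<noteq> 0" using s pv(3) by (cases s) auto
    then obtain r where r: "s = Suc r" by (cases s) auto
    have "(E ^^ r) v \<noteq> 0" using r not_less_Least[of r "\<lambda>s. (E ^^ s) v = 0"] unfolding s_def by auto
    moreover have "(E ^^ r) v \<in> V (p + r)" by (induction r) (simp_all add: pv E)
    moreover have "E ((E ^^ r) v) = 0" using s r by simp
    ultimately have "p + r \<in> S" using pv(1) unfolding S_def by auto
    then show ?thesis using pv(1) by (intro bexI[of _ "p + r"]) auto
  qed
  then have infS: "infinite S" unfolding finite_nat_set_iff_bounded_le by (metis Suc_n_not_le_n le_trans)
  have "\<forall>m\<in>S. \<exists>w\<in>V n1. (E ^^ (m - n1)) w \<noteq> 0 \<and> (E ^^ Suc (m - n1)) w = 0"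
    using low unfolding S_def by blast
  then obtain w where w: "\<And>m. m \<in> S \<Longrightarrow> w m \<in> V n1 \<and> (E ^^ (m - n1)) (w m) \<noteq> 0 \<and> (E ^^ Suc (m - n1)) (w m) = 0"
    by metis
  have ind: "independent (w ` A) \<and> card (w ` A) = card A" if "finite A" "A \<subseteq> S" for A
    using that
  proof (induction A rule: finite_linorder_max_induct)
    case empty then show ?case by (simp add: independent_empty)
  next
    case (insert m A)
    have sub: "subspace {v. (E ^^ (m - n1)) v = 0}"
      by (rule subspaceI) (simp_all add: Epow0 Epow_add Epow_scale)
    have "w ` A \<subseteq> {v. (E ^^ (m - n1)) v = 0}"
    proof clarify
      fix x assume x: "x \<in> A"
      then have "Suc (x - n1) \<le> m - n1" using insert.hyps insert.prems unfolding S_def by fastforce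
      moreover have "(E ^^ Suc (x - n1)) (w x) = 0" using w x insert.prems by blast
      ultimately show "(E ^^ (m - n1)) (w x) = 0" using Epow_mono by blast
    qed
    then have "span (w ` A) \<subseteq> {v. (E ^^ (m - n1)) v = 0}" using sub by (rule span_minimal)
    then have "w m \<notin> span (w ` A)" using w[of m] insert.prems by auto
    moreover from this have "w m \<notin> w ` A" using span_base by blast
    moreover have "m \<notin> A" using insert.hyps by blast
    ultimately show ?case using insert by (simp add: independent_insertI)
  qed
  obtain B where B: "finite B" "V n1 \<subseteq> span B" using fin by blast
  obtain A where A: "A \<subseteq> S" "finite A" "card A = Suc (card B)"
    using infinite_arbitrarily_large[OF infS] by blast
  have "w ` A \<subseteq> span B" using w A(1) B(2) by blast
  then have "card (w ` A) \<le> card B" using independent_span_bound[OF B(1)] ind[OF A(2,1)] by blast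
  then show False using ind[OF A(2,1)] A(3) by simp
qed

section \<open>Entries of superbrackets\<close>

lemma square_mat_eqI:
  assumes "X \<in> carrier_mat n n" and "Y \<in> carrier_mat n n"
    and "\<And>i j. i < n \<Longrightarrow> j < n \<Longrightarrow> X $$ (i, j) = Y $$ (i, j)"
  shows "X = Y"
  using assms by (intro eq_matI) auto

lemma smult_one_mat: "1 \<cdot>\<^sub>m X = (X :: complex mat)"
  by (rule eq_matI) simp_all

lemma smult_smult_mat: "a \<cdot>\<^sub>m (b \<cdot>\<^sub>m X) = (a * b) \<cdot>\<^sub>m (X :: complex mat)"
  by (rule eq_matI) simp_all

text \<open>An entry of a product of two matrices is a sum over an intermediate index \<open>a\<close>. Both factors are odd
in this term exactly if the block changes from \<open>i\<close> to \<open>a\<close> and again from \<open>a\<close> to \<open>j\<close>.\<close>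

definition bracket_sign :: "nat \<Rightarrow> nat \<Rightarrow> nat \<Rightarrow> nat \<Rightarrow> complex" where
  "bracket_sign m i a j = (if (i < m) \<noteq> (a < m) \<and> (a < m) \<noteq> (j < m) then -1 else 1)"

lemma even_part_carrier [simp]: "X \<in> carrier_mat n n \<Longrightarrow> even_part m X \<in> carrier_mat n n"
  by (auto simp: even_part_def)

lemma odd_part_carrier [simp]: "X \<in> carrier_mat n n \<Longrightarrow> odd_part m X \<in> carrier_mat n n"
  by (auto simp: odd_part_def)

lemma superbracket_carrier [simp]:
  assumes X: "X \<in> carrier_mat n n" and Y: "Y \<in> carrier_mat n n"
  shows "superbracket m X Y \<in> carrier_mat n n"
proof -
  note c = X Y even_part_carrier[OF X, of m] odd_part_carrier[OF X, of m]
    even_part_carrier[OF Y, of m] odd_part_carrier[OF Y, of m]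
  show ?thesis unfolding superbracket_def
    by (intro add_carrier_mat mult_carrier_mat[OF c(6) c(4)])
qed

lemma parts_dim [simp]:
  "dim_row (even_part m X) = dim_row X" "dim_col (even_part m X) = dim_col X"
  "dim_row (odd_part m X) = dim_row X" "dim_col (odd_part m X) = dim_col X"
  by (simp_all add: even_part_def odd_part_def)

lemma even_part_index:
  "X \<in> carrier_mat n n \<Longrightarrow> i < n \<Longrightarrow> j < n \<Longrightarrow>
    even_part m X $$ (i, j) = (if i < m \<longleftrightarrow> j < m then X $$ (i, j) else 0)"
  by (auto simp: even_part_def)

lemma odd_part_index:
  "X \<in> carrier_mat n n \<Longrightarrow> i < n \<Longrightarrow> j < n \<Longrightarrow>
    odd_part m X $$ (i, j) = (if i < m \<longleftrightarrow> j < m then 0 else X $$ (i, j))"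
  by (auto simp: odd_part_def)

lemma mat_mult_index:
  "X \<in> carrier_mat n n \<Longrightarrow> Y \<in> carrier_mat n n \<Longrightarrow> i < n \<Longrightarrow> j < n \<Longrightarrow>
    (X * Y) $$ (i, j) = (\<Sum>a<n. X $$ (i, a) * Y $$ (a, j))"
  by (auto simp: scalar_prod_def atLeast0LessThan intro!: sum.cong)

lemma superbracket_index:
  assumes X: "X \<in> carrier_mat n n" and Y: "Y \<in> carrier_mat n n" and "i < n" and "j < n"
  shows "superbracket m X Y $$ (i, j) =
    (\<Sum>a<n. X $$ (i, a) * Y $$ (a, j) - bracket_sign m i a j * (Y $$ (i, a) * X $$ (a, j)))"
proof -
  have "superbracket m X Y $$ (i, j) =
     (X * Y) $$ (i, j) - (Y * even_part m X) $$ (i, j) - (even_part m Y * odd_part m X) $$ (i, j)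
       + (odd_part m Y * odd_part m X) $$ (i, j)"
  proof -
    have *: "(P - Q - R + S) $$ (i, j) = P $$ (i, j) - Q $$ (i, j) - R $$ (i, j) + S $$ (i, j)"
      if "P \<in> carrier_mat n n" "Q \<in> carrier_mat n n" "R \<in> carrier_mat n n" "S \<in> carrier_mat n n"
      for P Q R S :: "complex mat"
      using that assms(3,4) by auto
    show ?thesis unfolding superbracket_def
      by (rule *) (intro mult_carrier_mat[of _ n n] even_part_carrier odd_part_carrier X Y)+
  qed
  also have "\<dots> = (\<Sum>a<n. X $$ (i, a) * Y $$ (a, j) - bracket_sign m i a j * (Y $$ (i, a) * X $$ (a, j)))"
    unfolding mat_mult_index[OF X Y assms(3,4)]
      mat_mult_index[OF Y even_part_carrier[OF X] assms(3,4)]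
      mat_mult_index[OF even_part_carrier[OF Y] odd_part_carrier[OF X] assms(3,4)]
      mat_mult_index[OF odd_part_carrier[OF Y] odd_part_carrier[OF X] assms(3,4)]
      sum_subtractf[symmetric] sum.distrib[symmetric]
    by (rule sum.cong)
      (use assms in \<open>auto simp: even_part_index[OF X] odd_part_index[OF X]
        even_part_index[OF Y] odd_part_index[OF Y] bracket_sign_def\<close>)
  finally show ?thesis .
qed

section \<open>The automorphisms as signed permutations of the entries\<close>

context twisted_affine begin

abbreviation N :: nat where "N \<equiv> m1 + m2"

text \<open>The twist (in type \<open>D\<close> the bilinear form) pairs the indices: the diagonal entries at \<open>i\<close> and \<open>star i\<close> of a diagonal matrix in the
Cartan subalgebra are opposite to each other. In the \<open>A\<close> types this is the reflection of each block,
in type \<open>D\<close> it exchanges the two halves of each block.\<close>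

definition star :: "nat \<Rightarrow> nat" where
  "star i =
     (if T = D_type then
        if i < k + 1 then i + (k + 1) else if i < 2 * k + 2 then i - (k + 1)
        else if i < 2 * k + 2 + l then i + l else i - l
      else if i < m1 then m1 - 1 - i else 2 * m1 + m2 - 1 - i)"

definition omega :: "nat \<Rightarrow> complex" where
  "omega i =
     (if T = D_type then if i < 2 * k + 2 + l then 1 else -1
      else if i < m1 then J1_entry T k (i + 1) else J2_entry T l (i - m1 + 1))"

lemma star_less [simp]: "i < N \<Longrightarrow> star i < N"
  unfolding star_def by (cases T) auto

lemma star_star [simp]: "i < N \<Longrightarrow> star (star i) = i"
  unfolding star_def by (cases T) auto

lemma star_upper [simp]: "i < N \<Longrightarrow> star i < m1 \<longleftrightarrow> i < m1"
  unfolding star_def by (cases T) auto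

lemma star_inj: "i < N \<Longrightarrow> j < N \<Longrightarrow> star i = star j \<longleftrightarrow> i = j"
  by (metis star_star)

lemma star_bij: "bij_betw star {..<N} {..<N}"
  by (rule bij_betwI[where g = star]) auto

lemma sum_star: "(\<Sum>i<N. f (star i)) = (\<Sum>i<N. f i)"
  using sum.reindex_bij_betw[OF star_bij] .

lemma cnj_omega: "cnj (omega i) * omega i = 1"
  unfolding omega_def by (cases T) (auto simp flip: power_mult_distrib)

lemma omega_nonzero [simp]: "omega i \<noteq> 0"
  using cnj_omega[of i] by force

lemma omega_square: "T \<noteq> A_even_even \<or> i \<noteq> m1 + l \<Longrightarrow> omega i * omega i = 1"
  unfolding omega_def by (cases T) (auto simp flip: power_mult_distrib)

definition super_sign :: "nat \<Rightarrow> nat \<Rightarrow> complex" where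
  "super_sign i j = (if i < m1 \<and> \<not> j < m1 then -1 else 1)"

text \<open>A signed transposition along the pairing \<open>star\<close>. In the \<open>A\<close> types it is the automorphism of the
matrix algebra; in type \<open>D\<close> its fixed points form the orthosymplectic algebra. Treating both roles
with one map makes the proofs below uniform in the four types.\<close>

definition theta :: "complex mat \<Rightarrow> complex mat" where
  "theta X = mat N N (\<lambda>(i, j). - super_sign i j * omega i / omega j * X $$ (star j, star i))"

lemma theta_carrier [simp]: "theta X \<in> carrier_mat N N"
  by (simp add: theta_def)

lemma theta_dim [simp]: "dim_row (theta X) = N" "dim_col (theta X) = N"
  by (simp_all add: theta_def)

lemma theta_index:
  "i < N \<Longrightarrow> j < N \<Longrightarrow> theta X $$ (i, j) = - super_sign i j * omega i / omega j * X $$ (star j, star i)"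
  by (simp add: theta_def)

text \<open>Transposition reverses products, and the sign of the odd terms is absorbed by the cocycle identity
that \<open>super_sign i a * super_sign a j\<close> equals \<open>super_sign i j\<close> times the bracket sign of
\<open>i\<close>, \<open>a\<close> and \<open>j\<close>.\<close>

lemma theta_superbracket:
  assumes X: "X \<in> carrier_mat N N" and Y: "Y \<in> carrier_mat N N"
  shows "theta (superbracket m1 X Y) = superbracket m1 (theta X) (theta Y)"
proof (rule square_mat_eqI[where n = N])
  fix i j assume i: "i < N" and j: "j < N"
  have "theta (superbracket m1 X Y) $$ (i, j) = - super_sign i j * omega i / omega j *
    (\<Sum>a<N. X $$ (star j, star a) * Y $$ (star a, star i)
        - bracket_sign m1 (star j) (star a) (star i) * (Y $$ (star j, star a) * X $$ (star a, star i)))"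
    using i j sum_star[of "\<lambda>a. X $$ (star j, a) * Y $$ (a, star i)
        - bracket_sign m1 (star j) a (star i) * (Y $$ (star j, a) * X $$ (a, star i))"]
    by (simp only: theta_index superbracket_index[OF X Y] star_less)
  also have "\<dots> = (\<Sum>a<N. theta X $$ (i, a) * theta Y $$ (a, j)
      - bracket_sign m1 i a j * (theta Y $$ (i, a) * theta X $$ (a, j)))"
    unfolding sum_distrib_left
    by (rule sum.cong) (use i j in \<open>auto simp: theta_index super_sign_def bracket_sign_def field_simps\<close>)
  also have "\<dots> = superbracket m1 (theta X) (theta Y) $$ (i, j)"
    by (rule superbracket_index[symmetric]) (use i j in auto)
  finally show "theta (superbracket m1 X Y) $$ (i, j) = superbracket m1 (theta X) (theta Y) $$ (i, j)" .
qed simp_all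

lemma theta_add: "X \<in> carrier_mat N N \<Longrightarrow> Y \<in> carrier_mat N N \<Longrightarrow> theta (X + Y) = theta X + theta Y"
  by (rule square_mat_eqI[where n = N]) (simp_all add: theta_index distrib_left)

lemma theta_smult: "X \<in> carrier_mat N N \<Longrightarrow> theta (c \<cdot>\<^sub>m X) = c \<cdot>\<^sub>m theta X"
  by (rule square_mat_eqI[where n = N]) (simp_all add: theta_index)

lemma theta_even_part: "X \<in> carrier_mat N N \<Longrightarrow> theta (even_part m1 X) = even_part m1 (theta X)"
  by (rule square_mat_eqI[where n = N]) (simp_all add: even_part_index[of _ N] theta_index)

lemma theta_odd_part: "X \<in> carrier_mat N N \<Longrightarrow> theta (odd_part m1 X) = odd_part m1 (theta X)"
  by (rule square_mat_eqI[where n = N]) (simp_all add: odd_part_index[of _ N] theta_index)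

text \<open>The permutation of the indices that conjugation by \<open>H\<close> performs in type \<open>D\<close>.\<close>

definition swap_ends :: "nat \<Rightarrow> nat" where
  "swap_ends i = (if i = k then 2 * k + 1 else if i = 2 * k + 1 then k else i)"

lemma antidiagonal_mult_index:
  assumes "A \<in> carrier_mat n n'" "i < n" "j < n'"
  shows "(antidiagonal n e * A) $$ (i, j) = e (i + 1) * A $$ (n - 1 - i, j)"
proof -
  have "(antidiagonal n e * A) $$ (i, j) = (\<Sum>a\<in>{0..<n}. antidiagonal n e $$ (i, a) * A $$ (a, j))"
    using assms by (auto simp: scalar_prod_def antidiagonal_def intro!: sum.cong)
  also have "\<dots> = (\<Sum>a\<in>{0..<n}. (if a = n - 1 - i then e (i + 1) * A $$ (n - 1 - i, j) else 0))"
    by (rule sum.cong) (use assms in \<open>auto simp: antidiagonal_def\<close>)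
  finally show ?thesis using assms by simp
qed

lemma mult_antidiagonal_index:
  assumes "A \<in> carrier_mat n' n" "i < n'" "j < n"
  shows "(A * antidiagonal n e) $$ (i, j) = A $$ (i, n - 1 - j) * e (n - j)"
proof -
  have "(A * antidiagonal n e) $$ (i, j) = (\<Sum>a\<in>{0..<n}. A $$ (i, a) * antidiagonal n e $$ (a, j))"
    using assms by (auto simp: scalar_prod_def antidiagonal_def intro!: sum.cong)
  also have "\<dots> = (\<Sum>a\<in>{0..<n}. (if a = n - 1 - j then A $$ (i, n - 1 - j) * e (n - j) else 0))"
    by (rule sum.cong) (use assms in \<open>auto simp: antidiagonal_def Suc_diff_Suc\<close>)
  finally show ?thesis using assms by simp
qed

lemma matrix_inverse_eqI:
  assumes A: "A \<in> carrier_mat n n" and B: "B \<in> carrier_mat n n" and AB: "A * B = 1\<^sub>m n"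
  shows "matrix_inverse A = B"
proof -
  have BA: "B * A = 1\<^sub>m n" using mat_mult_left_right_inverse[OF A B AB] .
  then have "A \<in> Units (ring_mat TYPE(complex) n undefined)"
    using A B AB unfolding Units_def ring_mat_def by auto
  then obtain C where C: "mat_inverse A = Some C"
    using mat_inverse(1)[OF A, of undefined] by (cases "mat_inverse A") auto
  then have "A * C = 1\<^sub>m n" "C * A = 1\<^sub>m n" "C \<in> carrier_mat n n"
    using mat_inverse(2)[OF A C] by auto
  then have "C = B" using assoc_mult_mat[of C n n A n B n] A B AB by simp
  then show ?thesis using C by (simp add: matrix_inverse_def)
qed

lemma antidiagonal_inverse:
  assumes "\<And>r. e r \<noteq> 0"
  shows "matrix_inverse (antidiagonal n e) = antidiagonal n (\<lambda>r. 1 / e (n + 1 - r))"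
proof (rule matrix_inverse_eqI)
  show "antidiagonal n e * antidiagonal n (\<lambda>r. 1 / e (n + 1 - r)) = 1\<^sub>m n"
  proof (rule eq_matI)
    fix i j assume "i < dim_row (1\<^sub>m n :: complex mat)" "j < dim_col (1\<^sub>m n :: complex mat)"
    then show "(antidiagonal n e * antidiagonal n (\<lambda>r. 1 / e (n + 1 - r))) $$ (i, j) = 1\<^sub>m n $$ (i, j)"
      using assms by (subst antidiagonal_mult_index[where n' = n])
        (auto simp: antidiagonal_def Suc_diff_Suc)
  qed (auto simp: antidiagonal_def)
qed (auto simp: antidiagonal_def)

lemma antidiagonal_sandwich_index:
  assumes A: "A \<in> carrier_mat n' n" and e': "\<And>r. e' r \<noteq> 0" and "i < n" "j < n'"
  shows "(antidiagonal n e * A\<^sup>T * matrix_inverse (antidiagonal n' e')) $$ (i, j) =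
    e (i + 1) / e' (j + 1) * A $$ (n' - 1 - j, n - 1 - i)"
proof -
  let ?B = "antidiagonal n e * A\<^sup>T" and ?C = "antidiagonal n' (\<lambda>r. 1 / e' (n' + 1 - r))"
  have B: "?B \<in> carrier_mat n n'" using A by (auto simp: antidiagonal_def)
  have "(?B * ?C) $$ (i, j) = ?B $$ (i, n' - 1 - j) / e' (j + 1)"
    using mult_antidiagonal_index[OF B assms(3,4)] assms(4) by (simp add: Suc_diff_le)
  also have "?B $$ (i, n' - 1 - j) = e (i + 1) * A $$ (n' - 1 - j, n - 1 - i)"
    using assms by (subst antidiagonal_mult_index[where n' = n']) auto
  finally show ?thesis using antidiagonal_inverse[of e' n'] e' by simp
qed

lemma J1_entry_nonzero: "J1_entry T k r \<noteq> 0"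
  by (cases T) auto

lemma J2_entry_nonzero: "J2_entry T l r \<noteq> 0"
  by (cases T) auto

lemma sigma_matrix_A:
  assumes T: "T \<noteq> D_type" and X: "X \<in> carrier_mat N N"
  shows "sigma_matrix X = theta X"
proof -
  obtain A B C E where s: "split_block X m1 m1 = (A, B, C, E)" by (metis prod_cases4)
  have car: "A \<in> carrier_mat m1 m1" "B \<in> carrier_mat m1 m2" "C \<in> carrier_mat m2 m1" "E \<in> carrier_mat m2 m2"
    and X4: "X = four_block_mat A B C E"
    using split_block[OF s, of m2 m2] X by auto
  have sm: "sigma_matrix X = four_block_mat
          (- (J1 * A\<^sup>T * matrix_inverse J1)) (J1 * C\<^sup>T * matrix_inverse J2)
          (- (J2 * B\<^sup>T * matrix_inverse J1)) (- (J2 * E\<^sup>T * matrix_inverse J2))"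
    using T by (simp add: sigma_matrix_def s)
  have dims [simp]: "dim_row J1 = m1" "dim_col J1 = m1" "dim_row J2 = m2" "dim_col J2 = m2"
    "dim_row (matrix_inverse J1) = m1" "dim_col (matrix_inverse J1) = m1"
    "dim_row (matrix_inverse J2) = m2" "dim_col (matrix_inverse J2) = m2"
    unfolding J1_def J2_def antidiagonal_inverse[OF J1_entry_nonzero] antidiagonal_inverse[OF J2_entry_nonzero]
    by (simp_all add: antidiagonal_def)
  note sand = antidiagonal_sandwich_index[where n = m1 and n' = m1 and e = "J1_entry T k" and e' = "J1_entry T k",
      OF _ J1_entry_nonzero, folded J1_def]
    antidiagonal_sandwich_index[where n = m2 and n' = m1 and e = "J2_entry T l" and e' = "J1_entry T k",
      OF _ J1_entry_nonzero, folded J1_def J2_def]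
    antidiagonal_sandwich_index[where n = m1 and n' = m2 and e = "J1_entry T k" and e' = "J2_entry T l",
      OF _ J2_entry_nonzero, folded J1_def J2_def]
    antidiagonal_sandwich_index[where n = m2 and n' = m2 and e = "J2_entry T l" and e' = "J2_entry T l",
      OF _ J2_entry_nonzero, folded J2_def]
  show ?thesis
  proof (rule square_mat_eqI[where n = N])
    show "sigma_matrix X \<in> carrier_mat N N"
      unfolding sm by (rule four_block_carrier_mat[of _ m1 m1 _ m2 m2]) (rule carrier_matI; simp)+
    fix i j assume i: "i < N" and j: "j < N"
    have st: "star a = (if a < m1 then m1 - 1 - a else m1 + (m2 - 1 - (a - m1)))" if "a < N" for a
      using T that by (auto simp: star_def)
    have om: "omega a = (if a < m1 then J1_entry T k (a + 1) else J2_entry T l (a - m1 + 1))" for a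
      using T by (auto simp: omega_def)
    have sl: "sigma_matrix X $$ (i, j) =
      (if i < m1 then if j < m1 then - ((J1 * A\<^sup>T * matrix_inverse J1) $$ (i, j))
                      else (J1 * C\<^sup>T * matrix_inverse J2) $$ (i, j - m1)
       else if j < m1 then - ((J2 * B\<^sup>T * matrix_inverse J1) $$ (i - m1, j))
       else - ((J2 * E\<^sup>T * matrix_inverse J2) $$ (i - m1, j - m1)))"
      unfolding sm using i j by (auto simp del: index_mult_mat(1))
    have Xs: "X $$ (star j, star i) =
      (if i < m1 then if j < m1 then A $$ (m1 - 1 - j, m1 - 1 - i) else C $$ (m2 - 1 - (j - m1), m1 - 1 - i)
       else if j < m1 then B $$ (m1 - 1 - j, m2 - 1 - (i - m1))
       else E $$ (m2 - 1 - (j - m1), m2 - 1 - (i - m1)))"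
      unfolding X4 using i j car by (auto simp: st)
    have i': "\<not> i < m1 \<Longrightarrow> i - m1 < m2" and j': "\<not> j < m1 \<Longrightarrow> j - m1 < m2" using i j by auto
    show "sigma_matrix X $$ (i, j) = theta X $$ (i, j)" (is ?g)
    proof (cases "i < m1"; cases "j < m1")
      assume a: "i < m1" "j < m1"
      show ?g using sand(1)[OF car(1) a] a by (simp only: sl theta_index[OF i j] Xs om super_sign_def if_True if_False)
        (simp del: index_mult_mat(1))
    next
      assume a: "i < m1" "\<not> j < m1"
      show ?g using sand(3)[OF car(3) a(1) j'[OF a(2)]] a by (simp only: sl theta_index[OF i j] Xs om super_sign_def if_True if_False)
        (simp del: index_mult_mat(1))
    next
      assume a: "\<not> i < m1" "j < m1"
      show ?g using sand(2)[OF car(2) i'[OF a(1)] a(2)] a by (simp only: sl theta_index[OF i j] Xs om super_sign_def if_True if_False)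
        (simp del: index_mult_mat(1))
    next
      assume a: "\<not> i < m1" "\<not> j < m1"
      show ?g using sand(4)[OF car(4) i'[OF a(1)] j'[OF a(2)]] a by (simp only: sl theta_index[OF i j] Xs om super_sign_def if_True if_False)
        (simp del: index_mult_mat(1))
    qed
  qed simp
qed

lemma sigma_matrix_D:
  assumes T: "T = D_type" and X: "X \<in> carrier_mat N N"
  shows "sigma_matrix X = mat N N (\<lambda>(i, j). X $$ (swap_ends i, swap_ends j))"
proof -
  have H: "H \<in> carrier_mat N N" by (simp add: H_def)
  have Hi: "H $$ (i, j) = (if j = swap_ends i then 1 else 0)" if "i < N" "j < N" for i j
    unfolding H_def swaprows_mat_def using that T by (auto simp: swap_ends_def)
  have sw: "i < N \<Longrightarrow> swap_ends i < N" "swap_ends (swap_ends i) = i" for i using T by (auto simp: swap_ends_def)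
  have HA: "(H * A) $$ (i, j) = A $$ (swap_ends i, j)" if "A \<in> carrier_mat N N" "i < N" "j < N" for A i j
  proof -
    have "(H * A) $$ (i, j) = (\<Sum>a<N. if a = swap_ends i then A $$ (a, j) else 0)"
      unfolding mat_mult_index[OF H that] by (rule sum.cong) (use that in \<open>auto simp: Hi\<close>)
    then show ?thesis using sw that by simp
  qed
  have "H * H = 1\<^sub>m N"
    by (rule square_mat_eqI[where n = N])
      (use H sw in \<open>auto simp: HA[OF H] Hi simp del: index_mult_mat(1)\<close>)
  then have inv: "matrix_inverse H = H" by (rule matrix_inverse_eqI[OF H H])
  have HX: "H * X \<in> carrier_mat N N" using H X by simp
  have sm: "sigma_matrix X = H * X * H"
    unfolding sigma_matrix_def inv using T by simp
  show ?thesis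
  proof (rule square_mat_eqI[where n = N])
    show "sigma_matrix X \<in> carrier_mat N N" unfolding sm by (rule mult_carrier_mat[OF HX H])
    fix i j assume i: "i < N" and j: "j < N"
    have "(H * X * H) $$ (i, j) = (\<Sum>a<N. if a = swap_ends j then X $$ (swap_ends i, a) else 0)"
      unfolding mat_mult_index[OF HX H i j]
      by (rule sum.cong) (use i j sw in \<open>auto simp: HA[OF X] Hi\<close>)
    also have "\<dots> = X $$ (swap_ends i, swap_ends j)"
      using sw(1)[OF j] by (subst sum.delta) auto
    finally show "sigma_matrix X $$ (i, j) = mat N N (\<lambda>(i, j). X $$ (swap_ends i, swap_ends j)) $$ (i, j)"
      using i j by (simp add: sm)
  qed simp
qed

end

section \<open>The orthosymplectic algebra as a fixed point algebra\<close>

lemma four_block_index: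
  assumes "A \<in> carrier_mat a b" "E \<in> carrier_mat c d" "i < a + c" "j < b + d"
  shows "four_block_mat A B C E $$ (i, j) =
        (if i < a then if j < b then A $$ (i, j) else B $$ (i, j - b)
         else if j < b then C $$ (i - a, j) else E $$ (i - a, j - b))"
  using assms by auto

definition osp_block_matrix ::
  "complex mat \<Rightarrow> complex mat \<Rightarrow> complex mat \<Rightarrow> complex mat \<Rightarrow> complex mat \<Rightarrow> complex mat
     \<Rightarrow> complex mat \<Rightarrow> complex mat \<Rightarrow> complex mat \<Rightarrow> complex mat \<Rightarrow> complex mat" where
  "osp_block_matrix x y z m n p q r s u =
     four_block_mat
        (four_block_mat x y z (- x\<^sup>T)) (four_block_mat m n p q)
        (four_block_mat (- q\<^sup>T) (- n\<^sup>T) p\<^sup>T m\<^sup>T) (four_block_mat r s u (- r\<^sup>T))"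

lemma osp_block_matrix_index:
  fixes x y z m n p q r s u :: "complex mat"
  assumes car [simp]: "x \<in> carrier_mat h h" "y \<in> carrier_mat h h" "z \<in> carrier_mat h h"
      "m \<in> carrier_mat h l" "n \<in> carrier_mat h l" "p \<in> carrier_mat h l" "q \<in> carrier_mat h l"
      "r \<in> carrier_mat l l" "s \<in> carrier_mat l l" "u \<in> carrier_mat l l"
    and ij: "i < h + h + (l + l)" "j < h + h + (l + l)"
  shows "osp_block_matrix x y z m n p q r s u $$ (i, j) =
     (if i < h then
        if j < h then x $$ (i, j) else if j < h + h then y $$ (i, j - h)
        else if j < h + h + l then m $$ (i, j - (h + h)) else n $$ (i, j - (h + h) - l)
      else if i < h + h then
        if j < h then z $$ (i - h, j) else if j < h + h then - x $$ (j - h, i - h)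
        else if j < h + h + l then p $$ (i - h, j - (h + h)) else q $$ (i - h, j - (h + h) - l)
      else if i < h + h + l then
        if j < h then - q $$ (j, i - (h + h)) else if j < h + h then - n $$ (j - h, i - (h + h))
        else if j < h + h + l then r $$ (i - (h + h), j - (h + h)) else s $$ (i - (h + h), j - (h + h) - l)
      else
        if j < h then p $$ (j, i - (h + h) - l) else if j < h + h then m $$ (j - h, i - (h + h) - l)
        else if j < h + h + l then u $$ (i - (h + h) - l, j - (h + h))
        else - r $$ (j - (h + h) - l, i - (h + h) - l))"
proof -
  note dims = car[THEN carrier_matD(1)] car[THEN carrier_matD(2)]
  have ranges: "i < h \<or> h \<le> i \<and> i < h + h \<or> h + h \<le> i \<and> i < h + h + l \<or> h + h + l \<le> i" for i
    by linarith
  have P: "four_block_mat x y z (- x\<^sup>T) \<in> carrier_mat (h + h) (h + h)"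
    and S: "four_block_mat r s u (- r\<^sup>T) \<in> carrier_mat (l + l) (l + l)"
    by (rule four_block_carrier_mat; simp)+
  show ?thesis
    unfolding osp_block_matrix_def four_block_index[OF P S ij]
    using ij ranges[of i] ranges[of j]
    apply (elim disjE conjE)
    apply (simp_all add: four_block_index[where a = h and c = h and b = h and d = h]
        four_block_index[where a = h and c = h and b = l and d = l]
        four_block_index[where a = l and c = l and b = h and d = h]
        four_block_index[where a = l and c = l and b = l and d = l] dims less_diff_conv2
        del: index_mat_four_block)
    done
qed

context twisted_affine begin

definition parity_sign :: "nat \<Rightarrow> complex" where
  "parity_sign i = (if i < m1 then 1 else -1)"

lemma supertrace_eq_sum:
  assumes "X \<in> carrier_mat N N"
  shows "supertrace m1 X = (\<Sum>i<N. parity_sign i * X $$ (i, i))"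
proof -
  have "(\<Sum>i\<in>{0..<N}. parity_sign i * X $$ (i, i)) =
      (\<Sum>i\<in>{0..<m1}. parity_sign i * X $$ (i, i)) + (\<Sum>i\<in>{m1..<N}. parity_sign i * X $$ (i, i))"
    by (rule sum.atLeastLessThan_concat[symmetric]) simp_all
  moreover have "(\<Sum>i\<in>{0..<m1}. parity_sign i * X $$ (i, i)) = (\<Sum>i\<in>{0..<m1}. X $$ (i, i))"
    by (rule sum.cong) (simp_all add: parity_sign_def)
  moreover have "(\<Sum>i\<in>{m1..<N}. parity_sign i * X $$ (i, i)) = (\<Sum>i\<in>{m1..<N}. - X $$ (i, i))"
    by (rule sum.cong) (simp_all add: parity_sign_def)
  ultimately show ?thesis using carrier_matD(1)[OF assms]
    by (simp add: supertrace_def sum_negf atLeast0LessThan)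
qed

lemma bracket_sign_parity: "bracket_sign m1 i a i = parity_sign i * parity_sign a"
  unfolding bracket_sign_def parity_sign_def by (cases "i < m1"; cases "a < m1") simp_all

text \<open>Interchanging the two summation indices exchanges the two products, since the bracket sign of
\<open>i\<close>, \<open>a\<close> and \<open>i\<close> is the product of the parities of \<open>i\<close> and \<open>a\<close>.\<close>

lemma supertrace_superbracket:
  assumes X: "X \<in> carrier_mat N N" and Y: "Y \<in> carrier_mat N N"
  shows "supertrace m1 (superbracket m1 X Y) = 0"
proof -
  have "supertrace m1 (superbracket m1 X Y) =
     (\<Sum>i<N. \<Sum>a<N. parity_sign i * (X $$ (i, a) * Y $$ (a, i)) - parity_sign a * (Y $$ (i, a) * X $$ (a, i)))"
    unfolding supertrace_eq_sum[OF superbracket_carrier[OF X Y]]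
    by (rule sum.cong) (auto simp: superbracket_index[OF X Y] sum_distrib_left bracket_sign_parity parity_sign_def
        intro!: sum.cong)
  also have "\<dots> = (\<Sum>i<N. \<Sum>a<N. parity_sign i * (X $$ (i, a) * Y $$ (a, i)))
      - (\<Sum>i<N. \<Sum>a<N. parity_sign a * (Y $$ (i, a) * X $$ (a, i)))"
    by (simp only: sum_subtractf)
  also have "(\<Sum>i<N. \<Sum>a<N. parity_sign a * (Y $$ (i, a) * X $$ (a, i))) =
      (\<Sum>i<N. \<Sum>a<N. parity_sign i * (X $$ (i, a) * Y $$ (a, i)))"
    by (subst sum.swap) (simp add: mult_ac)
  finally show ?thesis by simp
qed

lemma supertrace_theta:
  assumes X: "X \<in> carrier_mat N N"
  shows "supertrace m1 (theta X) = - supertrace m1 X"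
proof -
  have "supertrace m1 (theta X) = (\<Sum>i<N. - (parity_sign (star i) * X $$ (star i, star i)))"
    unfolding supertrace_eq_sum[OF theta_carrier]
    by (rule sum.cong) (auto simp: theta_index parity_sign_def super_sign_def)
  also have "\<dots> = - supertrace m1 X"
    using sum_star[of "\<lambda>i. parity_sign i * X $$ (i, i)"]
    unfolding supertrace_eq_sum[OF X] by (simp add: sum_negf)
  finally show ?thesis .
qed

lemma matrices_A: "T \<noteq> D_type \<Longrightarrow> matrices = {X \<in> carrier_mat N N. supertrace m1 X = 0}"
  by (simp add: matrices_def sl_matrices_def)

lemma osp_matrices_theta:
  assumes T: "T = D_type" and X: "X \<in> osp_matrices (k + 1) l"
  shows "X \<in> carrier_mat N N \<and> theta X = X"
proof -
  define h where "h = k + 1"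
  obtain x y z m n p q r s u where
    X: "X = four_block_mat
        (four_block_mat x y z (- x\<^sup>T)) (four_block_mat m n p q)
        (four_block_mat (- q\<^sup>T) (- n\<^sup>T) p\<^sup>T m\<^sup>T) (four_block_mat r s u (- r\<^sup>T))"
    and car [simp]: "x \<in> carrier_mat h h" "y \<in> carrier_mat h h" "z \<in> carrier_mat h h"
      "m \<in> carrier_mat h l" "n \<in> carrier_mat h l" "p \<in> carrier_mat h l" "q \<in> carrier_mat h l"
      "r \<in> carrier_mat l l" "s \<in> carrier_mat l l" "u \<in> carrier_mat l l"
    and sym: "y\<^sup>T = - y" "z\<^sup>T = - z" "s\<^sup>T = s" "u\<^sup>T = u"
    using X unfolding osp_matrices_def h_def[symmetric] by auto
  have m1: "m1 = h + h" and m2: "m2 = l + l" using T by (auto simp: h_def)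
  have st: "star i = (if i < h then i + h else if i < h + h then i - h
        else if i < h + h + l then i + l else i - l)" for i
    unfolding star_def h_def using T by simp
  have om: "omega i = (if i < h + h + l then 1 else -1)" for i
    unfolding omega_def h_def using T by simp
  have y: "y $$ (i, j) = - y $$ (j, i)" if "i < h" "j < h" for i j
    using arg_cong[OF sym(1), of "\<lambda>M. M $$ (j, i)"] that carrier_matD[OF car(2)] by simp
  have z: "z $$ (i, j) = - z $$ (j, i)" if "i < h" "j < h" for i j
    using arg_cong[OF sym(2), of "\<lambda>M. M $$ (j, i)"] that carrier_matD[OF car(3)] by simp
  have s: "s $$ (i, j) = s $$ (j, i)" if "i < l" "j < l" for i j
    using arg_cong[OF sym(3), of "\<lambda>M. M $$ (j, i)"] that carrier_matD[OF car(9)] by simp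
  have u: "u $$ (i, j) = u $$ (j, i)" if "i < l" "j < l" for i j
    using arg_cong[OF sym(4), of "\<lambda>M. M $$ (j, i)"] that carrier_matD[OF car(10)] by simp
  note dims = car[THEN carrier_matD(1)] car[THEN carrier_matD(2)]
  have XN: "X \<in> carrier_mat N N"
    by (rule carrier_matI) (simp_all add: X m1 m2 dims)
  have ranges: "i < h \<or> h \<le> i \<and> i < h + h \<or> h + h \<le> i \<and> i < h + h + l \<or> h + h + l \<le> i" for i
    by linarith
  have en: "X $$ (i, j) = (if i < h then
        if j < h then x $$ (i, j) else if j < h + h then y $$ (i, j - h)
        else if j < h + h + l then m $$ (i, j - (h + h)) else n $$ (i, j - (h + h) - l)
      else if i < h + h then
        if j < h then z $$ (i - h, j) else if j < h + h then - x $$ (j - h, i - h)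
        else if j < h + h + l then p $$ (i - h, j - (h + h)) else q $$ (i - h, j - (h + h) - l)
      else if i < h + h + l then
        if j < h then - q $$ (j, i - (h + h)) else if j < h + h then - n $$ (j - h, i - (h + h))
        else if j < h + h + l then r $$ (i - (h + h), j - (h + h)) else s $$ (i - (h + h), j - (h + h) - l)
      else
        if j < h then p $$ (j, i - (h + h) - l) else if j < h + h then m $$ (j - h, i - (h + h) - l)
        else if j < h + h + l then u $$ (i - (h + h) - l, j - (h + h))
        else - r $$ (j - (h + h) - l, i - (h + h) - l))"
    if "i < h + h + (l + l)" "j < h + h + (l + l)" for i j
    using osp_block_matrix_index[OF car that] unfolding X osp_block_matrix_def .
  have "theta X = X"
  proof (rule square_mat_eqI[where n = N])
    fix i j assume i: "i < N" and j: "j < N"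
    have i': "i < h + h + (l + l)" and j': "j < h + h + (l + l)" using i j m1 m2 by simp_all
    have si: "star i < h + h + (l + l)" and sj: "star j < h + h + (l + l)"
      using star_less[OF i] star_less[OF j] m1 m2 by simp_all
    show "theta X $$ (i, j) = X $$ (i, j)"
      using y[of i "j - h"] z[of j "i - h"] s[of "i - (h + h)" "j - (h + h) - l"] u[of "j - (h + h)" "i - (h + h) - l"]
        i' j' ranges[of i] ranges[of j]
      unfolding theta_index[OF i j] en[OF i' j'] en[OF sj si] super_sign_def m1
      apply (elim disjE conjE)
      apply (simp_all add: st om less_diff_conv2 add.commute[of l "h + h"])
      done
  qed (use XN in simp_all)
  with XN show ?thesis by simp
qed

lemma theta_fixed_osp:
  assumes T: "T = D_type" and X: "X \<in> carrier_mat N N" and fixed: "theta X = X"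
  shows "X \<in> osp_matrices (k + 1) l"
proof -
  define h where "h = k + 1"
  have m1: "m1 = h + h" and m2: "m2 = l + l" using T by (auto simp: h_def)
  have st: "star i = (if i < h then i + h else if i < h + h then i - h
        else if i < h + h + l then i + l else i - l)" for i
    unfolding star_def h_def using T by simp
  have om: "omega i = (if i < h + h + l then 1 else -1)" for i
    unfolding omega_def h_def using T by simp
  have rel: "X $$ (i, j) = - super_sign i j * omega i / omega j * X $$ (star j, star i)"
    if "i < h + h + (l + l)" "j < h + h + (l + l)" for i j
    using theta_index[of i j X] that fixed m1 m2 by simp
  define x y z where "x = mat h h (\<lambda>(i, j). X $$ (i, j))" and "y = mat h h (\<lambda>(i, j). X $$ (i, j + h))"
    and "z = mat h h (\<lambda>(i, j). X $$ (i + h, j))"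
  define m n p q where "m = mat h l (\<lambda>(i, j). X $$ (i, j + (h + h)))"
    and "n = mat h l (\<lambda>(i, j). X $$ (i, j + (h + h + l)))"
    and "p = mat h l (\<lambda>(i, j). X $$ (i + h, j + (h + h)))"
    and "q = mat h l (\<lambda>(i, j). X $$ (i + h, j + (h + h + l)))"
  define r s u where "r = mat l l (\<lambda>(i, j). X $$ (i + (h + h), j + (h + h)))"
    and "s = mat l l (\<lambda>(i, j). X $$ (i + (h + h), j + (h + h + l)))"
    and "u = mat l l (\<lambda>(i, j). X $$ (i + (h + h + l), j + (h + h)))"
  note defs = x_def y_def z_def m_def n_def p_def q_def r_def s_def u_def
  have car: "x \<in> carrier_mat h h" "y \<in> carrier_mat h h" "z \<in> carrier_mat h h"
      "m \<in> carrier_mat h l" "n \<in> carrier_mat h l" "p \<in> carrier_mat h l" "q \<in> carrier_mat h l"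
      "r \<in> carrier_mat l l" "s \<in> carrier_mat l l" "u \<in> carrier_mat l l"
    by (simp_all add: defs)
  have ranges: "i < h \<or> h \<le> i \<and> i < h + h \<or> h + h \<le> i \<and> i < h + h + l \<or> h + h + l \<le> i" for i
    by linarith
  have "X = osp_block_matrix x y z m n p q r s u"
  proof (rule square_mat_eqI[where n = N])
    have "osp_block_matrix x y z m n p q r s u \<in> carrier_mat (h + h + (l + l)) (h + h + (l + l))"
      unfolding osp_block_matrix_def using car by (intro four_block_carrier_mat) simp_all
    then show "osp_block_matrix x y z m n p q r s u \<in> carrier_mat N N" using m1 m2 by simp
    fix i j assume "i < N" "j < N"
    then have i: "i < h + h + (l + l)" and j: "j < h + h + (l + l)" using m1 m2 by simp_all
    show "X $$ (i, j) = osp_block_matrix x y z m n p q r s u $$ (i, j)"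
      using ranges[of i] ranges[of j] i j rel[OF i j]
      unfolding osp_block_matrix_index[OF car i j] m1 super_sign_def
      apply (elim disjE conjE)
      apply (simp_all add: st om defs less_diff_conv2 add.commute[of l "h + h"])
      done
  qed (rule X)
  moreover have "y\<^sup>T = - y"
  proof (rule square_mat_eqI[where n = h])
    fix i j assume "i < h" "j < h"
    then show "y\<^sup>T $$ (i, j) = (- y) $$ (i, j)"
      using rel[of j "i + h"] by (simp add: y_def st om super_sign_def m1)
  qed (simp_all add: y_def)
  moreover have "z\<^sup>T = - z"
  proof (rule square_mat_eqI[where n = h])
    fix i j assume "i < h" "j < h"
    then show "z\<^sup>T $$ (i, j) = (- z) $$ (i, j)"
      using rel[of "j + h" i] by (simp add: z_def st om super_sign_def m1)
  qed (simp_all add: z_def)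
  moreover have "s\<^sup>T = s"
  proof (rule square_mat_eqI[where n = l])
    fix i j assume "i < l" "j < l"
    then show "s\<^sup>T $$ (i, j) = s $$ (i, j)"
      using rel[of "j + (h + h)" "i + (h + h + l)"] by (simp add: s_def st om super_sign_def m1 add_ac)
  qed (simp_all add: s_def)
  moreover have "u\<^sup>T = u"
  proof (rule square_mat_eqI[where n = l])
    fix i j assume "i < l" "j < l"
    then show "u\<^sup>T $$ (i, j) = u $$ (i, j)"
      using rel[of "j + (h + h + l)" "i + (h + h)"] by (simp add: u_def st om super_sign_def m1 add_ac)
  qed (simp_all add: u_def)
  ultimately show ?thesis
    unfolding osp_matrices_def osp_block_matrix_def h_def[symmetric] using car by blast
qed

lemma matrices_D: "T = D_type \<Longrightarrow> matrices = {X \<in> carrier_mat N N. theta X = X}"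
  unfolding matrices_def using osp_matrices_theta theta_fixed_osp by auto

section \<open>The matrix algebra and its automorphism\<close>

text \<open>A name for the equation, so that it can serve as a hypothesis without being substituted everywhere.\<close>

definition osp_type :: bool where
  "osp_type \<longleftrightarrow> T = D_type"

text \<open>On even matrices this is the compact involution up to sign. It turns a root vector into a root vector for the opposite root, and so
provides the missing member of an \<open>sl(2)\<close> triple without a list of the roots.\<close>

definition conj_transpose :: "complex mat \<Rightarrow> complex mat" where
  "conj_transpose X = mat N N (\<lambda>(i, j). cnj (X $$ (j, i)))"

lemma conj_transpose_carrier [simp]: "conj_transpose X \<in> carrier_mat N N"
  by (simp add: conj_transpose_def)

lemma conj_transpose_dim [simp]: "dim_row (conj_transpose X) = N" "dim_col (conj_transpose X) = N"
  by (simp_all add: conj_transpose_def)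

lemma conj_transpose_index: "i < N \<Longrightarrow> j < N \<Longrightarrow> conj_transpose X $$ (i, j) = cnj (X $$ (j, i))"
  by (simp add: conj_transpose_def)

definition swap_conj :: "complex mat \<Rightarrow> complex mat" where
  "swap_conj X = mat N N (\<lambda>(i, j). X $$ (swap_ends i, swap_ends j))"

lemma swap_conj_carrier [simp]: "swap_conj X \<in> carrier_mat N N"
  by (simp add: swap_conj_def)

lemma swap_conj_dim [simp]: "dim_row (swap_conj X) = N" "dim_col (swap_conj X) = N"
  by (simp_all add: swap_conj_def)

lemma swap_conj_index:
  "i < N \<Longrightarrow> j < N \<Longrightarrow> swap_conj X $$ (i, j) = X $$ (swap_ends i, swap_ends j)"
  by (simp add: swap_conj_def)

lemma swap_ends_swap_ends [simp]: "swap_ends (swap_ends i) = i"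
  by (simp add: swap_ends_def)

lemma swap_ends_less: "osp_type \<Longrightarrow> i < N \<Longrightarrow> swap_ends i < N"
  unfolding osp_type_def by (simp add: swap_ends_def)

lemma swap_ends_upper: "osp_type \<Longrightarrow> swap_ends i < m1 \<longleftrightarrow> i < m1"
  unfolding osp_type_def by (simp add: swap_ends_def)

lemma star_swap_ends: "osp_type \<Longrightarrow> i < N \<Longrightarrow> star (swap_ends i) = swap_ends (star i)"
  unfolding osp_type_def star_def swap_ends_def by auto

lemma omega_swap_ends: "osp_type \<Longrightarrow> omega (swap_ends i) = omega i"
  unfolding osp_type_def omega_def swap_ends_def by simp

lemma sum_swap_ends:
  assumes "osp_type"
  shows "(\<Sum>i<N. f (swap_ends i)) = (\<Sum>i<N. f i)"
proof -
  have "bij_betw swap_ends {..<N} {..<N}"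
    by (rule bij_betwI[where g = swap_ends]) (use swap_ends_less[OF assms] in auto)
  from sum.reindex_bij_betw[OF this] show ?thesis .
qed

lemma swap_conj_superbracket:
  assumes T: "osp_type" and X: "X \<in> carrier_mat N N" and Y: "Y \<in> carrier_mat N N"
  shows "swap_conj (superbracket m1 X Y) = superbracket m1 (swap_conj X) (swap_conj Y)"
proof (rule square_mat_eqI[where n = N])
  fix i j assume i: "i < N" and j: "j < N"
  note less = swap_ends_less[OF T]
  have "swap_conj (superbracket m1 X Y) $$ (i, j) =
    (\<Sum>a<N. X $$ (swap_ends i, swap_ends a) * Y $$ (swap_ends a, swap_ends j)
        - bracket_sign m1 (swap_ends i) (swap_ends a) (swap_ends j)
          * (Y $$ (swap_ends i, swap_ends a) * X $$ (swap_ends a, swap_ends j)))"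
    unfolding swap_conj_index[OF i j] superbracket_index[OF X Y less[OF i] less[OF j]]
    by (rule sum_swap_ends[OF T, symmetric])
  also have "\<dots> = superbracket m1 (swap_conj X) (swap_conj Y) $$ (i, j)"
    unfolding superbracket_index[OF swap_conj_carrier swap_conj_carrier i j]
    by (rule sum.cong) (use i j in \<open>simp_all add: swap_conj_index bracket_sign_def swap_ends_upper[OF T]\<close>)
  finally show "swap_conj (superbracket m1 X Y) $$ (i, j) =
    superbracket m1 (swap_conj X) (swap_conj Y) $$ (i, j)" .
qed simp_all

lemma sigma_matrix_eq:
  "X \<in> carrier_mat N N \<Longrightarrow> sigma_matrix X = (if osp_type then swap_conj X else theta X)"
  unfolding swap_conj_def osp_type_def using sigma_matrix_A[of X] sigma_matrix_D[of X] by metis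

lemma sigma_matrix_carrier [simp]: "X \<in> carrier_mat N N \<Longrightarrow> sigma_matrix X \<in> carrier_mat N N"
  by (simp add: sigma_matrix_eq)

lemma sigma_matrix_add:
  assumes "X \<in> carrier_mat N N" "Y \<in> carrier_mat N N"
  shows "sigma_matrix (X + Y) = sigma_matrix X + sigma_matrix Y"
proof -
  have "swap_conj (X + Y) = swap_conj X + swap_conj Y" if "osp_type"
    by (rule square_mat_eqI[where n = N])
      (use assms swap_ends_less[OF that] in \<open>simp_all add: swap_conj_index\<close>)
  then show ?thesis using assms by (simp add: sigma_matrix_eq theta_add)
qed

lemma sigma_matrix_smult:
  assumes "X \<in> carrier_mat N N"
  shows "sigma_matrix (c \<cdot>\<^sub>m X) = c \<cdot>\<^sub>m sigma_matrix X"
proof -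
  have "swap_conj (c \<cdot>\<^sub>m X) = c \<cdot>\<^sub>m swap_conj X" if "osp_type"
    by (rule square_mat_eqI[where n = N])
      (use assms swap_ends_less[OF that] in \<open>simp_all add: swap_conj_index\<close>)
  then show ?thesis using assms by (simp add: sigma_matrix_eq theta_smult)
qed

lemma sigma_matrix_superbracket:
  assumes "X \<in> carrier_mat N N" "Y \<in> carrier_mat N N"
  shows "sigma_matrix (superbracket m1 X Y) = superbracket m1 (sigma_matrix X) (sigma_matrix Y)"
  using assms by (simp add: sigma_matrix_eq theta_superbracket swap_conj_superbracket)

lemma sigma_matrix_even_part:
  assumes "X \<in> carrier_mat N N"
  shows "sigma_matrix (even_part m1 X) = even_part m1 (sigma_matrix X)"
proof -
  have "swap_conj (even_part m1 X) = even_part m1 (swap_conj X)" if "osp_type"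
    by (rule square_mat_eqI[where n = N])
      (use assms swap_ends_less[OF that] in
        \<open>simp_all add: swap_conj_index even_part_index[of _ N] swap_ends_upper[OF that]\<close>)
  then show ?thesis using assms by (simp add: sigma_matrix_eq theta_even_part)
qed

lemma sigma_matrix_odd_part:
  assumes "X \<in> carrier_mat N N"
  shows "sigma_matrix (odd_part m1 X) = odd_part m1 (sigma_matrix X)"
proof -
  have "swap_conj (odd_part m1 X) = odd_part m1 (swap_conj X)" if "osp_type"
    by (rule square_mat_eqI[where n = N])
      (use assms swap_ends_less[OF that] in
        \<open>simp_all add: swap_conj_index odd_part_index[of _ N] swap_ends_upper[OF that]\<close>)
  then show ?thesis using assms by (simp add: sigma_matrix_eq theta_odd_part)
qed

lemma even_part_zero_entry:
  "X \<in> carrier_mat N N \<Longrightarrow> even_part m1 X = X \<Longrightarrow> i < N \<Longrightarrow> j < N \<Longrightarrow> (i < m1) \<noteq> (j < m1) \<Longrightarrow> X $$ (i, j) = 0"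
  using even_part_index[of X N i j m1] by auto

text \<open>The entries of \<open>omega\<close> have modulus one, so inverting and conjugating them amounts to the same. On
odd entries the signs in the two corners would differ.\<close>

lemma theta_conj_transpose:
  assumes X: "X \<in> carrier_mat N N" and even: "even_part m1 X = X"
  shows "theta (conj_transpose X) = conj_transpose (theta X)"
proof (rule square_mat_eqI[where n = N])
  fix i j assume i: "i < N" and j: "j < N"
  show "theta (conj_transpose X) $$ (i, j) = conj_transpose (theta X) $$ (i, j)"
  proof (cases "(i < m1) = (j < m1)")
    case True
    have ss: "super_sign i j = 1" "super_sign j i = 1" using True by (auto simp: super_sign_def)
    have "cnj (omega a) = 1 / omega a" for a using cnj_omega[of a] by (simp add: eq_divide_eq)
    then show ?thesis using i j by (simp add: theta_index conj_transpose_index ss)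
  next
    case False
    then have "X $$ (star i, star j) = 0"
      by (intro even_part_zero_entry[OF X even]) (use i j in auto)
    then show ?thesis using i j by (simp add: theta_index conj_transpose_index)
  qed
qed simp_all

lemma sigma_matrix_conj_transpose:
  assumes X: "X \<in> carrier_mat N N" and even: "even_part m1 X = X"
  shows "sigma_matrix (conj_transpose X) = conj_transpose (sigma_matrix X)"
proof -
  have "swap_conj (conj_transpose X) = conj_transpose (swap_conj X)" if "osp_type"
    by (rule square_mat_eqI[where n = N])
      (use assms swap_ends_less[OF that] in \<open>simp_all add: swap_conj_index conj_transpose_index\<close>)
  then show ?thesis using assms by (simp add: sigma_matrix_eq theta_conj_transpose)
qed

lemma matrices_eq:
  "matrices = {X \<in> carrier_mat N N. if osp_type then theta X = X else supertrace m1 X = 0}"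
proof (cases osp_type)
  case True
  then have D: "T = D_type" unfolding osp_type_def .
  show ?thesis unfolding matrices_D[OF D] using True by simp
next
  case False
  then have A: "T \<noteq> D_type" unfolding osp_type_def .
  show ?thesis unfolding matrices_A[OF A] using False by simp
qed

lemma matrices_carrier [simp]: "X \<in> matrices \<Longrightarrow> X \<in> carrier_mat N N"
  by (simp add: matrices_eq)

lemma supertrace_add:
  "X \<in> carrier_mat N N \<Longrightarrow> Y \<in> carrier_mat N N \<Longrightarrow> supertrace m1 (X + Y) = supertrace m1 X + supertrace m1 Y"
  by (simp add: supertrace_eq_sum distrib_left sum.distrib)

lemma supertrace_smult:
  "X \<in> carrier_mat N N \<Longrightarrow> supertrace m1 (c \<cdot>\<^sub>m X) = c * supertrace m1 X"
  by (simp add: supertrace_eq_sum sum_distrib_left mult_ac)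

lemma matricesI:
  assumes "X \<in> carrier_mat N N"
    and "\<not> osp_type \<Longrightarrow> supertrace m1 X = 0" and "osp_type \<Longrightarrow> theta X = X"
  shows "X \<in> matrices"
  using assms by (simp add: matrices_eq del: matrices_carrier)

lemma matrices_supertrace: "X \<in> matrices \<Longrightarrow> \<not> osp_type \<Longrightarrow> supertrace m1 X = 0"
  by (simp add: matrices_eq del: matrices_carrier)

lemma matrices_theta: "X \<in> matrices \<Longrightarrow> osp_type \<Longrightarrow> theta X = X"
  by (simp add: matrices_eq del: matrices_carrier)

lemma matrices_add [simp]: "X \<in> matrices \<Longrightarrow> Y \<in> matrices \<Longrightarrow> X + Y \<in> matrices"
  by (rule matricesI) (simp_all add: supertrace_add theta_add matrices_supertrace matrices_theta)

lemma matrices_smult [simp]: "X \<in> matrices \<Longrightarrow> c \<cdot>\<^sub>m X \<in> matrices"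
  by (rule matricesI) (simp_all add: supertrace_smult theta_smult matrices_supertrace matrices_theta)

lemma matrices_zero [simp]: "0\<^sub>m N N \<in> matrices"
proof (rule matricesI)
  show "theta (0\<^sub>m N N) = 0\<^sub>m N N" by (rule square_mat_eqI[where n = N]) (simp_all add: theta_index)
qed (simp_all add: supertrace_eq_sum)

lemma matrices_superbracket [simp]: "X \<in> matrices \<Longrightarrow> Y \<in> matrices \<Longrightarrow> superbracket m1 X Y \<in> matrices"
  by (rule matricesI) (simp_all add: supertrace_superbracket theta_superbracket matrices_theta)

lemma matrices_even_part [simp]:
  assumes "X \<in> matrices"
  shows "even_part m1 X \<in> matrices"
proof (rule matricesI)
  show "supertrace m1 (even_part m1 X) = 0" if "\<not> osp_type"
    using matrices_supertrace[OF assms that] assms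
    by (simp add: supertrace_eq_sum even_part_index[of X N])
qed (use assms in \<open>simp_all add: theta_even_part matrices_theta\<close>)

lemma matrices_odd_part [simp]:
  assumes "X \<in> matrices"
  shows "odd_part m1 X \<in> matrices"
  by (rule matricesI)
    (use assms in \<open>simp_all add: theta_odd_part matrices_theta supertrace_eq_sum odd_part_index[of X N]\<close>)

lemma matrices_conj_transpose:
  assumes X: "X \<in> matrices" and even: "even_part m1 X = X"
  shows "conj_transpose X \<in> matrices"
proof (rule matricesI)
  show "supertrace m1 (conj_transpose X) = 0" if "\<not> osp_type"
  proof -
    have "supertrace m1 (conj_transpose X) = cnj (supertrace m1 X)"
      using X by (simp add: supertrace_eq_sum conj_transpose_index parity_sign_def if_distrib cong: if_cong)
        (auto intro!: sum.cong)
    then show ?thesis using matrices_supertrace[OF X that] by simp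
  qed
qed (use X even in \<open>simp_all add: theta_conj_transpose matrices_theta\<close>)

lemma theta_swap_conj:
  assumes "osp_type" "X \<in> carrier_mat N N"
  shows "theta (swap_conj X) = swap_conj (theta X)"
  by (rule square_mat_eqI[where n = N])
    (use assms swap_ends_less[OF assms(1)] in
      \<open>simp_all add: theta_index swap_conj_index star_swap_ends omega_swap_ends super_sign_def
        swap_ends_upper[OF assms(1)]\<close>)

lemma matrices_sigma_matrix [simp]: "X \<in> matrices \<Longrightarrow> sigma_matrix X \<in> matrices"
  by (rule matricesI)
    (simp_all add: sigma_matrix_eq supertrace_theta theta_swap_conj matrices_supertrace matrices_theta)

text \<open>If the two blocks have equal size in the \<open>A\<close> types, elements of the finite-dimensional algebra are
matrices modulo scalars. A vanishing trace of the upper block singles out one representative, and it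
holds for the matrices that matter below: those supported in one block, the odd ones, and brackets with
diagonal ones.\<close>

definition upper_trace :: "complex mat \<Rightarrow> complex" where
  "upper_trace X = (\<Sum>i<m1. X $$ (i, i))"

lemma upper_trace_add:
  "X \<in> carrier_mat N N \<Longrightarrow> Y \<in> carrier_mat N N \<Longrightarrow> upper_trace (X + Y) = upper_trace X + upper_trace Y"
  by (simp add: upper_trace_def sum.distrib)

lemma upper_trace_smult: "X \<in> carrier_mat N N \<Longrightarrow> upper_trace (c \<cdot>\<^sub>m X) = c * upper_trace X"
  by (simp add: upper_trace_def sum_distrib_left)

lemma upper_trace_theta:
  "upper_trace (theta X) = - upper_trace X"
proof -
  have bij: "bij_betw star {..<m1} {..<m1}"
    by (rule bij_betwI[where g = star]) auto
  have "upper_trace (theta X) = (\<Sum>i<m1. - X $$ (star i, star i))"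
    unfolding upper_trace_def by (rule sum.cong) (simp_all add: theta_index super_sign_def)
  then show ?thesis
    using sum.reindex_bij_betw[OF bij, of "\<lambda>i. X $$ (i, i)"] by (simp add: sum_negf upper_trace_def)
qed

lemma upper_trace_sigma_matrix:
  assumes X: "X \<in> carrier_mat N N" and "upper_trace X = 0"
  shows "upper_trace (sigma_matrix X) = 0"
proof (cases "osp_type")
  case True
  have bij: "bij_betw swap_ends {..<m1} {..<m1}"
    by (rule bij_betwI[where g = swap_ends]) (use swap_ends_upper[OF True] in auto)
  have "upper_trace (swap_conj X) = (\<Sum>i<m1. X $$ (swap_ends i, swap_ends i))"
    unfolding upper_trace_def by (rule sum.cong) (simp_all add: swap_conj_index)
  then show ?thesis
    using sum.reindex_bij_betw[OF bij, of "\<lambda>i. X $$ (i, i)"] assms True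
    by (simp add: upper_trace_def sigma_matrix_eq)
qed (use assms in \<open>simp add: sigma_matrix_eq upper_trace_theta\<close>)

lemma upper_trace_even_part: "X \<in> carrier_mat N N \<Longrightarrow> upper_trace (even_part m1 X) = upper_trace X"
  by (simp add: upper_trace_def even_part_index[of X N])

lemma upper_trace_odd_part: "X \<in> carrier_mat N N \<Longrightarrow> upper_trace (odd_part m1 X) = 0"
  by (simp add: upper_trace_def odd_part_index[of X N])

lemma upper_trace_D: "osp_type \<Longrightarrow> X \<in> matrices \<Longrightarrow> upper_trace X = 0"
  using upper_trace_theta[of X] matrices_theta[of X] by simp

lemma block_matrices_matrices [simp]: "X \<in> block_matrices a \<Longrightarrow> X \<in> matrices"
  by (simp add: block_matrices_def)

lemma block_matrices_entry:
  "X \<in> block_matrices a \<Longrightarrow> i < N \<Longrightarrow> j < N \<Longrightarrow> X $$ (i, j) \<noteq> 0 \<Longrightarrow> i \<in> block_indices a \<and> j \<in> block_indices a"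
  unfolding block_matrices_def by blast

lemma block_matricesI:
  "X \<in> matrices \<Longrightarrow> (\<And>i j. i < N \<Longrightarrow> j < N \<Longrightarrow> X $$ (i, j) \<noteq> 0 \<Longrightarrow> i \<in> block_indices a \<and> j \<in> block_indices a)
    \<Longrightarrow> X \<in> block_matrices a"
  unfolding block_matrices_def by blast

lemma mem_block_indices: "i < N \<Longrightarrow> i \<in> block_indices a \<longleftrightarrow> (i < m1 \<longleftrightarrow> a = 1)"
  by (auto simp: block_indices_def)

lemma upper_trace_block:
  assumes X: "X \<in> block_matrices a"
  shows "upper_trace X = 0"
proof (cases "osp_type")
  case False
  show ?thesis
  proof (cases "a = 1")
    case True
    have z: "X $$ (i, i) = 0" if "i < N" "\<not> i < m1" for i
      using block_matrices_entry[OF X that(1) that(1)] that True by (auto simp: block_indices_def)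
    have "(\<Sum>i\<in>{m1..<dim_row X}. X $$ (i, i)) = 0"
      using matrices_carrier[OF block_matrices_matrices[OF X]] by (intro sum.neutral) (auto intro: z)
    then show ?thesis using matrices_supertrace[OF block_matrices_matrices[OF X] False]
      by (simp add: supertrace_def upper_trace_def)
  next
    case False
    have "X $$ (i, i) = 0" if "i < m1" for i
      using block_matrices_entry[OF X, of i i] that False by (auto simp: block_indices_def)
    then show ?thesis by (simp add: upper_trace_def)
  qed
qed (use X upper_trace_D in simp)

lemma block_matrices_even:
  assumes X: "X \<in> block_matrices a"
  shows "even_part m1 X = X"
proof (rule square_mat_eqI[where n = N])
  fix i j assume i: "i < N" and j: "j < N"
  show "even_part m1 X $$ (i, j) = X $$ (i, j)"
    using block_matrices_entry[OF X i j] i j X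
    by (auto simp: even_part_index[of X N] mem_block_indices)
qed (use X in simp_all)

lemma block_matrices_zero [simp]: "0\<^sub>m N N \<in> block_matrices a"
  by (rule block_matricesI) simp_all

lemma block_matrices_add [simp]:
  assumes X: "X \<in> block_matrices a" and Y: "Y \<in> block_matrices a"
  shows "X + Y \<in> block_matrices a"
proof (rule block_matricesI)
  fix i j assume "i < N" "j < N" "(X + Y) $$ (i, j) \<noteq> 0"
  then have "X $$ (i, j) \<noteq> 0 \<or> Y $$ (i, j) \<noteq> 0"
    using matrices_carrier[OF block_matrices_matrices[OF Y]] by auto
  then show "i \<in> block_indices a \<and> j \<in> block_indices a"
    using block_matrices_entry[OF X \<open>i < N\<close> \<open>j < N\<close>] block_matrices_entry[OF Y \<open>i < N\<close> \<open>j < N\<close>] by blast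
qed (use X Y in simp)

lemma block_matrices_smult [simp]:
  assumes X: "X \<in> block_matrices a"
  shows "c \<cdot>\<^sub>m X \<in> block_matrices a"
proof (rule block_matricesI)
  fix i j assume "i < N" "j < N" "(c \<cdot>\<^sub>m X) $$ (i, j) \<noteq> 0"
  then have "X $$ (i, j) \<noteq> 0"
    using matrices_carrier[OF block_matrices_matrices[OF X]] by auto
  then show "i \<in> block_indices a \<and> j \<in> block_indices a"
    using block_matrices_entry[OF X \<open>i < N\<close> \<open>j < N\<close>] by blast
qed (use X in simp)

lemma block_matrices_superbracket [simp]:
  assumes X: "X \<in> block_matrices a" and Y: "Y \<in> block_matrices a"
  shows "superbracket m1 X Y \<in> block_matrices a"
proof (rule block_matricesI)
  fix i j assume i: "i < N" and j: "j < N" and nz: "superbracket m1 X Y $$ (i, j) \<noteq> 0"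
  obtain c where "c < N" "X $$ (i, c) * Y $$ (c, j) - bracket_sign m1 i c j * (Y $$ (i, c) * X $$ (c, j)) \<noteq> 0"
    using nz X Y sum.not_neutral_contains_not_neutral
    unfolding superbracket_index[OF matrices_carrier[OF block_matrices_matrices[OF X]]
        matrices_carrier[OF block_matrices_matrices[OF Y]] i j] by blast
  then obtain c where "c < N" "X $$ (i, c) \<noteq> 0 \<and> Y $$ (c, j) \<noteq> 0 \<or> Y $$ (i, c) \<noteq> 0 \<and> X $$ (c, j) \<noteq> 0"
    by fastforce
  then show "i \<in> block_indices a \<and> j \<in> block_indices a"
    using block_matrices_entry[OF X] block_matrices_entry[OF Y] i j by blast
qed (use X Y in simp)

lemma block_matrices_sigma_matrix [simp]:
  assumes X: "X \<in> block_matrices a"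
  shows "sigma_matrix X \<in> block_matrices a"
proof (rule block_matricesI)
  fix i j assume i: "i < N" and j: "j < N" and nz: "sigma_matrix X $$ (i, j) \<noteq> 0"
  show "i \<in> block_indices a \<and> j \<in> block_indices a"
  proof (cases "osp_type")
    case True
    then have "X $$ (swap_ends i, swap_ends j) \<noteq> 0" using nz i j X by (simp add: sigma_matrix_eq swap_conj_index)
    then show ?thesis
      using block_matrices_entry[OF X swap_ends_less[OF True i] swap_ends_less[OF True j]] i j
        swap_ends_less[OF True i] swap_ends_less[OF True j]
      by (simp add: mem_block_indices swap_ends_upper[OF True])
  next
    case False
    then have "X $$ (star j, star i) \<noteq> 0" using nz i j X by (auto simp: sigma_matrix_eq theta_index)
    then show ?thesis
      using block_matrices_entry[OF X star_less[OF j] star_less[OF i]] i j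
      by (simp add: mem_block_indices)
  qed
qed (use X in simp)

lemma block_matrices_conj_transpose [simp]:
  assumes X: "X \<in> block_matrices a"
  shows "conj_transpose X \<in> block_matrices a"
proof (rule block_matricesI)
  show "conj_transpose X \<in> matrices" using X block_matrices_even matrices_conj_transpose by simp
  fix i j assume i: "i < N" and j: "j < N" and "conj_transpose X $$ (i, j) \<noteq> 0"
  then have "X $$ (j, i) \<noteq> 0" by (simp add: conj_transpose_index)
  then show "i \<in> block_indices a \<and> j \<in> block_indices a"
    using block_matrices_entry[OF X j i] by blast
qed

section \<open>The torus and the coroots\<close>

text \<open>The diagonal matrices that give the Cartan subalgebra in degree zero, block by block and then together.\<close>

definition torus_block :: "nat \<Rightarrow> complex mat set" where
  "torus_block a = {D \<in> block_matrices a. diagonal_mat D \<and> sigma_matrix D = D}"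

definition torus :: "complex mat set" where
  "torus = {D1 + D2 | D1 D2. D1 \<in> torus_block 1 \<and> D2 \<in> torus_block 2}"

lemma torus_block_carrier: "D \<in> torus_block a \<Longrightarrow> D \<in> carrier_mat N N"
  by (auto simp: torus_block_def)

lemma diagonal_mat_entry:
  "diagonal_mat D \<Longrightarrow> D \<in> carrier_mat N N \<Longrightarrow> i < N \<Longrightarrow> j < N \<Longrightarrow> i \<noteq> j \<Longrightarrow> D $$ (i, j) = 0"
  by (auto simp: diagonal_mat_def)

lemma diagonal_matI:
  "D \<in> carrier_mat N N \<Longrightarrow> (\<And>i j. i < N \<Longrightarrow> j < N \<Longrightarrow> i \<noteq> j \<Longrightarrow> D $$ (i, j) = 0) \<Longrightarrow> diagonal_mat D"
  by (auto simp: diagonal_mat_def)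

lemma torus_block_zero: "0\<^sub>m N N \<in> torus_block a"
proof -
  have "sigma_matrix (0 \<cdot>\<^sub>m 0\<^sub>m N N) = 0 \<cdot>\<^sub>m sigma_matrix (0\<^sub>m N N)" by (rule sigma_matrix_smult) simp
  moreover have "0 \<cdot>\<^sub>m X = 0\<^sub>m N N" if "X \<in> carrier_mat N N" for X :: "complex mat"
    by (rule square_mat_eqI[where n = N]) (use that in simp_all)
  ultimately have "sigma_matrix (0\<^sub>m N N) = 0\<^sub>m N N" by simp
  then show ?thesis unfolding torus_block_def by (auto intro!: diagonal_matI)
qed

lemma torus_block_smult:
  assumes "D \<in> torus_block a"
  shows "c \<cdot>\<^sub>m D \<in> torus_block a"
proof -
  have c: "D \<in> carrier_mat N N" by (rule torus_block_carrier[OF assms])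
  have d: "D \<in> block_matrices a" "diagonal_mat D" "sigma_matrix D = D" using assms by (auto simp: torus_block_def)
  have "diagonal_mat (c \<cdot>\<^sub>m D)"
    by (rule diagonal_matI) (use c d(2) in \<open>simp_all add: diagonal_mat_entry[of D]\<close>)
  then show ?thesis using c d by (simp add: torus_block_def sigma_matrix_smult)
qed

lemma torus_block_add:
  assumes "D \<in> torus_block a" "E \<in> torus_block a"
  shows "D + E \<in> torus_block a"
proof -
  note c = torus_block_carrier[OF assms(1)] torus_block_carrier[OF assms(2)]
  have d: "D \<in> block_matrices a" "diagonal_mat D" "sigma_matrix D = D"
    "E \<in> block_matrices a" "diagonal_mat E" "sigma_matrix E = E" using assms by (auto simp: torus_block_def)
  have "diagonal_mat (D + E)"
    by (rule diagonal_matI) (use c d(2,5) in \<open>simp_all add: diagonal_mat_entry[of D] diagonal_mat_entry[of E]\<close>)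
  then show ?thesis using c d by (simp add: torus_block_def sigma_matrix_add)
qed

lemma torus_block_conj_transpose:
  assumes "D \<in> torus_block a"
  shows "conj_transpose D \<in> torus_block a"
  using assms torus_block_carrier[OF assms] unfolding torus_block_def
  by (auto simp: sigma_matrix_conj_transpose block_matrices_even conj_transpose_index diagonal_mat_entry
      intro!: diagonal_matI)

lemma torus_block_torus:
  assumes D: "D \<in> torus_block a" and a: "a \<in> {1, 2}"
  shows "D \<in> torus"
proof (cases "a = 1")
  case True
  then have "D = D + 0\<^sub>m N N" using torus_block_carrier[OF D] by simp
  then show ?thesis using D True torus_block_zero unfolding torus_def by blast
next
  case False
  then have "a = 2" using a by simp
  moreover have "D = 0\<^sub>m N N + D" using torus_block_carrier[OF D] by simp
  ultimately show ?thesis using D torus_block_zero unfolding torus_def by blast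
qed

lemma torusE:
  assumes "D \<in> torus"
  obtains D1 D2 where "D1 \<in> torus_block 1" "D2 \<in> torus_block 2" "D = D1 + D2"
    "D1 \<in> carrier_mat N N" "D2 \<in> carrier_mat N N"
  using assms torus_block_carrier unfolding torus_def by blast

lemma torus_carrier: "D \<in> torus \<Longrightarrow> D \<in> carrier_mat N N"
  by (auto simp: torus_def dest: torus_block_carrier)

lemma torus_matrices: "D \<in> torus \<Longrightarrow> D \<in> matrices"
  by (auto simp: torus_def torus_block_def)

lemma torus_sigma_matrix: "D \<in> torus \<Longrightarrow> sigma_matrix D = D"
  by (elim torusE) (simp add: sigma_matrix_add, simp add: torus_block_def)

lemma torus_upper_trace: "D \<in> torus \<Longrightarrow> upper_trace D = 0"
  by (elim torusE) (simp add: upper_trace_add, auto simp: torus_block_def upper_trace_block)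

lemma torus_entry: "D \<in> torus \<Longrightarrow> i < N \<Longrightarrow> j < N \<Longrightarrow> i \<noteq> j \<Longrightarrow> D $$ (i, j) = 0"
  by (elim torusE) (auto simp: torus_block_def diagonal_mat_entry)

lemma torus_smult: "D \<in> torus \<Longrightarrow> c \<cdot>\<^sub>m D \<in> torus"
proof -
  assume "D \<in> torus"
  then obtain D1 D2 where D: "D1 \<in> torus_block 1" "D2 \<in> torus_block 2" "D = D1 + D2" by (auto simp: torus_def)
  then have "c \<cdot>\<^sub>m D = c \<cdot>\<^sub>m D1 + c \<cdot>\<^sub>m D2"
    using torus_block_carrier add_smult_distrib_left_mat by blast
  then show ?thesis using D torus_block_smult unfolding torus_def by blast
qed

lemma torus_add:
  assumes "D \<in> torus" "E \<in> torus"
  shows "D + E \<in> torus"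
proof -
  obtain D1 D2 E1 E2 where D: "D1 \<in> torus_block 1" "D2 \<in> torus_block 2" "D = D1 + D2"
    and E: "E1 \<in> torus_block 1" "E2 \<in> torus_block 2" "E = E1 + E2" using assms by (auto simp: torus_def)
  have "D + E = (D1 + E1) + (D2 + E2)"
    unfolding D(3) E(3)
    using D(1,2)[THEN torus_block_carrier] E(1,2)[THEN torus_block_carrier]
    by (intro square_mat_eqI[where n = N]) simp_all
  then show ?thesis using D E torus_block_add unfolding torus_def by blast
qed

lemma torus_zero: "0\<^sub>m N N \<in> torus"
  using torus_block_torus[OF torus_block_zero, of 1] by simp

lemma torus_superbracket_index:
  assumes D: "D \<in> torus" and X: "X \<in> carrier_mat N N" and i: "i < N" and j: "j < N"
  shows "superbracket m1 D X $$ (i, j) = (D $$ (i, i) - D $$ (j, j)) * X $$ (i, j)"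
proof -
  have "superbracket m1 D X $$ (i, j) =
    (\<Sum>a<N. (if a = i then D $$ (i, i) * X $$ (i, j) else 0) - (if a = j then X $$ (i, j) * D $$ (j, j) else 0))"
    unfolding superbracket_index[OF torus_carrier[OF D] X i j]
    by (rule sum.cong) (use i j torus_entry[OF D] in \<open>auto simp: bracket_sign_def\<close>)
  then show ?thesis using i j by (simp add: sum_subtractf algebra_simps)
qed

lemma superbracket_zero_right: "X \<in> carrier_mat N N \<Longrightarrow> superbracket m1 X (0\<^sub>m N N) = 0\<^sub>m N N"
  by (rule square_mat_eqI[where n = N]) (simp_all add: superbracket_index[of _ N])

text \<open>These elements of the torus distinguish the diagonal positions.\<close>

definition coroot_matrix :: "nat \<Rightarrow> complex mat" where
  "coroot_matrix i = mat N N (\<lambda>(a, b). if a = b then of_bool (a = i) - of_bool (a = star i) else 0)"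

lemma coroot_matrix_carrier [simp]: "coroot_matrix i \<in> carrier_mat N N"
  by (simp add: coroot_matrix_def)

lemma coroot_matrix_index:
  "a < N \<Longrightarrow> b < N \<Longrightarrow>
    coroot_matrix i $$ (a, b) = (if a = b then of_bool (a = i) - of_bool (a = star i) else 0)"
  by (simp add: coroot_matrix_def)

lemma theta_coroot_matrix:
  assumes i: "i < N"
  shows "theta (coroot_matrix i) = coroot_matrix i"
proof (rule square_mat_eqI[where n = N])
  fix a b assume ab: "a < N" "b < N"
  have st: "star a = i \<longleftrightarrow> a = star i" "star a = star i \<longleftrightarrow> a = i" "star b = star a \<longleftrightarrow> b = a"
    using star_inj[OF ab(1) star_less[OF i]] star_inj[OF ab(1) i] star_inj[OF ab(2,1)] star_star[OF i] by simp_all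
  show "theta (coroot_matrix i) $$ (a, b) = coroot_matrix i $$ (a, b)"
  proof (cases "b = a")
    case True
    show ?thesis
      unfolding True theta_index[OF ab(1) ab(1)] coroot_matrix_index[OF star_less[OF ab(1)] star_less[OF ab(1)]]
        coroot_matrix_index[OF ab(1) ab(1)] st super_sign_def by simp
  next
    case False
    then show ?thesis
      unfolding theta_index[OF ab] coroot_matrix_index[OF star_less[OF ab(2)] star_less[OF ab(1)]]
        coroot_matrix_index[OF ab] st by simp
  qed
qed simp_all

lemma coroot_matrix_torus:
  assumes i: "i < N" and fixed: "osp_type \<Longrightarrow> swap_ends i = i"
  shows "coroot_matrix i \<in> torus_block (if i < m1 then 1 else 2)"
proof -
  have "supertrace m1 (coroot_matrix i) = 0"
    using supertrace_theta[OF coroot_matrix_carrier, of i] theta_coroot_matrix[OF i] by simp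
  then have M: "coroot_matrix i \<in> matrices"
    by (intro matricesI) (simp_all add: theta_coroot_matrix[OF i])
  have "coroot_matrix i \<in> block_matrices (if i < m1 then 1 else 2)"
  proof (rule block_matricesI[OF M])
    fix b c assume bc: "b < N" "c < N" "coroot_matrix i $$ (b, c) \<noteq> 0"
    then have "c = b" "b = i \<or> b = star i" by (auto simp: coroot_matrix_index split: if_splits)
    then show "b \<in> block_indices (if i < m1 then 1 else 2) \<and> c \<in> block_indices (if i < m1 then 1 else 2)"
      using bc(1) star_upper[OF i] by (auto simp: mem_block_indices)
  qed
  moreover have "swap_conj (coroot_matrix i) = coroot_matrix i" if o: "osp_type"
  proof (rule square_mat_eqI[where n = N])
    fix a b assume ab: "a < N" "b < N"
    have sw: "swap_ends a = i \<longleftrightarrow> a = i" "swap_ends a = star i \<longleftrightarrow> a = star i" "swap_ends a = swap_ends b \<longleftrightarrow> a = b"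
      using fixed[OF o] star_swap_ends[OF o i] swap_ends_swap_ends by metis+
    show "swap_conj (coroot_matrix i) $$ (a, b) = coroot_matrix i $$ (a, b)"
      unfolding swap_conj_index[OF ab] coroot_matrix_index[OF swap_ends_less[OF o ab(1)] swap_ends_less[OF o ab(2)]]
        coroot_matrix_index[OF ab] sw ..
  qed simp_all
  ultimately show ?thesis unfolding torus_block_def
    by (auto simp: sigma_matrix_eq theta_coroot_matrix[OF i] coroot_matrix_index intro!: diagonal_matI)
qed

lemma star_swap_eq: "osp_type \<Longrightarrow> swap_ends i \<noteq> i \<Longrightarrow> star i = swap_ends i"
  unfolding osp_type_def star_def swap_ends_def by (auto split: if_splits)

lemma star_fixed_unique:
  assumes "i < N" "j < N" "i < m1 \<longleftrightarrow> j < m1" "star i = i" "star j = j" "\<not> osp_type"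
  shows "i = j"
  using assms unfolding osp_type_def star_def by (auto split: if_splits)

lemma star_nonfixed_osp: "osp_type \<Longrightarrow> i < N \<Longrightarrow> star i \<noteq> i"
  unfolding osp_type_def star_def by auto

text \<open>The positions \<open>k\<close> and \<open>2 k + 1\<close> in type \<open>D\<close> are exchanged both by the pairing and by the
automorphism, which forces the corresponding entries of the torus to vanish; every other pair in the
same block is told apart by one of the coroot matrices.\<close>

lemma torus_separates:
  assumes i: "i < N" and j: "j < N" and ij: "i \<noteq> j" "i < m1 \<longleftrightarrow> j < m1"
    and ns: "\<not> (osp_type \<and> j = star i \<and> swap_ends i \<noteq> i)"
  shows "\<exists>D\<in>torus. D $$ (i, i) \<noteq> D $$ (j, j)"
proof -
  have *: "\<exists>D\<in>torus. D $$ (a, a) \<noteq> D $$ (b, b)"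
    if ab: "a < N" "b < N" "a \<noteq> b" and a: "star a \<noteq> a" "osp_type \<Longrightarrow> swap_ends a = a" for a b
  proof
    show "coroot_matrix a \<in> torus" using coroot_matrix_torus[OF ab(1) a(2)] by (rule torus_block_torus) auto
    show "coroot_matrix a $$ (a, a) \<noteq> coroot_matrix a $$ (b, b)"
      using ab a(1) by (auto simp: coroot_matrix_index)
  qed
  show ?thesis
  proof (cases osp_type)
    case True
    have "swap_ends i = i \<or> swap_ends j = j"
      using ns True star_swap_eq[OF True, of i] ij(1) by (auto simp: swap_ends_def split: if_splits)
    then show ?thesis using *[of i j] *[of j i] i j ij(1) star_nonfixed_osp[OF True] by metis
  next
    case False
    then have "star i \<noteq> i \<or> star j \<noteq> j" using star_fixed_unique[OF i j ij(2)] ij(1) by blast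
    then show ?thesis using *[of i j] *[of j i] i j ij(1) False by metis
  qed
qed

definition has_weight :: "complex mat \<Rightarrow> (complex mat \<Rightarrow> complex) \<Rightarrow> bool" where
  "has_weight X w \<longleftrightarrow> (\<forall>D\<in>torus. superbracket m1 D X = w D \<cdot>\<^sub>m X)"

lemma has_weight_iff:
  assumes X: "X \<in> carrier_mat N N"
  shows "has_weight X w \<longleftrightarrow>
    (\<forall>D\<in>torus. \<forall>i<N. \<forall>j<N. X $$ (i, j) \<noteq> 0 \<longrightarrow> D $$ (i, i) - D $$ (j, j) = w D)"
proof -
  have "superbracket m1 D X = w D \<cdot>\<^sub>m X \<longleftrightarrow>
      (\<forall>i<N. \<forall>j<N. X $$ (i, j) \<noteq> 0 \<longrightarrow> D $$ (i, i) - D $$ (j, j) = w D)" if D: "D \<in> torus" for D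
  proof
    assume eq: "superbracket m1 D X = w D \<cdot>\<^sub>m X"
    show "\<forall>i<N. \<forall>j<N. X $$ (i, j) \<noteq> 0 \<longrightarrow> D $$ (i, i) - D $$ (j, j) = w D"
    proof (intro allI impI)
      fix i j assume "i < N" "j < N" "X $$ (i, j) \<noteq> 0"
      then show "D $$ (i, i) - D $$ (j, j) = w D"
        using torus_superbracket_index[OF D X, of i j] X unfolding eq by simp
    qed
  next
    assume *: "\<forall>i<N. \<forall>j<N. X $$ (i, j) \<noteq> 0 \<longrightarrow> D $$ (i, i) - D $$ (j, j) = w D"
    show "superbracket m1 D X = w D \<cdot>\<^sub>m X"
    proof (rule square_mat_eqI[where n = N])
      fix i j assume "i < N" "j < N"
      then show "superbracket m1 D X $$ (i, j) = (w D \<cdot>\<^sub>m X) $$ (i, j)"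
        using * X torus_superbracket_index[OF D X, of i j] by (cases "X $$ (i, j) = 0") auto
    qed (use torus_carrier[OF D] X in simp_all)
  qed
  then show ?thesis unfolding has_weight_def by blast
qed

lemma has_weight_conj_transpose:
  assumes X: "X \<in> carrier_mat N N" and w: "has_weight X w"
  shows "has_weight (conj_transpose X) (\<lambda>D. - w D)"
  unfolding has_weight_iff[OF conj_transpose_carrier]
proof (intro ballI allI impI)
  fix D i j assume "D \<in> torus" "i < N" "j < N" "conj_transpose X $$ (i, j) \<noteq> 0"
  then have "D $$ (j, j) - D $$ (i, i) = w D"
    using w unfolding has_weight_iff[OF X] by (simp add: conj_transpose_index)
  then show "D $$ (i, i) - D $$ (j, j) = - w D" by (simp add: algebra_simps)
qed

definition block_sign :: "nat \<Rightarrow> complex" where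
  "block_sign a = (if a = 1 then 1 else -1)"

lemma parity_sign_block: "i < N \<Longrightarrow> i \<in> block_indices a \<Longrightarrow> parity_sign i = block_sign a"
  by (simp add: parity_sign_def block_sign_def mem_block_indices)

text \<open>The bracket of a root vector with the opposite root vector, a multiple of the coroot.\<close>

definition coroot :: "complex mat \<Rightarrow> complex mat" where
  "coroot X = superbracket m1 X (conj_transpose X)"

lemma coroot_index:
  assumes X: "X \<in> block_matrices a" and i: "i < N" and j: "j < N"
  shows "coroot X $$ (i, j) =
    (\<Sum>c<N. X $$ (i, c) * cnj (X $$ (j, c)) - cnj (X $$ (c, i)) * X $$ (c, j))"
  unfolding coroot_def
    superbracket_index[OF matrices_carrier[OF block_matrices_matrices[OF X]] conj_transpose_carrier i j]
proof (rule sum.cong)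
  fix c assume "c \<in> {..<N}"
  then have c: "c < N" by simp
  have "bracket_sign m1 i c j = 1" if "X $$ (c, i) \<noteq> 0"
    using block_matrices_entry[OF X c i that] c i by (auto simp: mem_block_indices bracket_sign_def)
  then show "X $$ (i, c) * conj_transpose X $$ (c, j)
      - bracket_sign m1 i c j * (conj_transpose X $$ (i, c) * X $$ (c, j))
    = X $$ (i, c) * cnj (X $$ (j, c)) - cnj (X $$ (c, i)) * X $$ (c, j)"
    using c i j by (cases "X $$ (c, i) = 0") (simp_all add: conj_transpose_index)
qed simp

lemma supertrace_mult:
  assumes X: "X \<in> carrier_mat N N" and Y: "Y \<in> carrier_mat N N"
  shows "supertrace m1 (X * Y) = (\<Sum>i<N. parity_sign i * (\<Sum>j<N. X $$ (i, j) * Y $$ (j, i)))"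
  unfolding supertrace_eq_sum[OF mult_carrier_mat[OF X Y]]
  by (rule sum.cong) (use mat_mult_index[OF X Y] in auto)

lemma supertrace_mult_torus:
  assumes X: "X \<in> carrier_mat N N" and D: "D \<in> torus"
  shows "supertrace m1 (X * D) = (\<Sum>i<N. parity_sign i * (X $$ (i, i) * D $$ (i, i)))"
proof -
  have "(\<Sum>j<N. X $$ (i, j) * D $$ (j, i)) = X $$ (i, i) * D $$ (i, i)" if "i < N" for i
  proof -
    have "(\<Sum>j<N. X $$ (i, j) * D $$ (j, i)) = (\<Sum>j<N. if j = i then X $$ (i, i) * D $$ (i, i) else 0)"
      by (rule sum.cong) (use that torus_entry[OF D] in auto)
    then show ?thesis using that by simp
  qed
  then show ?thesis unfolding supertrace_mult[OF X torus_carrier[OF D]] by simp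
qed

definition norm_form :: "complex mat \<Rightarrow> complex" where
  "norm_form X = supertrace m1 (X * conj_transpose X)"

context
  fixes X a w
  assumes X: "X \<in> block_matrices a" and a: "a \<in> {1, 2}" and w: "has_weight X w"
begin

lemma weight_matrix_carrier: "X \<in> carrier_mat N N"
  using X by simp

lemma weight_entry:
  "D \<in> torus \<Longrightarrow> i < N \<Longrightarrow> j < N \<Longrightarrow> X $$ (i, j) \<noteq> 0 \<Longrightarrow> D $$ (i, i) - D $$ (j, j) = w D"
  using w unfolding has_weight_iff[OF weight_matrix_carrier] by blast

lemma coroot_block: "coroot X \<in> block_matrices a"
  unfolding coroot_def using X by simp

text \<open>A nonzero entry at \<open>(i, j)\<close> forces the torus to take the same value at \<open>i\<close> and \<open>j\<close>, so only the
exceptional pair of type \<open>D\<close> is left. There the equations of the orthosymplectic algebra say that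
the entry equals its own negative.\<close>

lemma coroot_diagonal:
  assumes i: "i < N" and j: "j < N" and ij: "i \<noteq> j"
  shows "coroot X $$ (i, j) = 0"
proof (rule ccontr)
  assume nz: "coroot X $$ (i, j) \<noteq> 0"
  then obtain c where c: "c < N" "X $$ (i, c) * cnj (X $$ (j, c)) - cnj (X $$ (c, i)) * X $$ (c, j) \<noteq> 0"
    unfolding coroot_index[OF X i j] using sum.not_neutral_contains_not_neutral by blast
  then have "X $$ (i, c) \<noteq> 0 \<and> X $$ (j, c) \<noteq> 0 \<or> X $$ (c, i) \<noteq> 0 \<and> X $$ (c, j) \<noteq> 0" by fastforce
  then have eq: "D $$ (i, i) = D $$ (j, j)" if D: "D \<in> torus" for D
  proof (elim disjE conjE)
    assume "X $$ (i, c) \<noteq> 0" "X $$ (j, c) \<noteq> 0"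
    then have "D $$ (i, i) - D $$ (c, c) = D $$ (j, j) - D $$ (c, c)"
      using weight_entry[OF D i c(1)] weight_entry[OF D j c(1)] by simp
    then show ?thesis by simp
  next
    assume "X $$ (c, i) \<noteq> 0" "X $$ (c, j) \<noteq> 0"
    then have "D $$ (c, c) - D $$ (i, i) = D $$ (c, c) - D $$ (j, j)"
      using weight_entry[OF D c(1) i] weight_entry[OF D c(1) j] by simp
    then show ?thesis by simp
  qed
  have "i < m1 \<longleftrightarrow> j < m1"
    using block_matrices_entry[OF coroot_block i j nz] i j by (auto simp: mem_block_indices)
  then have "osp_type \<and> j = star i \<and> swap_ends i \<noteq> i" using torus_separates[OF i j ij] eq by blast
  then have o: "osp_type" and ji: "j = star i" and sw: "swap_ends i \<noteq> i" by auto
  have "theta (coroot X) = coroot X"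
    using matrices_theta[OF block_matrices_matrices[OF coroot_block] o] .
  moreover have "theta (coroot X) $$ (i, star i) = - super_sign i (star i) * omega i / omega (star i) * coroot X $$ (i, star i)"
    using theta_index[OF i star_less[OF i], of "coroot X"] i by simp
  moreover have "super_sign i (star i) = 1" using i by (simp add: super_sign_def)
  moreover have "omega (star i) = omega i"
    using star_swap_eq[OF o sw] omega_swap_ends[OF o] by simp
  ultimately have "coroot X $$ (i, j) = - coroot X $$ (i, j)" using ji by simp
  then show False using nz by simp
qed

lemma coroot_torus_block:
  assumes sig: "sigma_matrix X = e \<cdot>\<^sub>m X" and e: "e * cnj e = 1"
  shows "coroot X \<in> torus_block a"
proof -
  have "sigma_matrix (coroot X) = superbracket m1 (e \<cdot>\<^sub>m X) (conj_transpose (e \<cdot>\<^sub>m X))"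
    unfolding coroot_def using X
    by (simp add: sigma_matrix_superbracket sigma_matrix_conj_transpose block_matrices_even sig)
  also have "\<dots> = coroot X"
  proof (rule square_mat_eqI[where n = N])
    fix i j assume i: "i < N" and j: "j < N"
    have "coroot (e \<cdot>\<^sub>m X) $$ (i, j) = (\<Sum>c<N. (e * cnj e) * (X $$ (i, c) * cnj (X $$ (j, c)) - cnj (X $$ (c, i)) * X $$ (c, j)))"
      unfolding coroot_index[OF block_matrices_smult[OF X] i j]
      by (rule sum.cong) (use i j weight_matrix_carrier in \<open>simp_all add: algebra_simps\<close>)
    then show "superbracket m1 (e \<cdot>\<^sub>m X) (conj_transpose (e \<cdot>\<^sub>m X)) $$ (i, j) = coroot X $$ (i, j)"
      using coroot_index[OF X i j] e by (simp add: coroot_def)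
  qed (use coroot_block weight_matrix_carrier in simp_all)
  finally show ?thesis unfolding torus_block_def
    using coroot_block coroot_diagonal by (auto intro!: diagonal_matI)
qed

lemma norm_form_eq: "norm_form X = block_sign a * (\<Sum>i<N. \<Sum>j<N. X $$ (i, j) * cnj (X $$ (i, j)))"
  unfolding norm_form_def supertrace_mult[OF weight_matrix_carrier conj_transpose_carrier] sum_distrib_left
proof (intro sum.cong refl)
  fix i j assume "i \<in> {..<N}" "j \<in> {..<N}"
  then have ij: "i < N" "j < N" by auto
  show "parity_sign i * (X $$ (i, j) * conj_transpose X $$ (j, i)) = block_sign a * (X $$ (i, j) * cnj (X $$ (i, j)))"
    using block_matrices_entry[OF X ij] parity_sign_block[OF ij(1)] ij
    by (cases "X $$ (i, j) = 0") (auto simp: conj_transpose_index)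
qed

text \<open>On one block the supertrace form is the trace form up to sign, so the pairing of a matrix with its
conjugate transpose is, up to sign, the sum of the squared moduli of its entries.\<close>

lemma norm_form_nonzero:
  assumes "X \<noteq> 0\<^sub>m N N"
  shows "norm_form X \<noteq> 0"
proof -
  obtain i j where ij: "i < N" "j < N" "X $$ (i, j) \<noteq> 0"
    using assms square_mat_eqI[OF weight_matrix_carrier zero_carrier_mat] by fastforce
  have "(\<Sum>i<N. \<Sum>j<N. X $$ (i, j) * cnj (X $$ (i, j))) = of_real (\<Sum>i<N. \<Sum>j<N. (cmod (X $$ (i, j)))\<^sup>2)"
    by (simp add: complex_norm_square[symmetric] mult.commute del: of_real_power)
  moreover have "(\<Sum>i<N. \<Sum>j<N. (cmod (X $$ (i, j)))\<^sup>2) > 0"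
    using ij by (intro sum_pos2[of _ i] sum_pos2[of _ j] sum_nonneg) auto
  ultimately show ?thesis unfolding norm_form_eq by (auto simp: block_sign_def simp del: of_real_sum)
qed

text \<open>Invariance of the supertrace form, read off from the entries: up to a scalar, the coroot represents
the weight.\<close>

lemma supertrace_coroot:
  assumes D: "D \<in> torus"
  shows "supertrace m1 (coroot X * D) = w D * norm_form X"
proof -
  let ?q = "\<lambda>i c. X $$ (i, c) * cnj (X $$ (i, c))"
  have "supertrace m1 (coroot X * D) =
     (\<Sum>i<N. \<Sum>c<N. parity_sign i * ?q i c * D $$ (i, i)) - (\<Sum>i<N. \<Sum>c<N. parity_sign i * ?q c i * D $$ (i, i))"
    unfolding supertrace_mult_torus[OF matrices_carrier[OF block_matrices_matrices[OF coroot_block]] D]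
      sum_subtractf[symmetric]
    by (rule sum.cong)
      (simp_all add: coroot_index[OF X] sum_distrib_left sum_distrib_right algebra_simps sum_subtractf[symmetric]
        del: sum_subtractf)
  also have "(\<Sum>i<N. \<Sum>c<N. parity_sign i * ?q c i * D $$ (i, i)) = (\<Sum>i<N. \<Sum>c<N. parity_sign c * ?q i c * D $$ (c, c))"
    by (rule sum.swap)
  also have "(\<Sum>i<N. \<Sum>c<N. parity_sign i * ?q i c * D $$ (i, i)) - \<dots> =
      (\<Sum>i<N. \<Sum>c<N. w D * (block_sign a * ?q i c))"
    unfolding sum_subtractf[symmetric]
  proof (intro sum.cong refl)
    fix i c assume "i \<in> {..<N}" "c \<in> {..<N}"
    then have ic: "i < N" "c < N" by auto
    show "parity_sign i * ?q i c * D $$ (i, i) - parity_sign c * ?q i c * D $$ (c, c) = w D * (block_sign a * ?q i c)"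
    proof (cases "X $$ (i, c) = 0")
      case False
      have p: "parity_sign i = block_sign a" "parity_sign c = block_sign a"
        using block_matrices_entry[OF X ic False] parity_sign_block ic by auto
      show ?thesis unfolding p weight_entry[OF D ic False, symmetric] by (simp add: algebra_simps)
    qed simp
  qed
  also have "\<dots> = w D * norm_form X" by (simp add: norm_form_eq sum_distrib_left)
  finally show ?thesis .
qed

end

text \<open>Conjugating the entries, with the opposite sign in the lower block, gives an element of the torus
whose pairing with \<open>D\<close> is the sum of the squared moduli of the entries of \<open>D\<close>.\<close>

lemma torus_nondegenerate:
  assumes D: "D \<in> torus" and orth: "\<And>E. E \<in> torus \<Longrightarrow> supertrace m1 (D * E) = 0"
  shows "D = 0\<^sub>m N N"
proof -
  obtain D1 D2 where D12: "D1 \<in> torus_block 1" "D2 \<in> torus_block 2" "D = D1 + D2"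
    using D by (auto simp: torus_def)
  define E where "E = conj_transpose D1 + (-1) \<cdot>\<^sub>m conj_transpose D2"
  have E: "E \<in> torus" unfolding E_def torus_def using D12 torus_block_conj_transpose torus_block_smult by blast
  have e: "parity_sign i * (D $$ (i, i) * E $$ (i, i)) = of_real ((cmod (D $$ (i, i)))\<^sup>2)" if i: "i < N" for i
  proof -
    have b: "D1 \<in> block_matrices 1" "D2 \<in> block_matrices 2" using D12 by (auto simp: torus_block_def)
    have z: "i < m1 \<Longrightarrow> D2 $$ (i, i) = 0" "\<not> i < m1 \<Longrightarrow> D1 $$ (i, i) = 0"
      using block_matrices_entry[OF b(1) i i] block_matrices_entry[OF b(2) i i] i by (auto simp: mem_block_indices)
    have "D $$ (i, i) = D1 $$ (i, i) + D2 $$ (i, i)" "E $$ (i, i) = cnj (D1 $$ (i, i)) - cnj (D2 $$ (i, i))"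
      using i torus_block_carrier[OF D12(1)] torus_block_carrier[OF D12(2)] unfolding D12(3) E_def
      by (simp_all add: conj_transpose_index)
    then show ?thesis using z
      by (cases "i < m1") (simp_all add: parity_sign_def complex_norm_square del: of_real_power)
  qed
  have "of_real (\<Sum>i<N. (cmod (D $$ (i, i)))\<^sup>2) = supertrace m1 (D * E)"
    unfolding supertrace_mult_torus[OF torus_carrier[OF D] E] of_real_sum
    by (rule sum.cong) (use e in auto)
  then have "(\<Sum>i<N. (cmod (D $$ (i, i)))\<^sup>2) = 0" using orth[OF E] by (simp del: of_real_sum)
  then have "\<forall>i<N. D $$ (i, i) = 0" by (subst (asm) sum_nonneg_eq_0_iff) auto
  then have "D $$ (i, j) = 0\<^sub>m N N $$ (i, j)" if "i < N" "j < N" for i j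
    using torus_entry[OF D that] that by (cases "i = j") auto
  then show ?thesis using square_mat_eqI[OF torus_carrier[OF D] zero_carrier_mat] by blast
qed

section \<open>Existence of roots\<close>

lemma torus_star_entry:
  assumes D: "D \<in> torus" and i: "i < N"
  shows "D $$ (star i, star i) = - D $$ (i, i)"
proof -
  have "theta D = D"
    using matrices_theta[OF torus_matrices[OF D]] torus_sigma_matrix[OF D] torus_carrier[OF D]
    by (cases osp_type) (auto simp: sigma_matrix_eq)
  then have "D $$ (i, i) = - D $$ (star i, star i)"
    using theta_index[OF i i, of D] by (simp add: super_sign_def)
  then show ?thesis by simp
qed

text \<open>A single entry that joins an index to its partner is an eigenvector of the twist, of weight twice a
coordinate. It is available except in the upper block of type \<open>D\<close>, where skew-symmetry kills it.\<close>

lemma root_matrix_exists_antidiagonal: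
  assumes k: "1 \<le> k" and l: "1 \<le> l" and a: "a \<in> {1, 2}" and na: "\<not> (osp_type \<and> a = 1)"
  shows "\<exists>X e i j. X \<in> block_matrices a \<and> X \<noteq> 0\<^sub>m N N \<and> e \<in> {1, -1} \<and> sigma_matrix X = e \<cdot>\<^sub>m X \<and>
    has_weight X (\<lambda>D. D $$ (i, i) - D $$ (j, j)) \<and> (\<exists>D\<in>torus. D $$ (i, i) \<noteq> D $$ (j, j)) \<and> i < N \<and> j < N"
proof -
  define i where "i = (if a = 1 then 0 else m1)"
  have i: "i < N" using k l unfolding i_def by (cases T) auto
  have ib: "i < m1 \<longleftrightarrow> a = 1" using k l a unfolding i_def by (cases T) auto
  have ns: "star i \<noteq> i" using k l a unfolding i_def star_def by (cases T) auto
  have ne: "T \<noteq> A_even_even \<or> i \<noteq> m1 + l" "T \<noteq> A_even_even \<or> star i \<noteq> m1 + l"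
    using k l a unfolding i_def star_def by (cases T; auto)+
  have om: "omega i * omega i = 1" "omega (star i) * omega (star i) = 1"
    using ne by (simp_all only: omega_square)
  have omD: "omega i = 1 \<and> omega (star i) = - 1 \<and> swap_ends i = i \<and> swap_ends (star i) = star i" if osp_type
    using that na l unfolding osp_type_def i_def omega_def star_def swap_ends_def by auto
  define X where "X = mat N N (\<lambda>(b, c). of_bool (b = i \<and> c = star i) :: complex)"
  have XN: "X \<in> carrier_mat N N" by (simp add: X_def)
  have Xi: "X $$ (b, c) = of_bool (b = i \<and> c = star i)" if "b < N" "c < N" for b c
    using that by (simp add: X_def)
  define e where "e = - omega i / omega (star i)"
  have th: "theta X = e \<cdot>\<^sub>m X"
  proof (rule square_mat_eqI[where n = N])
    fix b c assume bc: "b < N" "c < N"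
    have "star c = i \<longleftrightarrow> c = star i" "star b = star i \<longleftrightarrow> b = i"
      using star_inj[OF bc(2) star_less[OF i]] star_inj[OF bc(1) i] star_star[OF i] by simp_all
    then have "X $$ (star c, star b) = of_bool (b = i \<and> c = star i)"
      using Xi[OF star_less[OF bc(2)] star_less[OF bc(1)]] by auto
    moreover have "super_sign i (star i) = 1" using i by (simp add: super_sign_def)
    ultimately show "theta X $$ (b, c) = (e \<cdot>\<^sub>m X) $$ (b, c)"
      using bc XN Xi[OF bc] by (simp add: theta_index e_def)
  qed (use XN in simp_all)
  have e: "e * e = 1" unfolding e_def using om by (simp add: field_simps)
  have eD: "e = 1" if osp_type using omD[OF that] by (simp add: e_def)
  have M: "X \<in> matrices"
  proof (rule matricesI[OF XN])
    show "supertrace m1 X = 0"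
      unfolding supertrace_eq_sum[OF XN] by (rule sum.neutral) (use Xi ns in auto)
    show "theta X = X" if osp_type
      unfolding th eD[OF that] by (rule smult_one_mat)
  qed
  have "X \<in> block_matrices a"
  proof (rule block_matricesI[OF M])
    fix b c assume bc: "b < N" "c < N" "X $$ (b, c) \<noteq> 0"
    then have "b = i" "c = star i" using Xi by auto
    then show "b \<in> block_indices a \<and> c \<in> block_indices a"
      using i ib by (simp add: mem_block_indices)
  qed
  moreover have "X \<noteq> 0\<^sub>m N N"
  proof
    assume "X = 0\<^sub>m N N"
    then have "X $$ (i, star i) = 0" using i by simp
    then show False using Xi[OF i star_less[OF i]] by simp
  qed
  moreover have "e \<in> {1, -1}" using e by (simp add: square_eq_1_iff)
  moreover have "sigma_matrix X = e \<cdot>\<^sub>m X"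
  proof (cases osp_type)
    case True
    have "swap_conj X = X"
    proof (rule square_mat_eqI[where n = N])
      fix b c assume bc: "b < N" "c < N"
      have "swap_ends b = i \<longleftrightarrow> b = i" "swap_ends c = star i \<longleftrightarrow> c = star i"
        using omD[OF True] swap_ends_swap_ends by metis+
      then show "swap_conj X $$ (b, c) = X $$ (b, c)"
        using bc swap_ends_less[OF True] by (simp add: swap_conj_index Xi)
    qed (use XN in simp_all)
    then show ?thesis using True XN by (simp add: sigma_matrix_eq eD smult_one_mat)
  qed (use XN th in \<open>simp add: sigma_matrix_eq\<close>)
  moreover have "has_weight X (\<lambda>D. D $$ (i, i) - D $$ (star i, star i))"
    unfolding has_weight_iff[OF XN] using Xi by auto
  moreover have "\<exists>D\<in>torus. D $$ (i, i) \<noteq> D $$ (star i, star i)"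
  proof
    show "coroot_matrix i \<in> torus"
      by (rule torus_block_torus[OF coroot_matrix_torus[OF i]]) (use omD in auto)
    show "coroot_matrix i $$ (i, i) \<noteq> coroot_matrix i $$ (star i, star i)"
      using i ns by (simp add: coroot_matrix_index)
  qed
  ultimately show ?thesis using i star_less[OF i] by blast
qed

text \<open>The sum of the two root vectors that join the first index to the two ends exchanged by the
automorphism: it is fixed, and its weight is the first coordinate.\<close>

lemma root_matrix_exists_osp:
  assumes k: "1 \<le> k" and D: osp_type
  shows "\<exists>X e i j. X \<in> block_matrices 1 \<and> X \<noteq> 0\<^sub>m N N \<and> e \<in> {1, -1} \<and> sigma_matrix X = e \<cdot>\<^sub>m X \<and>
    has_weight X (\<lambda>D. D $$ (i, i) - D $$ (j, j)) \<and> (\<exists>D\<in>torus. D $$ (i, i) \<noteq> D $$ (j, j)) \<and> i < N \<and> j < N"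
proof -
  have m1: "m1 = 2 * k + 2" using D by (simp add: osp_type_def)
  have st: "star 0 = k + 1" "star (k + 1) = 0" "star k = 2 * k + 1" "star (2 * k + 1) = k"
    using D k unfolding star_def osp_type_def by auto
  have sw: "swap_ends 0 = 0" "swap_ends (k + 1) = k + 1" "swap_ends k = 2 * k + 1" "swap_ends (2 * k + 1) = k"
    using k by (auto simp: swap_ends_def)
  \<comment> \<open>Positions with entry 1, and those with entry -1 forced by the symmetry of the algebra.\<close>
  define P where "P b c \<longleftrightarrow> b = 0 \<and> (c = k \<or> c = 2 * k + 1)" for b c :: nat
  define Q where "Q b c \<longleftrightarrow> c = k + 1 \<and> (b = k \<or> b = 2 * k + 1)" for b c :: nat
  define X where "X = mat N N (\<lambda>(b, c). of_bool (P b c) - of_bool (Q b c) :: complex)"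
  have XN: "X \<in> carrier_mat N N" by (simp add: X_def)
  have Xi: "X $$ (b, c) = of_bool (P b c) - of_bool (Q b c)" if "b < N" "c < N" for b c
    using that by (simp add: X_def)
  have nz: "b < m1 \<and> c < m1" if "P b c \<or> Q b c" for b c
    using that k m1 by (auto simp: P_def Q_def)
  have small: "0 < N" "k < N" "k + 1 < N" "2 * k + 1 < N" using m1 by auto
  have sb: "star b = 0 \<longleftrightarrow> b = k + 1" "star b = k + 1 \<longleftrightarrow> b = 0" "star b = k \<longleftrightarrow> b = 2 * k + 1"
    "star b = 2 * k + 1 \<longleftrightarrow> b = k" if "b < N" for b
    using star_inj[OF that small(3)] star_inj[OF that small(1)] star_inj[OF that small(4)] star_inj[OF that small(2)]
    unfolding st by auto
  have PQ: "P (star c) (star b) = Q b c" "Q (star c) (star b) = P b c" if bc: "b < N" "c < N" for b c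
    unfolding P_def Q_def sb[OF bc(1)] sb[OF bc(2)] by blast+
  have PQs: "P (swap_ends b) (swap_ends c) = P b c" "Q (swap_ends b) (swap_ends c) = Q b c" for b c
    using k unfolding P_def Q_def swap_ends_def by auto
  have om: "omega b = 1" if "b < m1" for b
    using that D unfolding omega_def osp_type_def by auto
  have th: "theta X = X"
  proof (rule square_mat_eqI[where n = N])
    fix b c assume bc: "b < N" "c < N"
    have "X $$ (star c, star b) = - X $$ (b, c)"
      using Xi[OF star_less[OF bc(2)] star_less[OF bc(1)]] Xi[OF bc] PQ[OF bc] by simp
    moreover have "X $$ (b, c) = 0 \<or> b < m1 \<and> c < m1"
      using nz[of b c] Xi[OF bc] by auto
    ultimately show "theta X $$ (b, c) = X $$ (b, c)"
      using theta_index[OF bc, of X] om[of b] om[of c] by (auto simp: super_sign_def)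
  qed (use XN in simp_all)
  have M: "X \<in> matrices" by (rule matricesI[OF XN]) (use D th in auto)
  have "X \<in> block_matrices 1"
  proof (rule block_matricesI[OF M])
    fix b c assume bc: "b < N" "c < N" "X $$ (b, c) \<noteq> 0"
    then have "P b c \<or> Q b c" using Xi by auto
    then show "b \<in> block_indices 1 \<and> c \<in> block_indices 1"
      using nz bc by (simp add: mem_block_indices)
  qed
  moreover have "X \<noteq> 0\<^sub>m N N"
  proof
    assume "X = 0\<^sub>m N N"
    then have "X $$ (0, k) = 0" using small by simp
    then show False using Xi[OF small(1,2)] k by (simp add: P_def Q_def)
  qed
  moreover have "sigma_matrix X = 1 \<cdot>\<^sub>m X"
  proof -
    have "swap_conj X = X"
      by (rule square_mat_eqI[where n = N])
        (use XN swap_ends_less[OF D] in \<open>simp_all add: swap_conj_index Xi PQs\<close>)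
    then show ?thesis using D XN by (simp add: sigma_matrix_eq smult_one_mat)
  qed
  moreover have "has_weight X (\<lambda>D. D $$ (0, 0) - D $$ (k, k))"
    unfolding has_weight_iff[OF XN]
  proof (intro ballI allI impI)
    fix E b c assume E: "E \<in> torus" and bc: "b < N" "c < N" "X $$ (b, c) \<noteq> 0"
    have "E $$ (2 * k + 1, 2 * k + 1) = E $$ (k, k)"
      using torus_sigma_matrix[OF E] torus_carrier[OF E] D small sw(3) swap_conj_index[OF small(2) small(2), of E]
      by (simp add: sigma_matrix_eq)
    moreover have "E $$ (2 * k + 1, 2 * k + 1) = - E $$ (k, k)" "E $$ (k + 1, k + 1) = - E $$ (0, 0)"
      using torus_star_entry[OF E small(2)] torus_star_entry[OF E small(1)] st by auto
    moreover have "P b c \<or> Q b c" using Xi bc by auto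
    ultimately show "E $$ (b, b) - E $$ (c, c) = E $$ (0, 0) - E $$ (k, k)"
      unfolding P_def Q_def by auto
  qed
  moreover have "\<exists>E\<in>torus. E $$ (0, 0) \<noteq> E $$ (k, k)"
  proof
    show "coroot_matrix 0 \<in> torus"
      by (rule torus_block_torus[OF coroot_matrix_torus[OF small(1)]]) (use sw in auto)
    show "coroot_matrix 0 $$ (0, 0) \<noteq> coroot_matrix 0 $$ (k, k)"
      using small k st by (simp add: coroot_matrix_index)
  qed
  ultimately show ?thesis using small by blast
qed

lemma root_matrix_exists:
  assumes "1 \<le> k" "1 \<le> l" "a \<in> {1, 2}"
  shows "\<exists>X e i j. X \<in> block_matrices a \<and> X \<noteq> 0\<^sub>m N N \<and> e \<in> {1, -1} \<and> sigma_matrix X = e \<cdot>\<^sub>m X \<and>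
    has_weight X (\<lambda>D. D $$ (i, i) - D $$ (j, j)) \<and> (\<exists>D\<in>torus. D $$ (i, i) \<noteq> D $$ (j, j)) \<and> i < N \<and> j < N"
  using root_matrix_exists_antidiagonal[OF assms] root_matrix_exists_osp[OF assms(1)]
  by (cases "osp_type \<and> a = 1") auto

section \<open>Matrices modulo scalars\<close>

text \<open>The case \<open>A(p,p)\<close>.\<close>

definition scalar_quotient :: bool where
  "scalar_quotient \<longleftrightarrow> \<not> osp_type \<and> m1 = m2"

lemma congr_iff:
  "(X, Y) \<in> congr \<longleftrightarrow> X \<in> matrices \<and> Y \<in> matrices \<and>
     (\<exists>c. (c \<noteq> 0 \<longrightarrow> scalar_quotient) \<and> X = Y + c \<cdot>\<^sub>m 1\<^sub>m N)"
proof (cases "X \<in> matrices \<and> Y \<in> matrices")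
  case True
  then have c: "X \<in> carrier_mat N N" "Y \<in> carrier_mat N N" by simp_all
  have sub: "X - Y = c \<cdot>\<^sub>m 1\<^sub>m N \<longleftrightarrow> X = Y + c \<cdot>\<^sub>m 1\<^sub>m N" for c
  proof
    assume *: "X - Y = c \<cdot>\<^sub>m 1\<^sub>m N"
    show "X = Y + c \<cdot>\<^sub>m 1\<^sub>m N"
    proof (rule square_mat_eqI[where n = N])
      fix i j assume "i < N" "j < N"
      then show "X $$ (i, j) = (Y + c \<cdot>\<^sub>m 1\<^sub>m N) $$ (i, j)"
        using arg_cong[OF *, of "\<lambda>M. M $$ (i, j)"] c by (auto simp: algebra_simps)
    qed (use c in simp_all)
  next
    assume *: "X = Y + c \<cdot>\<^sub>m 1\<^sub>m N"
    show "X - Y = c \<cdot>\<^sub>m 1\<^sub>m N"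
      unfolding * by (rule square_mat_eqI[where n = N]) (use c in \<open>simp_all add: minus_carrier_mat\<close>)
  qed
  have "Y + 0 \<cdot>\<^sub>m 1\<^sub>m N = Y" by (rule square_mat_eqI[where n = N]) (use c in simp_all)
  moreover have "(X, Y) \<in> congr \<longleftrightarrow> (if scalar_quotient then \<exists>c. X - Y = c \<cdot>\<^sub>m 1\<^sub>m N else X = Y)"
    unfolding congr_def scalar_quotient_def osp_type_def using True by simp
  ultimately show ?thesis using True unfolding sub by (cases scalar_quotient) auto
qed (auto simp: congr_def)

lemma congrI:
  "X \<in> matrices \<Longrightarrow> Y \<in> matrices \<Longrightarrow> c \<noteq> 0 \<longrightarrow> scalar_quotient \<Longrightarrow> X = Y + c \<cdot>\<^sub>m 1\<^sub>m N \<Longrightarrow> (X, Y) \<in> congr"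
  unfolding congr_iff by blast

lemma congrE:
  assumes "(X, Y) \<in> congr"
  obtains c where "X \<in> matrices" "Y \<in> matrices" "c \<noteq> 0 \<longrightarrow> scalar_quotient" "X = Y + c \<cdot>\<^sub>m 1\<^sub>m N"
  using assms unfolding congr_iff by blast

lemma add_scalar_index:
  fixes X :: "complex mat"
  shows "X \<in> carrier_mat N N \<Longrightarrow> i < N \<Longrightarrow> j < N \<Longrightarrow> (X + c \<cdot>\<^sub>m 1\<^sub>m N) $$ (i, j) = X $$ (i, j) + (if i = j then c else 0)"
  by simp

lemma add_zero_scalar:
  fixes X :: "complex mat"
  shows "X \<in> carrier_mat N N \<Longrightarrow> X + 0 \<cdot>\<^sub>m 1\<^sub>m N = X"
  by (rule square_mat_eqI[where n = N]) simp_all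

lemma equiv_congr: "equiv matrices congr"
proof (rule equivI)
  show "congr \<subseteq> matrices \<times> matrices" by (auto simp: congr_def)
  show "refl_on matrices congr"
    unfolding refl_on_def using add_zero_scalar[OF matrices_carrier] by (auto simp: congr_iff intro!: exI[of _ 0])
  show "sym congr"
  proof (rule symI)
    fix X Y assume "(X, Y) \<in> congr"
    then obtain c where c: "X \<in> matrices" "Y \<in> matrices" "c \<noteq> 0 \<longrightarrow> scalar_quotient" "X = Y + c \<cdot>\<^sub>m 1\<^sub>m N"
      by (elim congrE) blast
    have "Y = X + (- c) \<cdot>\<^sub>m 1\<^sub>m N"
      unfolding c(4) by (rule square_mat_eqI[where n = N]) (use c(2) in simp_all)
    then show "(Y, X) \<in> congr" by (intro congrI[where c = "- c"]) (use c(1-3) in simp_all)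
  qed
  show "trans congr"
  proof (rule transI)
    fix X Y Z assume "(X, Y) \<in> congr" "(Y, Z) \<in> congr"
    then obtain c c' where c: "X \<in> matrices" "Y \<in> matrices" "Z \<in> matrices" "c \<noteq> 0 \<longrightarrow> scalar_quotient"
      "X = Y + c \<cdot>\<^sub>m 1\<^sub>m N" "c' \<noteq> 0 \<longrightarrow> scalar_quotient" "Y = Z + c' \<cdot>\<^sub>m 1\<^sub>m N"
      by (elim congrE) blast
    have "X = Z + (c + c') \<cdot>\<^sub>m 1\<^sub>m N"
      unfolding c(5) c(7) by (rule square_mat_eqI[where n = N]) (use c(3) in simp_all)
    then show "(X, Z) \<in> congr" by (intro congrI[where c = "c + c'"]) (use c(1-4,6) in auto)
  qed
qed

lemma cls_eq_iff: "X \<in> matrices \<Longrightarrow> Y \<in> matrices \<Longrightarrow> cls X = cls Y \<longleftrightarrow> (X, Y) \<in> congr"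
  using eq_equiv_class_iff[OF equiv_congr] .

lemma cls_eqI: "(X, Y) \<in> congr \<Longrightarrow> cls X = cls Y"
  using equiv_class_eq[OF equiv_congr] .

lemma cls_carrier [simp]: "X \<in> matrices \<Longrightarrow> cls X \<in> carrier fin_alg"
  by (simp add: fin_alg_def quotientI)

lemma carrier_cls: "S \<in> carrier fin_alg \<Longrightarrow> \<exists>X\<in>matrices. S = cls X"
  by (auto simp: fin_alg_def quotient_def)

text \<open>Scalar matrices are even and commute with everything, also in the super sense.\<close>

lemma superbracket_add_scalar:
  assumes X: "X \<in> carrier_mat N N" and Y: "Y \<in> carrier_mat N N"
  shows "superbracket m1 (X + c \<cdot>\<^sub>m 1\<^sub>m N) Y = superbracket m1 X Y"
    and "superbracket m1 Y (X + c \<cdot>\<^sub>m 1\<^sub>m N) = superbracket m1 Y X"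
proof -
  have Xc: "X + c \<cdot>\<^sub>m 1\<^sub>m N \<in> carrier_mat N N" by simp
  have d: "(\<Sum>a<N. (if i = a then c else 0) * Z $$ (a, j) - bracket_sign m1 i a j * (Z $$ (i, a) * (if a = j then c else 0))) = 0"
    "(\<Sum>a<N. Z $$ (i, a) * (if a = j then c else 0) - bracket_sign m1 i a j * ((if i = a then c else 0) * Z $$ (a, j))) = 0"
    if "i < N" "j < N" for Z :: "complex mat" and i j
  proof -
    have "(\<Sum>a<N. (if i = a then c else 0) * Z $$ (a, j) - bracket_sign m1 i a j * (Z $$ (i, a) * (if a = j then c else 0)))
       = (\<Sum>a<N. (if a = i then c * Z $$ (i, j) else 0) - (if a = j then c * Z $$ (i, j) else 0))"
      by (rule sum.cong) (auto simp: bracket_sign_def)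
    then show "(\<Sum>a<N. (if i = a then c else 0) * Z $$ (a, j) - bracket_sign m1 i a j * (Z $$ (i, a) * (if a = j then c else 0))) = 0"
      using that by (simp add: sum_subtractf)
    have "(\<Sum>a<N. Z $$ (i, a) * (if a = j then c else 0) - bracket_sign m1 i a j * ((if i = a then c else 0) * Z $$ (a, j)))
       = (\<Sum>a<N. (if a = j then c * Z $$ (i, j) else 0) - (if a = i then c * Z $$ (i, j) else 0))"
      by (rule sum.cong) (auto simp: bracket_sign_def)
    then show "(\<Sum>a<N. Z $$ (i, a) * (if a = j then c else 0) - bracket_sign m1 i a j * ((if i = a then c else 0) * Z $$ (a, j))) = 0"
      using that by (simp add: sum_subtractf)
  qed
  show "superbracket m1 (X + c \<cdot>\<^sub>m 1\<^sub>m N) Y = superbracket m1 X Y"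
  proof (rule square_mat_eqI[where n = N])
    fix i j assume ij: "i < N" "j < N"
    have "superbracket m1 (X + c \<cdot>\<^sub>m 1\<^sub>m N) Y $$ (i, j) =
      (\<Sum>a<N. (X $$ (i, a) * Y $$ (a, j) - bracket_sign m1 i a j * (Y $$ (i, a) * X $$ (a, j)))
        + ((if i = a then c else 0) * Y $$ (a, j) - bracket_sign m1 i a j * (Y $$ (i, a) * (if a = j then c else 0))))"
      unfolding superbracket_index[OF Xc Y ij]
      by (rule sum.cong) (use ij in \<open>simp_all only: add_scalar_index[OF X] lessThan_iff, simp add: algebra_simps\<close>)
    then show "superbracket m1 (X + c \<cdot>\<^sub>m 1\<^sub>m N) Y $$ (i, j) = superbracket m1 X Y $$ (i, j)"
      unfolding sum.distrib d(1)[OF ij] superbracket_index[OF X Y ij] by simp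
  qed (use X Y Xc superbracket_carrier in blast)+
  show "superbracket m1 Y (X + c \<cdot>\<^sub>m 1\<^sub>m N) = superbracket m1 Y X"
  proof (rule square_mat_eqI[where n = N])
    fix i j assume ij: "i < N" "j < N"
    have "superbracket m1 Y (X + c \<cdot>\<^sub>m 1\<^sub>m N) $$ (i, j) =
      (\<Sum>a<N. (Y $$ (i, a) * X $$ (a, j) - bracket_sign m1 i a j * (X $$ (i, a) * Y $$ (a, j)))
        + (Y $$ (i, a) * (if a = j then c else 0) - bracket_sign m1 i a j * ((if i = a then c else 0) * Y $$ (a, j))))"
      unfolding superbracket_index[OF Y Xc ij]
      by (rule sum.cong) (use ij in \<open>simp_all only: add_scalar_index[OF X] lessThan_iff, simp add: algebra_simps\<close>)
    then show "superbracket m1 Y (X + c \<cdot>\<^sub>m 1\<^sub>m N) $$ (i, j) = superbracket m1 Y X $$ (i, j)"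
      unfolding sum.distrib d(2)[OF ij] superbracket_index[OF Y X ij] by simp
  qed (use X Y Xc superbracket_carrier in blast)+
qed

lemma cls_mult [simp]:
  assumes X: "X \<in> matrices" and Y: "Y \<in> matrices"
  shows "cls X \<otimes>\<^bsub>fin_alg\<^esub> cls Y = cls (superbracket m1 X Y)"
proof -
  have "congruent2 congr congr (\<lambda>X Y. cls (superbracket m1 X Y))"
    by (rule congruent2I[OF equiv_congr equiv_congr])
      (auto simp: congr_iff superbracket_add_scalar)
  from UN_equiv_class2[OF equiv_congr equiv_congr this X Y] show ?thesis by (simp add: fin_alg_def)
qed

lemma cls_add [simp]:
  assumes X: "X \<in> matrices" and Y: "Y \<in> matrices"
  shows "cls X \<oplus>\<^bsub>fin_alg\<^esub> cls Y = cls (X + Y)"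
proof -
  have *: "cls (X1 + Y1) = cls (X2 + Y2)" if h: "(X1, X2) \<in> congr" "(Y1, Y2) \<in> congr" for X1 X2 Y1 Y2
  proof (rule cls_eqI)
    obtain c c' where c: "X1 \<in> matrices" "X2 \<in> matrices" "c \<noteq> 0 \<longrightarrow> scalar_quotient" "X1 = X2 + c \<cdot>\<^sub>m 1\<^sub>m N"
      "Y1 \<in> matrices" "Y2 \<in> matrices" "c' \<noteq> 0 \<longrightarrow> scalar_quotient" "Y1 = Y2 + c' \<cdot>\<^sub>m 1\<^sub>m N"
      using h by (elim congrE) blast
    have eq: "X1 + Y1 = (X2 + Y2) + (c + c') \<cdot>\<^sub>m 1\<^sub>m N"
      unfolding c(4) c(8) by (rule square_mat_eqI[where n = N]) (use matrices_carrier[OF c(2)] matrices_carrier[OF c(6)] in simp_all)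
    show "(X1 + Y1, X2 + Y2) \<in> congr"
      by (rule congrI[OF matrices_add[OF c(1) c(5)] matrices_add[OF c(2) c(6)] _ eq]) (use c(3,7) in auto)
  qed
  have "congruent2 congr congr (\<lambda>X Y. cls (X + Y))"
    unfolding congruent2_def using * by blast
  from UN_equiv_class2[OF equiv_congr equiv_congr this X Y] show ?thesis by (simp add: fin_alg_def)
qed

lemma cls_smult [simp]:
  assumes X: "X \<in> matrices"
  shows "z \<odot>\<^bsub>fin_alg\<^esub> cls X = cls (z \<cdot>\<^sub>m X)"
proof -
  have "cls (z \<cdot>\<^sub>m X1) = cls (z \<cdot>\<^sub>m X2)" if h: "(X1, X2) \<in> congr" for X1 X2
  proof (rule cls_eqI)
    obtain c where c: "X1 \<in> matrices" "X2 \<in> matrices" "c \<noteq> 0 \<longrightarrow> scalar_quotient" "X1 = X2 + c \<cdot>\<^sub>m 1\<^sub>m N"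
      using h by (elim congrE) blast
    have eq: "z \<cdot>\<^sub>m X1 = z \<cdot>\<^sub>m X2 + (z * c) \<cdot>\<^sub>m 1\<^sub>m N"
      unfolding c(4) by (rule square_mat_eqI[where n = N]) (use matrices_carrier[OF c(2)] in \<open>simp_all add: algebra_simps\<close>)
    show "(z \<cdot>\<^sub>m X1, z \<cdot>\<^sub>m X2) \<in> congr"
      by (rule congrI[OF matrices_smult[OF c(1)] matrices_smult[OF c(2)] _ eq]) (use c(3) in auto)
  qed
  then have "(\<lambda>X. cls (z \<cdot>\<^sub>m X)) respects congr" unfolding congruent_def by blast
  from UN_equiv_class[OF equiv_congr this X] show ?thesis by (simp add: fin_alg_def)
qed

lemma sigma_cls [simp]:
  assumes X: "X \<in> matrices"
  shows "sigma (cls X) = cls (sigma_matrix X)"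
proof -
  have "cls (sigma_matrix X1) = cls (sigma_matrix X2)" if h: "(X1, X2) \<in> congr" for X1 X2
  proof (rule cls_eqI)
    obtain c where c: "X1 \<in> matrices" "X2 \<in> matrices" "c \<noteq> 0 \<longrightarrow> scalar_quotient" "X1 = X2 + c \<cdot>\<^sub>m 1\<^sub>m N"
      using h by (elim congrE) blast
    have eq: "sigma_matrix X1 = sigma_matrix X2 + (- c) \<cdot>\<^sub>m 1\<^sub>m N"
    proof (cases "c = 0")
      case True
      then show ?thesis unfolding c(4) using c(2) by (simp add: add_zero_scalar)
    next
      case False
      then have o: "\<not> osp_type" using c(3) by (simp add: scalar_quotient_def)
      have "theta (X2 + c \<cdot>\<^sub>m 1\<^sub>m N) = theta X2 + (- c) \<cdot>\<^sub>m 1\<^sub>m N"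
      proof (rule square_mat_eqI[where n = N])
        fix i j assume ij: "i < N" "j < N"
        show "theta (X2 + c \<cdot>\<^sub>m 1\<^sub>m N) $$ (i, j) = (theta X2 + (- c) \<cdot>\<^sub>m 1\<^sub>m N) $$ (i, j)"
          unfolding add_scalar_index[OF theta_carrier ij] theta_index[OF ij]
            add_scalar_index[OF matrices_carrier[OF c(2)] star_less[OF ij(2)] star_less[OF ij(1)]] star_inj[OF ij(2,1)]
          by (cases "i = j") (simp_all add: super_sign_def distrib_left add_divide_distrib)
      qed simp_all
      then show ?thesis unfolding c(4) using c(2) o by (simp add: sigma_matrix_eq)
    qed
    show "(sigma_matrix X1, sigma_matrix X2) \<in> congr"
      by (rule congrI[OF matrices_sigma_matrix[OF c(1)] matrices_sigma_matrix[OF c(2)] _ eq]) (use c(3) in auto)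
  qed
  then have "(\<lambda>X. cls (sigma_matrix X)) respects congr" unfolding congruent_def by blast
  from UN_equiv_class[OF equiv_congr this X] show ?thesis by (simp add: sigma_def)
qed

lemma supertrace_mult_add_scalar:
  assumes X: "X \<in> carrier_mat N N" and Y: "Y \<in> carrier_mat N N"
  shows "supertrace m1 ((X + c \<cdot>\<^sub>m 1\<^sub>m N) * Y) = supertrace m1 (X * Y) + c * supertrace m1 Y"
    and "supertrace m1 (Y * (X + c \<cdot>\<^sub>m 1\<^sub>m N)) = supertrace m1 (Y * X) + c * supertrace m1 Y"
proof -
  have Xc: "X + c \<cdot>\<^sub>m 1\<^sub>m N \<in> carrier_mat N N" by simp
  have "(\<Sum>j<N. (X + c \<cdot>\<^sub>m 1\<^sub>m N) $$ (i, j) * Y $$ (j, i)) = (\<Sum>j<N. X $$ (i, j) * Y $$ (j, i)) + c * Y $$ (i, i)"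
    "(\<Sum>j<N. Y $$ (i, j) * (X + c \<cdot>\<^sub>m 1\<^sub>m N) $$ (j, i)) = (\<Sum>j<N. Y $$ (i, j) * X $$ (j, i)) + c * Y $$ (i, i)"
    if i: "i < N" for i
  proof -
    have "(\<Sum>j<N. (X + c \<cdot>\<^sub>m 1\<^sub>m N) $$ (i, j) * Y $$ (j, i)) =
        (\<Sum>j<N. X $$ (i, j) * Y $$ (j, i) + (if j = i then c * Y $$ (i, i) else 0))"
      by (rule sum.cong) (use i in \<open>auto simp only: add_scalar_index[OF X] lessThan_iff, auto simp: algebra_simps\<close>)
    then show "(\<Sum>j<N. (X + c \<cdot>\<^sub>m 1\<^sub>m N) $$ (i, j) * Y $$ (j, i)) = (\<Sum>j<N. X $$ (i, j) * Y $$ (j, i)) + c * Y $$ (i, i)"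
      using i by (simp add: sum.distrib)
    have "(\<Sum>j<N. Y $$ (i, j) * (X + c \<cdot>\<^sub>m 1\<^sub>m N) $$ (j, i)) =
        (\<Sum>j<N. Y $$ (i, j) * X $$ (j, i) + (if j = i then c * Y $$ (i, i) else 0))"
      by (rule sum.cong) (use i in \<open>auto simp only: add_scalar_index[OF X] lessThan_iff, auto simp: algebra_simps\<close>)
    then show "(\<Sum>j<N. Y $$ (i, j) * (X + c \<cdot>\<^sub>m 1\<^sub>m N) $$ (j, i)) = (\<Sum>j<N. Y $$ (i, j) * X $$ (j, i)) + c * Y $$ (i, i)"
      using i by (simp add: sum.distrib)
  qed
  then show "supertrace m1 ((X + c \<cdot>\<^sub>m 1\<^sub>m N) * Y) = supertrace m1 (X * Y) + c * supertrace m1 Y"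
    "supertrace m1 (Y * (X + c \<cdot>\<^sub>m 1\<^sub>m N)) = supertrace m1 (Y * X) + c * supertrace m1 Y"
    unfolding supertrace_mult[OF Xc Y] supertrace_mult[OF X Y] supertrace_mult[OF Y Xc] supertrace_mult[OF Y X]
      supertrace_eq_sum[OF Y]
    by (simp_all add: algebra_simps sum.distrib sum_distrib_left)
qed

lemma kappa_cls [simp]:
  assumes X: "X \<in> matrices" and Y: "Y \<in> matrices"
  shows "kappa (cls X) (cls Y) = supertrace m1 (X * Y)"
proof -
  have *: "supertrace m1 (X1 * Y1) = supertrace m1 (X2 * Y2)" if h: "(X1, X2) \<in> congr" "(Y1, Y2) \<in> congr" for X1 X2 Y1 Y2
  proof -
    obtain c c' where c: "X1 \<in> matrices" "X2 \<in> matrices" "c \<noteq> 0 \<longrightarrow> scalar_quotient" "X1 = X2 + c \<cdot>\<^sub>m 1\<^sub>m N"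
      "Y1 \<in> matrices" "Y2 \<in> matrices" "c' \<noteq> 0 \<longrightarrow> scalar_quotient" "Y1 = Y2 + c' \<cdot>\<^sub>m 1\<^sub>m N"
      using h by (elim congrE) blast
    have "supertrace m1 (X1 * Y1) = supertrace m1 (X2 * Y1) + c * supertrace m1 Y1"
      unfolding c(4) using supertrace_mult_add_scalar(1) c by simp
    also have "supertrace m1 (X2 * Y1) = supertrace m1 (X2 * Y2) + c' * supertrace m1 X2"
      unfolding c(8) using supertrace_mult_add_scalar(2) c by simp
    also have "c' * supertrace m1 X2 = 0" using c(2,7) matrices_supertrace by (auto simp: scalar_quotient_def)
    also have "c * supertrace m1 Y1 = 0" using c(5,3) matrices_supertrace by (auto simp: scalar_quotient_def)
    finally show ?thesis by simp
  qed
  have "congruent2 congr congr (\<lambda>X Y. {supertrace m1 (X * Y)})"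
    unfolding congruent2_def using * by blast
  from UN_equiv_class2[OF equiv_congr equiv_congr this X Y] show ?thesis by (simp add: kappa_def)
qed

lemma zero_fin_alg: "\<zero>\<^bsub>fin_alg\<^esub> = cls (0\<^sub>m N N)"
  by (simp add: fin_alg_def)

lemma homog_fin_alg: "homog fin_alg i = {cls X | X. X \<in> matrices \<and>
    (if i = 0 then odd_part m1 X else even_part m1 X) = 0\<^sub>m N N}"
  by (simp add: fin_alg_def)

lemma abelian_monoid_fin_alg: "abelian_monoid fin_alg"
proof (rule abelian_monoidI)
  show "\<zero>\<^bsub>fin_alg\<^esub> \<in> carrier fin_alg" by (simp add: zero_fin_alg)
next
  fix x y assume "x \<in> carrier fin_alg" "y \<in> carrier fin_alg"
  then show "x \<oplus>\<^bsub>fin_alg\<^esub> y \<in> carrier fin_alg" using carrier_cls by (metis cls_add cls_carrier matrices_add)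
next
  fix x y z assume "x \<in> carrier fin_alg" "y \<in> carrier fin_alg" "z \<in> carrier fin_alg"
  then obtain X Y Z where *: "X \<in> matrices" "Y \<in> matrices" "Z \<in> matrices" "x = cls X" "y = cls Y" "z = cls Z"
    using carrier_cls by metis
  then show "x \<oplus>\<^bsub>fin_alg\<^esub> y \<oplus>\<^bsub>fin_alg\<^esub> z = x \<oplus>\<^bsub>fin_alg\<^esub> (y \<oplus>\<^bsub>fin_alg\<^esub> z)"
    using assoc_add_mat[OF matrices_carrier matrices_carrier matrices_carrier, of X Y Z] by simp
next
  fix x assume "x \<in> carrier fin_alg"
  then show "\<zero>\<^bsub>fin_alg\<^esub> \<oplus>\<^bsub>fin_alg\<^esub> x = x" using carrier_cls
    by (metis cls_add left_add_zero_mat matrices_carrier matrices_zero zero_fin_alg)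
next
  fix x y assume "x \<in> carrier fin_alg" "y \<in> carrier fin_alg"
  then obtain X Y where *: "X \<in> matrices" "Y \<in> matrices" "x = cls X" "y = cls Y"
    using carrier_cls by metis
  then show "x \<oplus>\<^bsub>fin_alg\<^esub> y = y \<oplus>\<^bsub>fin_alg\<^esub> x"
    using comm_add_mat[OF matrices_carrier matrices_carrier, of X Y] by simp
qed

lemma cls_eq_upper_trace:
  assumes k: "1 \<le> k" and X: "X \<in> matrices" and Y: "Y \<in> matrices" and eq: "cls X = cls Y"
    and tr: "upper_trace X = upper_trace Y"
  shows "X = Y"
proof -
  obtain c where c: "X = Y + c \<cdot>\<^sub>m 1\<^sub>m N" using eq cls_eq_iff[OF X Y] by (auto simp: congr_iff)
  have "upper_trace X = upper_trace Y + of_nat m1 * c"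
    unfolding c using Y by (simp add: upper_trace_def sum.distrib)
  moreover have "m1 \<noteq> 0" using k by (cases T) auto
  ultimately have "c = 0" using tr by simp
  then show ?thesis using c Y by (simp add: add_zero_scalar)
qed

end

section \<open>Elements of the affine superalgebra\<close>

locale twisted_affine_setting = twisted_affine +
  assumes k_pos: "1 \<le> k" and l_pos: "1 \<le> l"
    and zeta_power: "\<zeta> ^ twist_order T = 1"
    and zeta_primitive: "\<And>m. 0 < m \<Longrightarrow> m < twist_order T \<Longrightarrow> \<zeta> ^ m \<noteq> 1"
begin

abbreviation period :: nat where "period \<equiv> twist_order T"

definition zpow :: "int \<Rightarrow> complex" where
  "zpow m = \<zeta> ^ nat (m mod int period)"

lemma period_pos: "0 < period"
  by (cases T) auto

lemma zeta_nonzero: "\<zeta> \<noteq> 0"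
  using zeta_power period_pos by (metis power_eq_0_iff zero_neq_one zero_power)

lemma zpow_powi: "zpow m = \<zeta> powi m"
proof -
  have "\<zeta> powi m = \<zeta> powi (int period * (m div int period) + m mod int period)" by simp
  also have "\<dots> = (\<zeta> powi int period) powi (m div int period) * \<zeta> powi (m mod int period)"
    using zeta_nonzero by (simp only: power_int_add power_int_mult simp_thms)
  also have "\<zeta> powi int period = 1" using zeta_power by simp
  also have "\<zeta> powi (m mod int period) = \<zeta> ^ nat (m mod int period)"
    using period_pos by (simp add: power_int_def)
  finally show ?thesis by (simp add: zpow_def)
qed

lemma zpow_0 [simp]: "zpow 0 = 1"
  by (simp add: zpow_powi)

lemma zpow_add: "zpow (a + b) = zpow a * zpow b"
  using zeta_nonzero by (simp add: zpow_powi power_int_add)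

lemma zpow_period: "zpow (m + int period * q) = zpow m"
  by (simp add: zpow_def)

lemma zpow_norm: "zpow m * cnj (zpow m) = 1"
proof -
  have "cmod \<zeta> ^ period = 1 ^ period" using arg_cong[OF zeta_power, of cmod] by (simp add: norm_power)
  then have "cmod \<zeta> = 1" by (rule power_eq_imp_eq_base) (simp_all add: period_pos)
  then have "cmod (zpow m) = 1" by (simp add: zpow_def norm_power)
  then show ?thesis using complex_norm_square[of "zpow m"] by simp
qed

lemma zpow_minus: "zpow (- m) = cnj (zpow m)"
proof -
  have "zpow m * zpow (- m) = 1" using zpow_add[of m "- m"] by simp
  then have "zpow m * zpow (- m) = zpow m * cnj (zpow m)" by (simp only: zpow_norm)
  moreover have "zpow m \<noteq> 0" using zpow_norm[of m] by auto
  ultimately show ?thesis by simp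
qed

text \<open>The order is even, so half of it is an exponent that yields \<open>-1\<close>; this is the degree in which the
root vectors with eigenvalue \<open>-1\<close> live.\<close>

lemma zpow_minus_one: "\<exists>m. zpow m = - 1"
proof -
  have e: "even period" by (cases T) auto
  have "\<zeta> ^ (period div 2) * \<zeta> ^ (period div 2) = 1"
    using zeta_power e by (metis dvd_mult_div_cancel mult_2 power_add)
  then have "\<zeta> ^ (period div 2) = 1 \<or> \<zeta> ^ (period div 2) = - 1" by (simp add: square_eq_1_iff)
  moreover have "\<zeta> ^ (period div 2) \<noteq> 1" by (rule zeta_primitive; cases T) auto
  moreover have "zpow (int (period div 2)) = \<zeta> ^ (period div 2)" by (simp add: zpow_powi)
  ultimately show ?thesis by metis
qed

lemma L_simps:
  "carrier L = affine_carrier fin_alg sigma period \<zeta>" "x \<otimes>\<^bsub>L\<^esub> y = affine_bracket fin_alg kappa x y"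
  "\<zero>\<^bsub>L\<^esub> = (\<lambda>_. \<zero>\<^bsub>fin_alg\<^esub>, 0, 0)"
  "(f, r, s) \<oplus>\<^bsub>L\<^esub> (g, r', s') = (\<lambda>a. f a \<oplus>\<^bsub>fin_alg\<^esub> g a, r + r', s + s')"
  "z \<odot>\<^bsub>L\<^esub> (f, r, s) = (\<lambda>a. z \<odot>\<^bsub>fin_alg\<^esub> f a, z * r, z * s)"
  "homog L i = {(f, r, s) \<in> affine_carrier fin_alg sigma period \<zeta>.
                      (\<forall>a. f a \<in> homog fin_alg i) \<and> (i \<noteq> 0 \<longrightarrow> r = 0 \<and> s = 0)}"
  by (simp_all add: L_def twisted_affinization_def)

abbreviation mzero :: "complex mat" where "mzero \<equiv> 0\<^sub>m N N"

text \<open>Representatives in the affine algebra: a family of matrices indexed by the degree, and the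
coefficients of \<open>c\<close> and \<open>d\<close>.\<close>

definition loop :: "(int \<Rightarrow> complex mat) \<Rightarrow> complex \<Rightarrow> complex \<Rightarrow> complex mat set affine" where
  "loop Y r s = (\<lambda>b. cls (Y b), r, s)"

definition single :: "int \<Rightarrow> complex mat \<Rightarrow> int \<Rightarrow> complex mat" where
  "single m X = (\<lambda>b. if b = m then X else mzero)"

definition monomial :: "int \<Rightarrow> complex mat \<Rightarrow> complex mat set affine" where
  "monomial m X = loop (single m X) 0 0"

definition cartan :: "complex mat \<Rightarrow> complex \<Rightarrow> complex \<Rightarrow> complex mat set affine" where
  "cartan D r s = loop (single 0 D) r s"

lemma single_matrices [simp]: "X \<in> matrices \<Longrightarrow> single m X b \<in> matrices"
  by (simp add: single_def)

lemma loop_eq_iff: "loop Y r s = loop Y' r' s' \<longleftrightarrow> (\<forall>b. cls (Y b) = cls (Y' b)) \<and> r = r' \<and> s = s'"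
  by (auto simp: loop_def fun_eq_iff)

lemma zero_L: "\<zero>\<^bsub>L\<^esub> = loop (\<lambda>_. mzero) 0 0"
  by (simp add: L_simps loop_def zero_fin_alg)

lemma loop_add:
  "(\<And>b. Y b \<in> matrices) \<Longrightarrow> (\<And>b. Y' b \<in> matrices) \<Longrightarrow>
    loop Y r s \<oplus>\<^bsub>L\<^esub> loop Y' r' s' = loop (\<lambda>b. Y b + Y' b) (r + r') (s + s')"
  by (simp add: loop_def L_simps)

lemma loop_smult:
  "(\<And>b. Y b \<in> matrices) \<Longrightarrow> z \<odot>\<^bsub>L\<^esub> loop Y r s = loop (\<lambda>b. z \<cdot>\<^sub>m Y b) (z * r) (z * s)"
  by (simp add: loop_def L_simps)

lemma mem_eigenspace_cls:
  "X \<in> matrices \<Longrightarrow> cls X \<in> eigenspace fin_alg sigma e \<longleftrightarrow> cls (sigma_matrix X) = cls (e \<cdot>\<^sub>m X)"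
  by (simp add: eigenspace_def)

lemma loop_carrier_iff:
  assumes "\<And>b. Y b \<in> matrices"
  shows "loop Y r s \<in> carrier L \<longleftrightarrow>
    finite {b. cls (Y b) \<noteq> cls mzero} \<and> (\<forall>b. cls (sigma_matrix (Y b)) = cls (zpow b \<cdot>\<^sub>m Y b))"
  using assms by (simp add: L_simps affine_carrier_def loop_def zero_fin_alg mem_eigenspace_cls zpow_def)

lemma carrier_loop:
  assumes "x \<in> carrier L"
  shows "\<exists>Y r s. (\<forall>b. Y b \<in> matrices) \<and> x = loop Y r s \<and>
    finite {b. cls (Y b) \<noteq> cls mzero} \<and> (\<forall>b. cls (sigma_matrix (Y b)) = cls (zpow b \<cdot>\<^sub>m Y b))"
proof -
  obtain f r s where x: "x = (f, r, s)" by (cases x)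
  have "\<forall>b. f b \<in> carrier fin_alg" using assms x by (auto simp: L_simps affine_carrier_def eigenspace_def)
  then have "\<forall>b. \<exists>Y\<in>matrices. f b = cls Y" using carrier_cls by blast
  then obtain Y where Y: "\<And>b. Y b \<in> matrices" "\<And>b. f b = cls (Y b)" by metis
  then have "x = loop Y r s" using x by (simp add: loop_def fun_eq_iff)
  then show ?thesis using Y(1) assms loop_carrier_iff[of Y r s] by blast
qed

lemma smult_zero_mat: "c \<cdot>\<^sub>m mzero = mzero"
  by (rule square_mat_eqI[where n = N]) simp_all

lemma zero_smult_mat: "X \<in> carrier_mat N N \<Longrightarrow> 0 \<cdot>\<^sub>m X = mzero"
  by (rule square_mat_eqI[where n = N]) simp_all

lemma sigma_matrix_zero: "sigma_matrix mzero = mzero"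
  using torus_sigma_matrix[OF torus_zero] .

lemma superbracket_zero_left: "X \<in> carrier_mat N N \<Longrightarrow> superbracket m1 mzero X = mzero"
  by (rule square_mat_eqI[where n = N]) (simp_all add: superbracket_index[of _ N])

lemma monomial_carrier:
  assumes X: "X \<in> matrices" and "sigma_matrix X = zpow m \<cdot>\<^sub>m X"
  shows "monomial m X \<in> carrier L"
proof -
  have "{b. cls (single m X b) \<noteq> cls mzero} \<subseteq> {m}" by (auto simp: single_def)
  then have "finite {b. cls (single m X b) \<noteq> cls mzero}" by (rule finite_subset) simp
  then show ?thesis unfolding monomial_def using assms
    by (subst loop_carrier_iff) (auto simp: single_def sigma_matrix_zero smult_zero_mat)
qed

lemma cartan_carrier:
  assumes D: "D \<in> torus"
  shows "cartan D r s \<in> carrier L"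
proof -
  have "{b. cls (single 0 D b) \<noteq> cls mzero} \<subseteq> {0}" by (auto simp: single_def)
  then have "finite {b. cls (single 0 D b) \<noteq> cls mzero}" by (rule finite_subset) simp
  then show ?thesis unfolding cartan_def using torus_matrices[OF D] torus_sigma_matrix[OF D]
    by (subst loop_carrier_iff) (auto simp: single_def sigma_matrix_zero smult_zero_mat smult_one_mat)
qed

lemma finsum_single:
  assumes X: "X \<in> matrices" and Y: "\<And>b. Y b \<in> matrices"
  shows "finsum fin_alg (\<lambda>a. cls (single m X a) \<otimes>\<^bsub>fin_alg\<^esub> cls (Y a)) {a. cls (single m X a) \<noteq> cls mzero}
     = cls (superbracket m1 X (Y m))"
proof -
  interpret abelian_monoid fin_alg by (rule abelian_monoid_fin_alg)
  show ?thesis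
  proof (cases "cls X = cls mzero")
    case True
    then have "{a. cls (single m X a) \<noteq> cls mzero} = {}" by (auto simp: single_def)
    moreover have "cls (superbracket m1 X (Y m)) = cls (superbracket m1 mzero (Y m))"
      using True X Y cls_mult[OF X Y] cls_mult[OF matrices_zero Y] by metis
    ultimately show ?thesis using Y by (simp add: superbracket_zero_left zero_fin_alg)
  next
    case False
    then have "{a. cls (single m X a) \<noteq> cls mzero} = insert m {}" by (auto simp: single_def)
    then show ?thesis
      using X Y by (simp only:) (subst finsum_insert, auto simp: single_def zero_fin_alg)
  qed
qed

lemma sum_single:
  assumes X: "X \<in> matrices" and Y: "\<And>b. Y b \<in> matrices"
  shows "(\<Sum>a | cls (single m X a) \<noteq> cls mzero. f a * kappa (cls (single m X a)) (cls (Y a)))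
     = f m * supertrace m1 (X * Y m)"
proof (cases "cls X = cls mzero")
  case True
  then have "{a. cls (single m X a) \<noteq> cls mzero} = {}" by (auto simp: single_def)
  moreover have "kappa (cls X) (cls (Y m)) = kappa (cls mzero) (cls (Y m))" using True by simp
  then have "supertrace m1 (X * Y m) = supertrace m1 (mzero * Y m)" using X Y by simp
  then have "supertrace m1 (X * Y m) = 0"
    using Y[of m] by (simp add: supertrace_mult[OF zero_carrier_mat matrices_carrier])
  ultimately show ?thesis by (simp only: sum.empty) simp
next
  case False
  then have "{a. cls (single m X a) \<noteq> cls mzero} = {m}" by (auto simp: single_def)
  then show ?thesis using X Y by (simp add: single_def)
qed

text \<open>Brackets whose left factor is concentrated in a single degree are all that is needed, and for these
the sums in the definition of the affine bracket have at most one term.\<close>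

lemma single_bracket:
  assumes X: "X \<in> matrices" and Y: "\<And>b. Y b \<in> matrices"
  shows "loop (single m X) r s \<otimes>\<^bsub>L\<^esub> loop Y r' s' =
    loop (\<lambda>b. superbracket m1 X (Y (b - m)) + (s * of_int b) \<cdot>\<^sub>m Y b + (- s' * of_int b) \<cdot>\<^sub>m single m X b)
       (of_int m * supertrace m1 (X * Y (- m))) 0"
proof -
  have "finsum fin_alg (\<lambda>a. cls (single m X a) \<otimes>\<^bsub>fin_alg\<^esub> cls (Y (b - a))) {a. cls (single m X a) \<noteq> cls mzero}
     = cls (superbracket m1 X (Y (b - m)))" for b
    using finsum_single[OF X, where Y = "\<lambda>a. Y (b - a)" and m = m] Y by simp
  moreover have "(\<Sum>a | cls (single m X a) \<noteq> cls mzero. of_int a * kappa (cls (single m X a)) (cls (Y (- a))))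
     = of_int m * supertrace m1 (X * Y (- m))"
    using sum_single[OF X, where Y = "\<lambda>a. Y (- a)" and m = m and f = of_int] Y by simp
  ultimately show ?thesis using X Y by (simp add: loop_def L_simps zero_fin_alg)
qed

lemma cartan_bracket:
  assumes D: "D \<in> torus" and Y: "\<And>b. Y b \<in> matrices"
  shows "cartan D r s \<otimes>\<^bsub>L\<^esub> loop Y r' s' = loop (\<lambda>b. superbracket m1 D (Y b) + (s * of_int b) \<cdot>\<^sub>m Y b) 0 0"
proof -
  have "superbracket m1 D (Y b) + (s * of_int b) \<cdot>\<^sub>m Y b + (- s' * of_int b) \<cdot>\<^sub>m single 0 D b =
     superbracket m1 D (Y b) + (s * of_int b) \<cdot>\<^sub>m Y b" for b
  proof -
    have c: "superbracket m1 D (Y b) + (s * of_int b) \<cdot>\<^sub>m Y b \<in> carrier_mat N N" using Y[of b] by simp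
    have "(- s' * of_int b) \<cdot>\<^sub>m single 0 D b = mzero"
      using zero_smult_mat[OF torus_carrier[OF D]] smult_zero_mat by (simp add: single_def)
    then show ?thesis using c by simp
  qed
  then show ?thesis unfolding cartan_def using single_bracket[OF torus_matrices[OF D], where Y = Y and m = 0 and r = r and s = s and r' = r' and s' = s'] Y by simp
qed

lemma h_part_eq:
  assumes "a \<in> {1, 2}"
  shows "h_part a = {cartan D r s | D r s. D \<in> torus_block a}"
proof (intro equalityI subsetI)
  fix x assume "x \<in> h_part a"
  then obtain f r s where x: "x = (f, r, s)" and f0: "f 0 \<in> eigenspace fin_alg sigma 1" "f 0 \<in> diag a"
    and fb: "\<And>b. b \<noteq> 0 \<Longrightarrow> f b = \<zero>\<^bsub>fin_alg\<^esub>" by (auto simp: h_part_def)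
  obtain X where X: "f 0 = cls X" "X \<in> block_matrices a" "diagonal_mat X" using f0(2) by (auto simp: diag_def)
  have "cls (sigma_matrix X) = cls X"
    using f0(1) X mem_eigenspace_cls[of X 1] by (simp add: smult_one_mat)
  then have "sigma_matrix X = X"
    using X(2) by (intro cls_eq_upper_trace[OF k_pos]) (simp_all add: upper_trace_block[OF X(2)] upper_trace_block[OF block_matrices_sigma_matrix[OF X(2)]])
  then have "X \<in> torus_block a" using X by (simp add: torus_block_def)
  moreover have "x = cartan X r s"
    using x X(1) fb by (auto simp: cartan_def loop_def single_def fun_eq_iff zero_fin_alg)
  ultimately show "x \<in> {cartan D r s | D r s. D \<in> torus_block a}" by blast
next
  fix x assume "x \<in> {cartan D r s | D r s. D \<in> torus_block a}"
  then obtain D r s where x: "x = cartan D r s" and D: "D \<in> torus_block a" by blast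
  then have "D \<in> block_matrices a" "diagonal_mat D" "sigma_matrix D = D" by (auto simp: torus_block_def)
  then show "x \<in> h_part a"
    unfolding x by (auto simp: h_part_def cartan_def loop_def single_def zero_fin_alg diag_def mem_eigenspace_cls smult_one_mat)
qed

lemma cartan_add:
  assumes "D \<in> torus" "E \<in> torus"
  shows "cartan D r s \<oplus>\<^bsub>L\<^esub> cartan E r' s' = cartan (D + E) (r + r') (s + s')"
  unfolding cartan_def using assms
  by (subst loop_add) (auto simp: torus_matrices loop_eq_iff single_def)

lemma cartan_smult:
  assumes "D \<in> torus"
  shows "z \<odot>\<^bsub>L\<^esub> cartan D r s = cartan (z \<cdot>\<^sub>m D) (z * r) (z * s)"
  unfolding cartan_def using assms
  by (subst loop_smult) (auto simp: torus_matrices loop_eq_iff single_def smult_zero_mat)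

lemma h_eq: "h = {cartan D r s | D r s. D \<in> torus}"
proof (intro equalityI subsetI)
  fix z assume "z \<in> h"
  then obtain D1 r s D2 r' s' where "z = cartan D1 r s \<oplus>\<^bsub>L\<^esub> cartan D2 r' s'" "D1 \<in> torus_block 1" "D2 \<in> torus_block 2"
    unfolding h_def using h_part_eq[of 1] h_part_eq[of 2] by auto
  then have "z = cartan (D1 + D2) (r + r') (s + s')" "D1 + D2 \<in> torus"
    using cartan_add torus_block_torus by (auto simp: torus_def)
  then show "z \<in> {cartan D r s | D r s. D \<in> torus}" by blast
next
  fix z assume "z \<in> {cartan D r s | D r s. D \<in> torus}"
  then obtain D1 D2 r s where "z = cartan (D1 + D2) r s" "D1 \<in> torus_block 1" "D2 \<in> torus_block 2"
    by (auto simp: torus_def)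
  moreover from this have "z = cartan D1 r s \<oplus>\<^bsub>L\<^esub> cartan D2 0 0"
    using cartan_add[of D1 D2 r s 0 0] torus_block_torus by auto
  ultimately show "z \<in> h"
    unfolding h_def using h_part_eq[of 1] h_part_eq[of 2] by blast
qed

lemma cartan_mem [simp]: "D \<in> torus \<Longrightarrow> cartan D r s \<in> h"
  by (auto simp: h_eq)

lemma hE:
  assumes "y \<in> h" obtains D r s where "y = cartan D r s" "D \<in> torus"
  using assms by (auto simp: h_eq)

lemma cartan_inj:
  assumes "D \<in> torus" "E \<in> torus"
  shows "cartan D r s = cartan E r' s' \<longleftrightarrow> D = E \<and> r = r' \<and> s = s'"
proof
  assume "cartan D r s = cartan E r' s'"
  then have "cls (single 0 D 0) = cls (single 0 E 0)" "r = r'" "s = s'" by (auto simp: cartan_def loop_eq_iff)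
  then show "D = E \<and> r = r' \<and> s = s'"
    using assms by (simp add: single_def cls_eq_upper_trace[OF k_pos torus_matrices torus_matrices] torus_upper_trace)
qed auto

abbreviation cc :: "complex mat set affine" where "cc \<equiv> cartan mzero 1 0"
abbreviation dd :: "complex mat set affine" where "dd \<equiv> cartan mzero 0 1"

lemma h_dual_cartan:
  assumes \<beta>: "\<beta> \<in> h_dual" and D: "D \<in> torus"
  shows "\<beta> (cartan D r s) = \<beta> (cartan D 0 0) + r * \<beta> cc + s * \<beta> dd"
proof -
  have lin: "\<beta> (x \<oplus>\<^bsub>L\<^esub> y) = \<beta> x + \<beta> y" "\<beta> (c \<odot>\<^bsub>L\<^esub> x) = c * \<beta> x" if "x \<in> h" "y \<in> h" for x y c
    using \<beta> that by (auto simp: h_dual_def)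
  have "cartan D r s = (cartan D 0 0 \<oplus>\<^bsub>L\<^esub> (r \<odot>\<^bsub>L\<^esub> cc)) \<oplus>\<^bsub>L\<^esub> (s \<odot>\<^bsub>L\<^esub> dd)"
    using D torus_zero torus_carrier[OF D] by (simp add: cartan_add cartan_smult smult_zero_mat)
  moreover have "cartan D 0 0 \<oplus>\<^bsub>L\<^esub> (r \<odot>\<^bsub>L\<^esub> cc) \<in> h" "r \<odot>\<^bsub>L\<^esub> cc \<in> h" "s \<odot>\<^bsub>L\<^esub> dd \<in> h"
    using D torus_zero torus_carrier[OF D] by (simp_all add: cartan_add cartan_smult smult_zero_mat)
  ultimately show ?thesis using lin D torus_zero by simp
qed

lemma delta_cartan: "D \<in> torus \<Longrightarrow> delta (cartan D r s) = s"
  by (simp add: delta_def) (simp add: cartan_def loop_def)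

lemma h_dualI:
  assumes add: "\<And>D E r s r' s'. D \<in> torus \<Longrightarrow> E \<in> torus \<Longrightarrow>
      \<beta> (cartan (D + E) (r + r') (s + s')) = \<beta> (cartan D r s) + \<beta> (cartan E r' s')"
    and smult: "\<And>D r s z. D \<in> torus \<Longrightarrow> \<beta> (cartan (z \<cdot>\<^sub>m D) (z * r) (z * s)) = z * \<beta> (cartan D r s)"
    and out: "\<And>x. x \<notin> h \<Longrightarrow> \<beta> x = 0"
  shows "\<beta> \<in> h_dual"
  unfolding h_dual_def using add smult out by (auto simp: h_eq cartan_add cartan_smult)

lemma h_dual_add:
  assumes "\<alpha> \<in> h_dual" "\<beta> \<in> h_dual"
  shows "(\<lambda>x. \<alpha> x + \<beta> x) \<in> h_dual"
  using assms unfolding h_dual_def by (simp add: algebra_simps)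

lemma h_dual_scale:
  assumes "\<alpha> \<in> h_dual"
  shows "(\<lambda>x. c * \<alpha> x) \<in> h_dual"
  using assms unfolding h_dual_def by (simp add: algebra_simps)

lemma delta_h_dual: "delta \<in> h_dual"
  by (rule h_dualI) (simp_all add: delta_cartan torus_add torus_smult, simp add: delta_def)

lemma shift_h_dual: "\<alpha> \<in> h_dual \<Longrightarrow> shift \<alpha> m \<in> h_dual"
  unfolding shift_def by (intro h_dual_add h_dual_scale delta_h_dual)

lemma shift_cartan:
  "D \<in> torus \<Longrightarrow> shift \<alpha> m (cartan D r s) = \<alpha> (cartan D r s) + of_int m * s"
  by (simp add: shift_def delta_cartan)

section \<open>Root vectors and real roots\<close>

definition finite_part_nonzero :: "(complex mat set affine \<Rightarrow> complex) \<Rightarrow> bool" where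
  "finite_part_nonzero \<beta> \<longleftrightarrow> (\<exists>D\<in>torus. \<beta> (cartan D 0 0) \<noteq> 0)"

text \<open>A matrix representative of a root vector in degree \<open>m\<close>. The condition on the trace makes it unique,
so that the equations hold for matrices and not only modulo scalars.\<close>

definition root_vector :: "(complex mat set affine \<Rightarrow> complex) \<Rightarrow> int \<Rightarrow> complex mat \<Rightarrow> bool" where
  "root_vector \<beta> m X \<longleftrightarrow> X \<in> matrices \<and> upper_trace X = 0 \<and> X \<noteq> mzero \<and>
     sigma_matrix X = zpow m \<cdot>\<^sub>m X \<and> has_weight X (\<lambda>D. \<beta> (cartan D 0 0)) \<and>
     \<beta> dd = of_int m \<and> \<beta> cc = 0"

lemma upper_trace_torus_bracket:
  "D \<in> torus \<Longrightarrow> X \<in> carrier_mat N N \<Longrightarrow> upper_trace (superbracket m1 D X) = 0"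
  by (simp add: upper_trace_def torus_superbracket_index)

lemma upper_trace_zero: "upper_trace mzero = 0"
  by (simp add: upper_trace_def)

lemma cls_eq_zero_iff: "X \<in> matrices \<Longrightarrow> upper_trace X = 0 \<Longrightarrow> cls X = cls mzero \<longleftrightarrow> X = mzero"
  using cls_eq_upper_trace[OF k_pos, of X mzero] by (auto simp: upper_trace_zero)

lemma monomial_eq_zero_iff:
  "X \<in> matrices \<Longrightarrow> upper_trace X = 0 \<Longrightarrow> monomial m X = \<zero>\<^bsub>L\<^esub> \<longleftrightarrow> X = mzero"
  using cls_eq_zero_iff[of X] unfolding monomial_def zero_L loop_eq_iff single_def by auto

lemma zero_root_space: "\<zero>\<^bsub>L\<^esub> \<in> root_space \<beta>"
proof -
  have "monomial 0 mzero = \<zero>\<^bsub>L\<^esub>" by (simp add: monomial_eq_zero_iff upper_trace_zero)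
  then have "\<zero>\<^bsub>L\<^esub> \<in> carrier L"
    using monomial_carrier[of mzero 0] by (simp add: sigma_matrix_zero smult_zero_mat)
  moreover have "cartan D r s \<otimes>\<^bsub>L\<^esub> \<zero>\<^bsub>L\<^esub> = \<beta> (cartan D r s) \<odot>\<^bsub>L\<^esub> \<zero>\<^bsub>L\<^esub>" if "D \<in> torus" for D r s
    unfolding zero_L cartan_bracket[OF that matrices_zero]
    using superbracket_zero_right[OF torus_carrier[OF that]] by (simp add: loop_smult smult_zero_mat)
  ultimately show ?thesis unfolding root_space_def by (auto simp: h_eq)
qed

lemma cartan_monomial_bracket:
  assumes D: "D \<in> torus" and X: "X \<in> matrices"
  shows "cartan D r s \<otimes>\<^bsub>L\<^esub> monomial m X = monomial m (superbracket m1 D X + (s * of_int m) \<cdot>\<^sub>m X)"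
  unfolding monomial_def using X torus_carrier[OF D]
  by (subst cartan_bracket[OF D]) (auto simp: loop_eq_iff single_def superbracket_zero_right smult_zero_mat)

lemma monomial_smult: "X \<in> matrices \<Longrightarrow> z \<odot>\<^bsub>L\<^esub> monomial m X = monomial m (z \<cdot>\<^sub>m X)"
  unfolding monomial_def by (subst loop_smult) (auto simp: loop_eq_iff single_def smult_zero_mat)

lemma monomial_add: "X \<in> matrices \<Longrightarrow> Y \<in> matrices \<Longrightarrow> monomial m X \<oplus>\<^bsub>L\<^esub> monomial m Y = monomial m (X + Y)"
  unfolding monomial_def by (subst loop_add) (auto simp: loop_eq_iff single_def)

lemma root_vector_root_space:
  assumes \<beta>: "\<beta> \<in> h_dual" and v: "root_vector \<beta> m X"
  shows "monomial m X \<in> root_space \<beta>" and "monomial m X \<noteq> \<zero>\<^bsub>L\<^esub>"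
proof -
  have X: "X \<in> matrices" "upper_trace X = 0" "X \<noteq> mzero" "sigma_matrix X = zpow m \<cdot>\<^sub>m X"
    and w: "has_weight X (\<lambda>D. \<beta> (cartan D 0 0))" and d: "\<beta> dd = of_int m" and c: "\<beta> cc = 0"
    using v by (auto simp: root_vector_def)
  show "monomial m X \<noteq> \<zero>\<^bsub>L\<^esub>" using monomial_eq_zero_iff X by simp
  have "cartan D r s \<otimes>\<^bsub>L\<^esub> monomial m X = \<beta> (cartan D r s) \<odot>\<^bsub>L\<^esub> monomial m X" if D: "D \<in> torus" for D r s
  proof -
    have "superbracket m1 D X + (s * of_int m) \<cdot>\<^sub>m X = \<beta> (cartan D r s) \<cdot>\<^sub>m X"
      unfolding h_dual_cartan[OF \<beta> D, of r s] d c
      using w D X(1) by (simp add: has_weight_def add_smult_distrib_right_mat[of _ N N])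
    then show ?thesis using cartan_monomial_bracket[OF D X(1)] monomial_smult[OF X(1)] by simp
  qed
  then show "monomial m X \<in> root_space \<beta>"
    unfolding root_space_def using monomial_carrier[OF X(1,4)] by (auto simp: h_eq)
qed

lemma root_space_cc:
  assumes x: "x \<in> root_space \<beta>" "x \<noteq> \<zero>\<^bsub>L\<^esub>"
  shows "\<beta> cc = 0"
proof (rule ccontr)
  assume nz: "\<beta> cc \<noteq> 0"
  have xc: "x \<in> carrier L" using x(1) by (simp add: root_space_def)
  obtain Y r s where Y: "\<And>b. Y b \<in> matrices" and xe: "x = loop Y r s"
    using carrier_loop[OF xc] by blast
  have "cc \<otimes>\<^bsub>L\<^esub> x = \<beta> cc \<odot>\<^bsub>L\<^esub> x" using x(1) torus_zero by (simp add: root_space_def)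
  then have "loop (\<lambda>b. superbracket m1 mzero (Y b) + (0 * of_int b) \<cdot>\<^sub>m Y b) 0 0 = loop (\<lambda>b. \<beta> cc \<cdot>\<^sub>m Y b) (\<beta> cc * r) (\<beta> cc * s)"
    unfolding xe cartan_bracket[OF torus_zero Y] loop_smult[OF Y] .
  then have *: "\<And>b. cls (\<beta> cc \<cdot>\<^sub>m Y b) = cls mzero" "r = 0" "s = 0"
    using nz Y by (auto simp: loop_eq_iff superbracket_zero_left zero_smult_mat)
  have "cls (Y b) = cls mzero" for b
  proof -
    have "(1 / \<beta> cc) \<odot>\<^bsub>fin_alg\<^esub> cls (\<beta> cc \<cdot>\<^sub>m Y b) = (1 / \<beta> cc) \<odot>\<^bsub>fin_alg\<^esub> cls mzero"
      by (simp only: *(1))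
    then show ?thesis using Y nz by (simp add: smult_zero_mat smult_smult_mat smult_one_mat)
  qed
  then have "x = \<zero>\<^bsub>L\<^esub>" unfolding xe zero_L loop_eq_iff using *(2,3) by simp
  then show False using x(2) by simp
qed

text \<open>The element \<open>d\<close> isolates one degree. In that degree, dividing \<open> [D0, Y m] \<close> by the nonzero value of
the root at \<open>D0\<close> gives a representative with zero diagonal, and all congruences modulo scalars between
matrices of trace zero in the upper block are equalities.\<close>

lemma root_space_root_vector:
  assumes \<beta>: "\<beta> \<in> h_dual" and x: "x \<in> root_space \<beta>" "x \<noteq> \<zero>\<^bsub>L\<^esub>" and fin: "finite_part_nonzero \<beta>"
  obtains m X where "root_vector \<beta> m X" "x = monomial m X"
proof -
  have xc: "x \<in> carrier L" using x(1) by (simp add: root_space_def)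
  obtain Y r s where Y: "\<And>b. Y b \<in> matrices" and xe: "x = loop Y r s"
    and sY: "\<And>b. cls (sigma_matrix (Y b)) = cls (zpow b \<cdot>\<^sub>m Y b)"
    using carrier_loop[OF xc] by blast
  have act: "cls (superbracket m1 D (Y b) + (s' * of_int b) \<cdot>\<^sub>m Y b) = cls (\<beta> (cartan D r' s') \<cdot>\<^sub>m Y b)"
    "\<beta> (cartan D r' s') * r = 0" "\<beta> (cartan D r' s') * s = 0" if D: "D \<in> torus" for D b r' s'
  proof -
    have "cartan D r' s' \<otimes>\<^bsub>L\<^esub> x = \<beta> (cartan D r' s') \<odot>\<^bsub>L\<^esub> x" using x(1) D by (simp add: root_space_def)
    then have "loop (\<lambda>b. superbracket m1 D (Y b) + (s' * of_int b) \<cdot>\<^sub>m Y b) 0 0 =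
        loop (\<lambda>b. \<beta> (cartan D r' s') \<cdot>\<^sub>m Y b) (\<beta> (cartan D r' s') * r) (\<beta> (cartan D r' s') * s)"
      unfolding xe cartan_bracket[OF D Y] loop_smult[OF Y] .
    then show "cls (superbracket m1 D (Y b) + (s' * of_int b) \<cdot>\<^sub>m Y b) = cls (\<beta> (cartan D r' s') \<cdot>\<^sub>m Y b)"
    "\<beta> (cartan D r' s') * r = 0" "\<beta> (cartan D r' s') * s = 0" by (simp_all add: loop_eq_iff)
  qed
  obtain D0 where D0: "D0 \<in> torus" "\<beta> (cartan D0 0 0) \<noteq> 0" using fin by (auto simp: finite_part_nonzero_def)
  have rs: "r = 0" "s = 0" using act(2,3)[OF D0(1), of 0 0] D0(2) by auto
  have deg: "cls (Y b) = cls mzero" if "\<beta> dd \<noteq> of_int b" for b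
  proof -
    have "cls (of_int b \<cdot>\<^sub>m Y b) = cls (\<beta> dd \<cdot>\<^sub>m Y b)"
      using act(1)[OF torus_zero, of b 1 0] Y[of b] by (simp add: superbracket_zero_left)
    then have "cls (of_int b \<cdot>\<^sub>m Y b) \<oplus>\<^bsub>fin_alg\<^esub> cls ((- \<beta> dd) \<cdot>\<^sub>m Y b) = cls (\<beta> dd \<cdot>\<^sub>m Y b) \<oplus>\<^bsub>fin_alg\<^esub> cls ((- \<beta> dd) \<cdot>\<^sub>m Y b)"
      by simp
    then have "cls ((of_int b - \<beta> dd) \<cdot>\<^sub>m Y b) = cls mzero"
      using Y[of b] zero_smult_mat[of "Y b"]
      by (simp add: add_smult_distrib_right_mat[of _ N N, symmetric])
    then have "(1 / (of_int b - \<beta> dd)) \<odot>\<^bsub>fin_alg\<^esub> cls ((of_int b - \<beta> dd) \<cdot>\<^sub>m Y b) = (1 / (of_int b - \<beta> dd)) \<odot>\<^bsub>fin_alg\<^esub> cls mzero"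
      by (simp only:)
    then show ?thesis using Y that by (simp add: smult_zero_mat smult_smult_mat smult_one_mat)
  qed
  obtain m where m: "cls (Y m) \<noteq> cls mzero" using x(2) rs unfolding xe zero_L loop_eq_iff by auto
  have dm: "\<beta> dd = of_int m" using deg m by blast
  define X where "X = (1 / \<beta> (cartan D0 0 0)) \<cdot>\<^sub>m superbracket m1 D0 (Y m)"
  have X: "X \<in> matrices" unfolding X_def using D0 Y by (simp add: torus_matrices)
  have bD: "cls (superbracket m1 D (Y m)) = cls (\<beta> (cartan D 0 0) \<cdot>\<^sub>m Y m)" if "D \<in> torus" for D
    using act(1)[OF that, of m 0 0] torus_carrier[OF that] Y[of m] zero_smult_mat[of "Y m"] by simp
  have XY: "cls X = cls (Y m)"
  proof -
    have "cls X = (1 / \<beta> (cartan D0 0 0)) \<odot>\<^bsub>fin_alg\<^esub> cls (superbracket m1 D0 (Y m))"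
      unfolding X_def using D0 Y by (simp add: torus_matrices)
    then show ?thesis unfolding bD[OF D0(1)] using D0(2) Y by (simp add: smult_smult_mat smult_one_mat)
  qed
  have tX: "upper_trace X = 0"
    unfolding X_def using D0 Y torus_carrier[OF D0(1)] by (simp add: upper_trace_smult upper_trace_torus_bracket)
  have "x = monomial m X"
    unfolding xe monomial_def loop_eq_iff using rs XY deg dm by (auto simp: single_def)
  moreover have "root_vector \<beta> m X"
    unfolding root_vector_def
  proof (intro conjI)
    show "X \<noteq> mzero" using XY m by auto
    have "cls (sigma_matrix X) = cls (zpow m \<cdot>\<^sub>m X)"
      using sY[of m] XY X Y sigma_cls cls_smult by metis
    then show "sigma_matrix X = zpow m \<cdot>\<^sub>m X"
      by (rule cls_eq_upper_trace[OF k_pos matrices_sigma_matrix[OF X] matrices_smult[OF X]])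
        (use X tX in \<open>simp add: upper_trace_smult upper_trace_sigma_matrix\<close>)
    show "has_weight X (\<lambda>D. \<beta> (cartan D 0 0))"
      unfolding has_weight_def
    proof
      fix D assume D: "D \<in> torus"
      have "cls (superbracket m1 D X) = cls D \<otimes>\<^bsub>fin_alg\<^esub> cls (Y m)"
        using XY cls_mult[OF torus_matrices[OF D] X] by simp
      also have "\<dots> = \<beta> (cartan D 0 0) \<odot>\<^bsub>fin_alg\<^esub> cls X"
        unfolding XY using bD[OF D] torus_matrices[OF D] Y by simp
      finally have "cls (superbracket m1 D X) = cls (\<beta> (cartan D 0 0) \<cdot>\<^sub>m X)" using X by simp
      then show "superbracket m1 D X = \<beta> (cartan D 0 0) \<cdot>\<^sub>m X"
        by (rule cls_eq_upper_trace[OF k_pos matrices_superbracket[OF torus_matrices[OF D] X] matrices_smult[OF X]])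
          (use X tX upper_trace_torus_bracket[OF D] in \<open>simp add: upper_trace_smult\<close>)
    qed
    show "\<beta> cc = 0" by (rule root_space_cc[OF x])
  qed (use X tX dm in simp_all)
  ultimately show ?thesis using that by blast
qed

lemma R_memI: "\<beta> \<in> h_dual \<Longrightarrow> x \<in> root_space \<beta> \<Longrightarrow> x \<noteq> \<zero>\<^bsub>L\<^esub> \<Longrightarrow> \<beta> \<in> R"
  by (auto simp: R_def)

lemma R_memE:
  assumes "\<beta> \<in> R" obtains x where "\<beta> \<in> h_dual" "x \<in> root_space \<beta>" "x \<noteq> \<zero>\<^bsub>L\<^esub>"
  using assms zero_root_space[of \<beta>] unfolding R_def by blast

text \<open>A root vector in \<open>L0 i + h\<close> equals, up to a nonzero factor, its bracket with an element of the torus.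
This bracket kills the part in \<open>h\<close> and preserves the ideal of block \<open>i\<close>.\<close>

lemma R_part_memE:
  assumes a: "\<alpha> \<in> R_part i" and fin: "finite_part_nonzero \<alpha>" and i: "i \<in> {1, 2}"
  obtains m X where "\<alpha> \<in> h_dual" "root_vector \<alpha> m X" "X \<in> block_matrices i"
proof -
  have zero_sum: "\<zero>\<^bsub>L\<^esub> \<in> {x \<oplus>\<^bsub>L\<^esub> y | x y. x \<in> L0 i \<and> y \<in> h}"
  proof -
    have "\<zero>\<^bsub>L\<^esub> \<in> L0 i"
      using zero_root_space[of \<alpha>] unfolding root_space_def L0_def zero_L loop_def
      by (auto simp: t_ideal_def)
    moreover have "cartan mzero 0 0 \<in> h" using torus_zero by simp
    moreover have "\<zero>\<^bsub>L\<^esub> = \<zero>\<^bsub>L\<^esub> \<oplus>\<^bsub>L\<^esub> cartan mzero 0 0"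
      unfolding zero_L cartan_def by (subst loop_add) (auto simp: loop_eq_iff single_def)
    ultimately show ?thesis by blast
  qed
  have \<alpha>: "\<alpha> \<in> h_dual" using a by (simp add: R_part_def)
  obtain x y where xy: "x \<in> L0 i" "y \<in> h" "x \<oplus>\<^bsub>L\<^esub> y \<in> root_space \<alpha>" "x \<oplus>\<^bsub>L\<^esub> y \<noteq> \<zero>\<^bsub>L\<^esub>"
    using a zero_sum zero_root_space[of \<alpha>] unfolding R_part_def by blast
  obtain m X where rv: "root_vector \<alpha> m X" and e: "x \<oplus>\<^bsub>L\<^esub> y = monomial m X"
    using root_space_root_vector[OF \<alpha> xy(3,4) fin] by blast
  obtain f r s where x: "x = (f, r, s)" by (cases x)
  have "\<forall>b. \<exists>Z\<in>block_matrices i. f b = cls Z"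
    using xy(1) x by (auto simp: L0_def t_ideal_def)
  then obtain Y where Y: "\<And>b. Y b \<in> block_matrices i" "\<And>b. f b = cls (Y b)" by metis
  have YM: "\<And>b. Y b \<in> matrices" using Y(1) block_matrices_matrices by blast
  have xe: "x = loop Y r s" using x Y(2) by (simp add: loop_def fun_eq_iff)
  obtain D r' s' where y: "y = cartan D r' s'" "D \<in> torus" using xy(2) by (rule hE)
  obtain D0 where D0: "D0 \<in> torus" "\<alpha> (cartan D0 0 0) \<noteq> 0" using fin by (auto simp: finite_part_nonzero_def)
  let ?w = "\<alpha> (cartan D0 0 0)"
  have X: "X \<in> matrices" "upper_trace X = 0" and w: "superbracket m1 D0 X = ?w \<cdot>\<^sub>m X"
    using rv D0 by (auto simp: root_vector_def has_weight_def)
  have "cls (Y m + single 0 D m) = cls X"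
    using e unfolding xe y(1) cartan_def monomial_def using YM y(2)
    by (subst (asm) loop_add) (auto simp: torus_matrices loop_eq_iff single_def dest: spec[of _ m])
  moreover have sD: "single 0 D m \<in> matrices" using y(2) by (simp add: torus_matrices)
  ultimately have "cls (superbracket m1 D0 (Y m + single 0 D m)) = cls (superbracket m1 D0 X)"
    using cls_mult[OF torus_matrices[OF D0(1)]] X Y by (metis block_matrices_matrices matrices_add)
  moreover have "superbracket m1 D0 (Y m + single 0 D m) = superbracket m1 D0 (Y m)"
  proof (rule square_mat_eqI[where n = N])
    have c: "Y m \<in> carrier_mat N N" "single 0 D m \<in> carrier_mat N N" using YM[of m] sD by auto
    fix i j assume ij: "i < N" "j < N"
    have "(D0 $$ (i, i) - D0 $$ (j, j)) * single 0 D m $$ (i, j) = 0"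
      using ij torus_entry[OF y(2) ij] by (cases "i = j") (auto simp: single_def)
    then show "superbracket m1 D0 (Y m + single 0 D m) $$ (i, j) = superbracket m1 D0 (Y m) $$ (i, j)"
      using c ij by (simp add: torus_superbracket_index[OF D0(1)] distrib_left)
  qed (use torus_carrier[OF D0(1)] YM[of m] sD in auto)
  ultimately have "cls (superbracket m1 D0 (Y m)) = cls (?w \<cdot>\<^sub>m X)" using w by simp
  then have eq: "superbracket m1 D0 (Y m) = ?w \<cdot>\<^sub>m X"
    by (rule cls_eq_upper_trace[OF k_pos matrices_superbracket[OF torus_matrices[OF D0(1)] block_matrices_matrices[OF Y(1)]] matrices_smult[OF X(1)]])
      (use X YM[of m] upper_trace_torus_bracket[OF D0(1)] in \<open>auto simp: upper_trace_smult\<close>)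
  have "X \<in> block_matrices i"
  proof (rule block_matricesI[OF X(1)])
    fix a b assume ab: "a < N" "b < N" "X $$ (a, b) \<noteq> 0"
    have Yc: "Y m \<in> carrier_mat N N" using YM by auto
    have "superbracket m1 D0 (Y m) $$ (a, b) \<noteq> 0" unfolding eq using ab matrices_carrier[OF X(1)] D0(2) by simp
    then have "Y m $$ (a, b) \<noteq> 0" using torus_superbracket_index[OF D0(1) Yc ab(1,2)] by auto
    then show "a \<in> block_indices i \<and> b \<in> block_indices i" using block_matrices_entry[OF Y(1) ab(1,2)] by blast
  qed
  then show ?thesis using that \<alpha> rv by blast
qed

lemma R_part_memI:
  assumes \<alpha>: "\<alpha> \<in> h_dual" and rv: "root_vector \<alpha> m X" and X: "X \<in> block_matrices i"
  shows "\<alpha> \<in> R_part i"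
proof -
  have "monomial m X \<in> L0 i"
    using monomial_carrier[of X m] rv X unfolding L0_def root_vector_def
    by (auto simp: monomial_def loop_def single_def t_ideal_def)
  moreover have "monomial m X = monomial m X \<oplus>\<^bsub>L\<^esub> cartan mzero 0 0"
    unfolding monomial_def cartan_def using X by (subst loop_add) (auto simp: loop_eq_iff single_def)
  moreover have "cartan mzero 0 0 \<in> h" using torus_zero by simp
  ultimately have "monomial m X \<in> {x \<oplus>\<^bsub>L\<^esub> y | x y. x \<in> L0 i \<and> y \<in> h}" by blast
  then show ?thesis using root_vector_root_space[OF \<alpha> rv] \<alpha> unfolding R_part_def by blast
qed

lemma bform_cartan:
  assumes D: "D \<in> torus" and E: "E \<in> torus"
  shows "bform (cartan D r s) (cartan E r' s') = supertrace m1 (D * E) + r * s' + s * r'"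
  using sum_single[OF torus_matrices[OF D], where Y = "\<lambda>a. single 0 E (- a)" and m = 0 and f = "\<lambda>_. 1"] torus_matrices[OF E]
  by (simp add: bform_def cartan_def loop_def zero_fin_alg) (simp add: single_def)

lemma dual_vector_eqI:
  assumes D: "D \<in> torus" and eq: "\<And>E r' s'. E \<in> torus \<Longrightarrow> \<alpha> (cartan E r' s') = bform (cartan D r s) (cartan E r' s')"
  shows "dual_vector \<alpha> = cartan D r s"
  unfolding dual_vector_def
proof (rule the_equality)
  show "cartan D r s \<in> h \<and> (\<forall>y\<in>h. \<alpha> y = bform (cartan D r s) y)"
    using D eq by (auto simp: h_eq)
  fix x assume x: "x \<in> h \<and> (\<forall>y\<in>h. \<alpha> y = bform x y)"
  then obtain D' p q where x': "x = cartan D' p q" "D' \<in> torus" using hE by blast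
  have b: "bform (cartan D' p q) (cartan E r' s') = bform (cartan D r s) (cartan E r' s')" if "E \<in> torus" for E r' s'
    using x eq[OF that] that unfolding x'(1) by (metis cartan_mem)
  have z: "supertrace m1 (F * mzero) = 0" if "F \<in> torus" for F
    using supertrace_mult_torus[OF torus_carrier[OF that] torus_zero] by simp
  have "p = r" "q = s"
    using b[OF torus_zero, of 0 1] b[OF torus_zero, of 1 0] z D x'(2) torus_zero by (simp_all add: bform_cartan)
  define F where "F = D' + (- 1) \<cdot>\<^sub>m D"
  have F: "F \<in> torus" unfolding F_def using D x'(2) by (intro torus_add torus_smult)
  have "supertrace m1 (F * E) = 0" if E: "E \<in> torus" for E
  proof -
    have "supertrace m1 (F * E) = supertrace m1 (D' * E) - supertrace m1 (D * E)"
      unfolding supertrace_mult_torus[OF torus_carrier[OF F] E]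
        supertrace_mult_torus[OF torus_carrier[OF D] E]
        supertrace_mult_torus[OF torus_carrier[OF x'(2)] E] sum_subtractf[symmetric]
      by (rule sum.cong) (use torus_carrier[OF D] torus_carrier[OF x'(2)] in \<open>simp_all add: F_def algebra_simps\<close>)
    then show ?thesis using b[OF E, of 0 0] E D x'(2) by (simp add: bform_cartan)
  qed
  then have "F = mzero" using torus_nondegenerate[OF F] by blast
  then have "D' $$ (i, j) = D $$ (i, j)" if "i < N" "j < N" for i j
  proof -
    have "F $$ (i, j) = D' $$ (i, j) - D $$ (i, j)"
      using that torus_carrier[OF D] torus_carrier[OF x'(2)] by (simp add: F_def)
    then show ?thesis using \<open>F = mzero\<close> that by simp
  qed
  then have "D' = D"
    using square_mat_eqI[OF torus_carrier[OF x'(2)] torus_carrier[OF D]] by blast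
  then show "x = cartan D r s" using x'(1) \<open>p = r\<close> \<open>q = s\<close> by simp
qed

text \<open>If a root vanishes on the finite torus, it is a multiple of \<open>\<delta>\<close>, and its dual vector is a multiple of
the isotropic element \<open>c\<close>.\<close>

lemma dual_form_zero:
  assumes \<alpha>: "\<alpha> \<in> R" and nf: "\<not> finite_part_nonzero \<alpha>"
  shows "dual_form \<alpha> \<alpha> = 0"
proof -
  obtain x where x: "\<alpha> \<in> h_dual" "x \<in> root_space \<alpha>" "x \<noteq> \<zero>\<^bsub>L\<^esub>" using R_memE[OF \<alpha>] by blast
  have z: "supertrace m1 (mzero * E) = 0" if "E \<in> torus" for E
    using supertrace_mult_torus[OF zero_carrier_mat that] by simp
  have "dual_vector \<alpha> = cartan mzero (\<alpha> dd) 0"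
  proof (rule dual_vector_eqI[OF torus_zero])
    fix E r' s' assume E: "E \<in> torus"
    then show "\<alpha> (cartan E r' s') = bform (cartan mzero (\<alpha> dd) 0) (cartan E r' s')"
      using h_dual_cartan[OF x(1) E, of r' s'] root_space_cc[OF x(2,3)] nf z torus_zero
      by (simp add: bform_cartan finite_part_nonzero_def)
  qed
  then show ?thesis
    unfolding dual_form_def by (simp only: bform_cartan[OF torus_zero torus_zero] z[OF torus_zero]) simp
qed

text \<open>The diagonal entries of the coroot are real, and the supertrace form is definite on real diagonal
matrices supported in one block.\<close>

lemma coroot_self_pairing:
  assumes X: "X \<in> block_matrices a" and a: "a \<in> {1, 2}" and w: "has_weight X w"
    and Z: "coroot X \<in> torus" "coroot X \<noteq> mzero"
  shows "supertrace m1 (coroot X * coroot X) \<noteq> 0"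
proof -
  have Zb: "coroot X \<in> block_matrices a" by (rule coroot_block[OF X a w])
  have r: "cnj (coroot X $$ (i, i)) = coroot X $$ (i, i)" if "i < N" for i
    by (simp add: coroot_index[OF X that that] mult.commute)
  have t: "parity_sign i * (coroot X $$ (i, i) * coroot X $$ (i, i)) = block_sign a * of_real ((cmod (coroot X $$ (i, i)))\<^sup>2)"
    if i: "i < N" for i
  proof (cases "coroot X $$ (i, i) = 0")
    case False
    then have "parity_sign i = block_sign a"
      using block_matrices_entry[OF Zb i i] parity_sign_block[OF i] by blast
    moreover have "coroot X $$ (i, i) * coroot X $$ (i, i) = of_real ((cmod (coroot X $$ (i, i)))\<^sup>2)"
      using r[OF i] complex_norm_square[of "coroot X $$ (i, i)"] by simp
    ultimately show ?thesis by (simp only:)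
  qed simp
  have "supertrace m1 (coroot X * coroot X) = (\<Sum>i<N. block_sign a * of_real ((cmod (coroot X $$ (i, i)))\<^sup>2))"
    unfolding supertrace_mult_torus[OF torus_carrier[OF Z(1)] Z(1)]
    by (rule sum.cong) (use t in auto)
  also have "\<dots> = block_sign a * of_real (\<Sum>i<N. (cmod (coroot X $$ (i, i)))\<^sup>2)"
    by (simp only: sum_distrib_left of_real_sum)
  finally have s: "supertrace m1 (coroot X * coroot X) = block_sign a * of_real (\<Sum>i<N. (cmod (coroot X $$ (i, i)))\<^sup>2)" .
  have "\<exists>i<N. coroot X $$ (i, i) \<noteq> 0"
  proof (rule ccontr)
    assume "\<not> ?thesis"
    then have "coroot X $$ (i, j) = mzero $$ (i, j)" if "i < N" "j < N" for i j
      using torus_entry[OF Z(1) that] that by (cases "i = j") auto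
    then show False using square_mat_eqI[OF torus_carrier[OF Z(1)] zero_carrier_mat] Z(2) by blast
  qed
  then have "(\<Sum>i<N. (cmod (coroot X $$ (i, i)))\<^sup>2) > 0"
    by (elim exE conjE) (rule sum_pos2, auto)
  then show ?thesis unfolding s by (simp add: block_sign_def del: of_real_sum)
qed

text \<open>The dual vector is the coroot, divided by the pairing of the two opposite root vectors, plus a multiple
of \<open>c\<close>; its square is that of the coroot up to a nonzero factor. The degree enters only through \<open>c\<close>, so
the statement applies to all translates of a root by multiples of \<open>\<delta>\<close>, whether or not there is a root
vector in block \<open>i\<close> for them.\<close>

lemma dual_form_nonzero:
  assumes \<beta>: "\<beta> \<in> h_dual" "\<beta> cc = 0" "finite_part_nonzero \<beta>"
    and X: "X \<in> block_matrices a" "X \<noteq> mzero" and a: "a \<in> {1, 2}" and sX: "sigma_matrix X = zpow m \<cdot>\<^sub>m X"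
    and w: "has_weight X (\<lambda>D. \<beta> (cartan D 0 0))"
  shows "coroot X \<in> torus" and "\<beta> (cartan (coroot X) 0 0) \<noteq> 0" and "dual_form \<beta> \<beta> \<noteq> 0"
proof -
  have Zb: "coroot X \<in> torus_block a" by (rule coroot_torus_block[OF X(1) a w sX zpow_norm])
  show Z: "coroot X \<in> torus" by (rule torus_block_torus[OF Zb a])
  define q where "q = norm_form X"
  have q: "q \<noteq> 0" unfolding q_def by (rule norm_form_nonzero[OF X(1) a w X(2)])
  have pair: "supertrace m1 (coroot X * D) = \<beta> (cartan D 0 0) * q" if "D \<in> torus" for D
    unfolding q_def by (rule supertrace_coroot[OF X(1) a w that])
  obtain D0 where D0: "D0 \<in> torus" "\<beta> (cartan D0 0 0) \<noteq> 0" using \<beta>(3) by (auto simp: finite_part_nonzero_def)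
  have "coroot X \<noteq> mzero"
  proof
    assume "coroot X = mzero"
    then have "supertrace m1 (mzero * D0) \<noteq> 0" using pair[OF D0(1)] D0(2) q by simp
    then show False using supertrace_mult_torus[OF zero_carrier_mat D0(1)] by simp
  qed
  then have self: "supertrace m1 (coroot X * coroot X) \<noteq> 0" by (rule coroot_self_pairing[OF X(1) a w Z])
  then show "\<beta> (cartan (coroot X) 0 0) \<noteq> 0" using pair[OF Z] by auto
  define Z' where "Z' = (1 / q) \<cdot>\<^sub>m coroot X"
  have Z': "Z' \<in> torus" unfolding Z'_def by (rule torus_smult[OF Z])
  have pZ: "supertrace m1 (Z' * D) = \<beta> (cartan D 0 0)" if D: "D \<in> torus" for D
  proof -
    have "Z' * D = (1 / q) \<cdot>\<^sub>m (coroot X * D)"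
      unfolding Z'_def using torus_carrier[OF Z] torus_carrier[OF D] by (simp add: mult_smult_assoc_mat)
    then show ?thesis
      using supertrace_smult[OF mult_carrier_mat[OF torus_carrier[OF Z] torus_carrier[OF D]], of "1 / q"] pair[OF D] q by simp
  qed
  have "dual_vector \<beta> = cartan Z' (\<beta> dd) 0"
  proof (rule dual_vector_eqI[OF Z'])
    fix E r' s' assume E: "E \<in> torus"
    then show "\<beta> (cartan E r' s') = bform (cartan Z' (\<beta> dd) 0) (cartan E r' s')"
      using h_dual_cartan[OF \<beta>(1) E, of r' s'] \<beta>(2) pZ[OF E] Z' by (simp add: bform_cartan)
  qed
  then have "dual_form \<beta> \<beta> = \<beta> (cartan Z' 0 0)"
    using Z' pZ[OF Z'] by (simp add: dual_form_def bform_cartan)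
  also have "cartan Z' 0 0 = (1 / q) \<odot>\<^bsub>L\<^esub> cartan (coroot X) 0 0"
    unfolding Z'_def using Z by (simp add: cartan_smult)
  also have "\<beta> \<dots> = (1 / q) * \<beta> (cartan (coroot X) 0 0)" using \<beta>(1) Z by (simp add: h_dual_def)
  finally show "dual_form \<beta> \<beta> \<noteq> 0" using \<open>\<beta> (cartan (coroot X) 0 0) \<noteq> 0\<close> q by simp
qed

lemma R_part_reE:
  assumes \<alpha>: "\<alpha> \<in> R_part_re i" and i: "i \<in> {1, 2}"
  obtains m X where "\<alpha> \<in> h_dual" "root_vector \<alpha> m X" "X \<in> block_matrices i" "finite_part_nonzero \<alpha>"
proof -
  have "\<alpha> \<in> R" "dual_form \<alpha> \<alpha> \<noteq> 0" "\<alpha> \<in> R_part i" using \<alpha> by (auto simp: R_part_re_def R_re_def)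
  then have "finite_part_nonzero \<alpha>" using dual_form_zero by blast
  then show ?thesis using R_part_memE[OF \<open>\<alpha> \<in> R_part i\<close> _ i] that by metis
qed

lemma R_part_reI:
  assumes \<alpha>: "\<alpha> \<in> h_dual" and rv: "root_vector \<alpha> m X" and X: "X \<in> block_matrices i" and i: "i \<in> {1, 2}"
    and fin: "finite_part_nonzero \<alpha>"
  shows "\<alpha> \<in> R_part_re i"
proof -
  have "dual_form \<alpha> \<alpha> \<noteq> 0"
    by (rule dual_form_nonzero(3)[OF \<alpha> _ fin X _ i]) (use rv in \<open>auto simp: root_vector_def\<close>)
  moreover have "\<alpha> \<in> R" using root_vector_root_space[OF \<alpha> rv] R_memI[OF \<alpha>] by blast
  ultimately show ?thesis using R_part_memI[OF \<alpha> rv X] by (simp add: R_part_re_def R_re_def)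
qed

lemma finite_part_shift [simp]: "finite_part_nonzero (shift \<alpha> n) \<longleftrightarrow> finite_part_nonzero \<alpha>"
  by (simp add: finite_part_nonzero_def shift_cartan)

lemma shift_values:
  "D \<in> torus \<Longrightarrow> shift \<alpha> n (cartan D 0 0) = \<alpha> (cartan D 0 0)"
  "shift \<alpha> n cc = \<alpha> cc" "shift \<alpha> n dd = \<alpha> dd + of_int n"
  using torus_zero by (simp_all add: shift_cartan)

lemma has_weight_shift: "has_weight X (\<lambda>D. shift \<alpha> n (cartan D 0 0)) \<longleftrightarrow> has_weight X (\<lambda>D. \<alpha> (cartan D 0 0))"
  by (simp add: has_weight_def shift_values)

lemma shift_R_re:
  assumes \<alpha>: "\<alpha> \<in> R_part_re i" and i: "i \<in> {1, 2}" and R: "shift \<alpha> n \<in> R"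
  shows "shift \<alpha> n \<in> R_re"
proof -
  obtain m X where 1: "\<alpha> \<in> h_dual" "root_vector \<alpha> m X" "X \<in> block_matrices i" "finite_part_nonzero \<alpha>"
    using R_part_reE[OF \<alpha> i] .
  have "dual_form (shift \<alpha> n) (shift \<alpha> n) \<noteq> 0"
    by (rule dual_form_nonzero(3)[OF shift_h_dual[OF 1(1)] _ _ 1(3) _ i, where m = m])
      (use 1 in \<open>auto simp: root_vector_def shift_values has_weight_shift\<close>)
  then show ?thesis using R by (simp add: R_re_def)
qed

lemma root_vector_shift:
  assumes rv: "root_vector \<alpha> m X"
  shows "root_vector (shift \<alpha> (int period * q)) (m + int period * q) X"
  using rv unfolding root_vector_def shift_values has_weight_shift by (simp add: zpow_period)

lemma R_part_re_shift:
  assumes \<alpha>: "\<alpha> \<in> R_part_re i" and i: "i \<in> {1, 2}"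
  shows "shift \<alpha> (int period * q) \<in> R_part_re i"
proof -
  obtain m X where 1: "\<alpha> \<in> h_dual" "root_vector \<alpha> m X" "X \<in> block_matrices i" "finite_part_nonzero \<alpha>"
    using R_part_reE[OF \<alpha> i] .
  show ?thesis
    by (rule R_part_reI[OF shift_h_dual[OF 1(1)] root_vector_shift[OF 1(2)] 1(3) i]) (simp add: 1(4))
qed

lemma conj_transpose_conj_transpose: "X \<in> carrier_mat N N \<Longrightarrow> conj_transpose (conj_transpose X) = X"
  by (rule square_mat_eqI[where n = N]) (simp_all add: conj_transpose_index)

lemma conj_transpose_smult:
  "X \<in> carrier_mat N N \<Longrightarrow> conj_transpose (c \<cdot>\<^sub>m X) = cnj c \<cdot>\<^sub>m conj_transpose X"
  by (rule square_mat_eqI[where n = N]) (simp_all add: conj_transpose_index)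

lemma root_vector_conj_transpose:
  assumes \<alpha>: "\<alpha> \<in> h_dual" and rv: "root_vector \<alpha> m X" and X: "X \<in> block_matrices i"
  shows "root_vector (\<lambda>x. - \<alpha> x) (- m) (conj_transpose X)"
proof -
  have XN: "X \<in> carrier_mat N N" using X by simp
  have s: "sigma_matrix (conj_transpose X) = zpow (- m) \<cdot>\<^sub>m conj_transpose X"
    using sigma_matrix_conj_transpose[OF XN block_matrices_even[OF X]] rv XN
    by (simp add: root_vector_def conj_transpose_smult zpow_minus)
  have "conj_transpose X \<noteq> mzero"
  proof
    assume "conj_transpose X = mzero"
    then have "X = conj_transpose mzero" using conj_transpose_conj_transpose[OF XN] by simp
    then have "X = mzero" by (simp add: conj_transpose_def zero_mat_def cong: cong_mat)
    then show False using rv by (simp add: root_vector_def)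
  qed
  then show ?thesis
    using rv s X has_weight_conj_transpose[OF XN, of "\<lambda>D. \<alpha> (cartan D 0 0)"]
      upper_trace_block[OF block_matrices_conj_transpose[OF X]] block_matrices_conj_transpose[OF X]
    block_matrices_matrices[OF block_matrices_conj_transpose[OF X]]
    unfolding root_vector_def by auto
qed

lemma R_part_re_neg:
  assumes \<alpha>: "\<alpha> \<in> R_part_re i" and i: "i \<in> {1, 2}"
  shows "(\<lambda>x. - \<alpha> x) \<in> R_part_re i"
proof -
  obtain m X where 1: "\<alpha> \<in> h_dual" "root_vector \<alpha> m X" "X \<in> block_matrices i" "finite_part_nonzero \<alpha>"
    using R_part_reE[OF \<alpha> i] .
  have "(\<lambda>x. - \<alpha> x) \<in> h_dual" using h_dual_scale[OF 1(1), of "-1"] by simp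
  then show ?thesis
    by (rule R_part_reI[OF _ root_vector_conj_transpose[OF 1(1-3)] block_matrices_conj_transpose[OF 1(3)] i])
      (use 1(4) in \<open>simp add: finite_part_nonzero_def\<close>)
qed

text \<open>The functional is read off from the two diagonal positions that give the weight of an explicit root
matrix, and the degree is chosen to match the eigenvalue of that matrix.\<close>

lemma R_part_re_nonempty:
  assumes i: "i \<in> {1, 2}"
  shows "\<exists>\<alpha>. \<alpha> \<in> R_part_re i"
proof -
  obtain X e a b where X: "X \<in> block_matrices i" "X \<noteq> mzero" "e \<in> {1, -1}" "sigma_matrix X = e \<cdot>\<^sub>m X"
    and w: "has_weight X (\<lambda>D. D $$ (a, a) - D $$ (b, b))" and D: "\<exists>D\<in>torus. D $$ (a, a) \<noteq> D $$ (b, b)"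
    and ab: "a < N" "b < N"
    using root_matrix_exists[OF k_pos l_pos i] by blast
  obtain m where m: "zpow m = e" using X(3) zpow_minus_one zpow_0 by blast
  define mat_of where "mat_of x = (THE D. D \<in> torus \<and> (\<exists>r s. x = cartan D r s))" for x
  have mat_of: "mat_of (cartan D r s) = D" if "D \<in> torus" for D r s
    unfolding mat_of_def by (rule the_equality) (use that cartan_inj in auto)
  define \<alpha> where "\<alpha> x = (if x \<in> h then mat_of x $$ (a, a) - mat_of x $$ (b, b) + of_int m * snd (snd x) else 0)" for x
  have \<alpha>_cartan: "\<alpha> (cartan D r s) = D $$ (a, a) - D $$ (b, b) + of_int m * s" if "D \<in> torus" for D r s
    using that mat_of[OF that] by (simp add: \<alpha>_def) (simp add: cartan_def loop_def)
  have \<alpha>: "\<alpha> \<in> h_dual"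
  proof (rule h_dualI)
    show "\<alpha> x = 0" if "x \<notin> h" for x using that by (simp add: \<alpha>_def)
    show "\<alpha> (cartan (D + E) (r + r') (s + s')) = \<alpha> (cartan D r s) + \<alpha> (cartan E r' s')"
      if "D \<in> torus" "E \<in> torus" for D E r s r' s'
      using that torus_carrier[OF that(1)] torus_carrier[OF that(2)] ab by (simp add: \<alpha>_cartan torus_add algebra_simps)
    show "\<alpha> (cartan (z \<cdot>\<^sub>m D) (z * r) (z * s)) = z * \<alpha> (cartan D r s)" if "D \<in> torus" for D r s z
      using that torus_carrier[OF that(1)] ab by (simp add: \<alpha>_cartan torus_smult algebra_simps)
  qed
  have "finite_part_nonzero \<alpha>" using D by (auto simp: finite_part_nonzero_def \<alpha>_cartan)
  moreover have "root_vector \<alpha> m X"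
    using X w m upper_trace_block[OF X(1)] ab torus_zero
    by (auto simp: root_vector_def \<alpha>_cartan has_weight_def)
  ultimately show ?thesis using R_part_reI[OF \<alpha> _ X(1) i] by blast
qed

lemma even_plus_odd: "X \<in> carrier_mat N N \<Longrightarrow> even_part m1 X + odd_part m1 X = X"
  by (rule square_mat_eqI[where n = N]) (simp_all add: even_part_index[of _ N] odd_part_index[of _ N])

lemma even_part_smult: "X \<in> carrier_mat N N \<Longrightarrow> even_part m1 (c \<cdot>\<^sub>m X) = c \<cdot>\<^sub>m even_part m1 X"
  by (rule square_mat_eqI[where n = N]) (simp_all add: even_part_index[of _ N])

lemma odd_part_smult: "X \<in> carrier_mat N N \<Longrightarrow> odd_part m1 (c \<cdot>\<^sub>m X) = c \<cdot>\<^sub>m odd_part m1 X"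
  by (rule square_mat_eqI[where n = N]) (simp_all add: odd_part_index[of _ N])

lemma root_vector_even_part:
  assumes rv: "root_vector \<beta> m X" and nz: "even_part m1 X \<noteq> mzero"
  shows "root_vector \<beta> m (even_part m1 X)"
proof -
  have X: "X \<in> carrier_mat N N" "X \<in> matrices" using rv by (auto simp: root_vector_def)
  have "has_weight (even_part m1 X) (\<lambda>D. \<beta> (cartan D 0 0))"
    using rv unfolding root_vector_def has_weight_iff[OF X(1)] has_weight_iff[OF even_part_carrier[OF X(1)]]
    by (auto simp: even_part_index[OF X(1)])
  then show ?thesis using rv nz X unfolding root_vector_def
    by (simp add: upper_trace_even_part sigma_matrix_even_part even_part_smult)
qed

lemma root_vector_odd_part:
  assumes rv: "root_vector \<beta> m X" and nz: "odd_part m1 X \<noteq> mzero"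
  shows "root_vector \<beta> m (odd_part m1 X)"
proof -
  have X: "X \<in> carrier_mat N N" "X \<in> matrices" using rv by (auto simp: root_vector_def)
  have "has_weight (odd_part m1 X) (\<lambda>D. \<beta> (cartan D 0 0))"
    using rv unfolding root_vector_def has_weight_iff[OF X(1)] has_weight_iff[OF odd_part_carrier[OF X(1)]]
    by (auto simp: odd_part_index[OF X(1)])
  then show ?thesis using rv nz X unfolding root_vector_def
    by (simp add: upper_trace_odd_part sigma_matrix_odd_part odd_part_smult)
qed

text \<open>A translate of a root of block \<open>i\<close> by a multiple of \<open>\<delta>\<close> may have odd root vectors. An even one lies in
block \<open>i\<close> again, since some element of the torus of block \<open>i\<close> acts on it by a nonzero scalar.\<close>

lemma even_part_block:
  assumes \<alpha>: "\<alpha> \<in> R_part_re i" and i: "i \<in> {1, 2}" and rv: "root_vector (shift \<alpha> n) m X"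
  shows "even_part m1 X \<in> block_matrices i"
proof -
  obtain m' A where 1: "\<alpha> \<in> h_dual" "root_vector \<alpha> m' A" "A \<in> block_matrices i" "finite_part_nonzero \<alpha>"
    using R_part_reE[OF \<alpha> i] .
  have X: "X \<in> carrier_mat N N" "X \<in> matrices" using rv by (auto simp: root_vector_def)
  have A: "A \<in> carrier_mat N N" using 1(3) by simp
  have wA: "\<And>D a b. D \<in> torus \<Longrightarrow> a < N \<Longrightarrow> b < N \<Longrightarrow> A $$ (a, b) \<noteq> 0 \<Longrightarrow> D $$ (a, a) - D $$ (b, b) = \<alpha> (cartan D 0 0)"
    using 1(2) unfolding root_vector_def has_weight_iff[OF A] by blast
  have wX: "\<And>D a b. D \<in> torus \<Longrightarrow> a < N \<Longrightarrow> b < N \<Longrightarrow> X $$ (a, b) \<noteq> 0 \<Longrightarrow> D $$ (a, a) - D $$ (b, b) = \<alpha> (cartan D 0 0)"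
    using rv unfolding root_vector_def has_weight_shift has_weight_iff[OF X(1)] by blast
  obtain a b where ab: "a < N" "b < N" "A $$ (a, b) \<noteq> 0"
    using 1(2) square_mat_eqI[OF A zero_carrier_mat] unfolding root_vector_def by fastforce
  have abi: "a \<in> block_indices i" "b \<in> block_indices i" using block_matrices_entry[OF 1(3) ab] by auto
  obtain D where D: "D \<in> torus" "\<alpha> (cartan D 0 0) \<noteq> 0" using 1(4) by (auto simp: finite_part_nonzero_def)
  obtain D1 D2 where D12: "D1 \<in> torus_block 1" "D2 \<in> torus_block 2" "D = D1 + D2"
    "D1 \<in> carrier_mat N N" "D2 \<in> carrier_mat N N" using D(1) by (rule torusE)
  have b: "D1 \<in> block_matrices 1" "D2 \<in> block_matrices 2" using D12 by (auto simp: torus_block_def)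
  define E where "E = (if i = 1 then D1 else D2)"
  have E: "E \<in> torus_block i" "E \<in> block_matrices i" using D12 b i by (auto simp: E_def)
  have "E $$ (c, c) = D $$ (c, c)" if c: "c < N" "c \<in> block_indices i" for c
  proof -
    have "(if i = 1 then D2 else D1) $$ (c, c) = 0"
      using block_matrices_entry[OF b(1) c(1) c(1)] block_matrices_entry[OF b(2) c(1) c(1)] c i
      by (auto simp: mem_block_indices)
    then show ?thesis using D12 c(1) i by (auto simp: E_def split: if_splits)
  qed
  then have nz: "\<alpha> (cartan E 0 0) \<noteq> 0"
    using wA[OF torus_block_torus[OF E(1) i] ab] wA[OF D(1) ab] D(2) ab(1,2) abi by simp
  show ?thesis
  proof (rule block_matricesI)
    show "even_part m1 X \<in> matrices" using X by simp
    fix c d assume cd: "c < N" "d < N" and "even_part m1 X $$ (c, d) \<noteq> 0"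
    then have p: "c < m1 \<longleftrightarrow> d < m1" and Xcd: "X $$ (c, d) \<noteq> 0"
      using even_part_index[OF X(1) cd, of m1] by (auto split: if_splits)
    have "E $$ (c, c) \<noteq> 0 \<or> E $$ (d, d) \<noteq> 0"
      using wX[OF torus_block_torus[OF E(1) i] cd Xcd] nz by auto
    then have "c \<in> block_indices i \<or> d \<in> block_indices i"
      using block_matrices_entry[OF E(2) cd(1) cd(1)] block_matrices_entry[OF E(2) cd(2) cd(2)] by blast
    then show "c \<in> block_indices i \<and> d \<in> block_indices i" using p cd by (auto simp: mem_block_indices)
  qed
qed

section \<open>Homogeneous elements\<close>

text \<open>Homogeneous matrices in terms of their entries; every positive number stands for odd parity.\<close>

definition has_parity :: "nat \<Rightarrow> complex mat \<Rightarrow> bool" where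
  "has_parity i X \<longleftrightarrow> (\<forall>a<N. \<forall>b<N. X $$ (a, b) \<noteq> 0 \<longrightarrow> ((a < m1) = (b < m1)) = (i = 0))"

lemma has_parityD:
  "has_parity i X \<Longrightarrow> a < N \<Longrightarrow> b < N \<Longrightarrow> X $$ (a, b) \<noteq> 0 \<Longrightarrow> ((a < m1) = (b < m1)) = (i = 0)"
  by (simp add: has_parity_def)

lemma has_parity_iff:
  assumes X: "X \<in> carrier_mat N N"
  shows "(if i = 0 then odd_part m1 X else even_part m1 X) = mzero \<longleftrightarrow> has_parity i X"
proof
  assume *: "(if i = 0 then odd_part m1 X else even_part m1 X) = mzero"
  show "has_parity i X"
    unfolding has_parity_def
  proof (intro allI impI)
    fix a b assume ab: "a < N" "b < N" "X $$ (a, b) \<noteq> 0"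
    show "((a < m1) = (b < m1)) = (i = 0)"
      using arg_cong[OF *, of "\<lambda>M. M $$ (a, b)"] ab odd_part_index[OF X ab(1,2), of m1] even_part_index[OF X ab(1,2), of m1]
      by (auto split: if_splits)
  qed
next
  assume *: "has_parity i X"
  show "(if i = 0 then odd_part m1 X else even_part m1 X) = mzero"
    by (rule square_mat_eqI[where n = N])
      (use X * in \<open>auto simp: odd_part_index[OF X] even_part_index[OF X] has_parity_def\<close>)
qed

lemma mem_homog_L:
  "(f, r, s) \<in> homog L i \<longleftrightarrow> (f, r, s) \<in> carrier L \<and>
    (\<forall>b. \<exists>Y\<in>matrices. has_parity i Y \<and> f b = cls Y) \<and> (i \<noteq> 0 \<longrightarrow> r = 0 \<and> s = 0)"
proof -
  have "f b \<in> homog fin_alg i \<longleftrightarrow> (\<exists>Y\<in>matrices. has_parity i Y \<and> f b = cls Y)" for b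
    unfolding homog_fin_alg using has_parity_iff[OF matrices_carrier] by blast
  then show ?thesis by (simp add: L_simps)
qed

lemma loop_homogI:
  "loop Y r s \<in> carrier L \<Longrightarrow> (\<And>b. Y b \<in> matrices) \<Longrightarrow> (\<And>b. has_parity i (Y b)) \<Longrightarrow> (i \<noteq> 0 \<Longrightarrow> r = 0 \<and> s = 0)
    \<Longrightarrow> loop Y r s \<in> homog L i"
  unfolding loop_def mem_homog_L by blast

lemma homog_L_loop:
  assumes "y \<in> homog L i"
  shows "\<exists>Y r s. y = loop Y r s \<and> loop Y r s \<in> carrier L \<and> (\<forall>b. Y b \<in> matrices) \<and> (\<forall>b. has_parity i (Y b)) \<and>
    (i \<noteq> 0 \<longrightarrow> r = 0 \<and> s = 0)"
proof -
  obtain f r s where y: "y = (f, r, s)" by (cases y)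
  have *: "(f, r, s) \<in> carrier L" "\<forall>b. \<exists>Y\<in>matrices. has_parity i Y \<and> f b = cls Y" "i \<noteq> 0 \<longrightarrow> r = 0 \<and> s = 0"
    using assms unfolding y mem_homog_L by auto
  then obtain Y where Y: "\<And>b. Y b \<in> matrices" "\<And>b. has_parity i (Y b)" "\<And>b. f b = cls (Y b)" by metis
  then have "y = loop Y r s" using y by (simp add: loop_def fun_eq_iff)
  then show ?thesis using * Y y by metis
qed

lemma homog_L_carrier: "y \<in> homog L i \<Longrightarrow> y \<in> carrier L"
  using homog_L_loop by blast

lemma has_parity_zero: "has_parity i mzero"
  by (simp add: has_parity_def)

lemma has_parity_even_part: "X \<in> carrier_mat N N \<Longrightarrow> has_parity 0 (even_part m1 X)"
  by (simp add: has_parity_def even_part_index[of _ N])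

lemma has_parity_odd_part: "X \<in> carrier_mat N N \<Longrightarrow> has_parity 1 (odd_part m1 X)"
  by (simp add: has_parity_def odd_part_index[of _ N])

lemma has_parity_block: "X \<in> block_matrices a \<Longrightarrow> has_parity 0 X"
  using has_parity_even_part[of X] by (simp add: block_matrices_even)

lemma monomial_homog:
  assumes "X \<in> matrices" "sigma_matrix X = zpow m \<cdot>\<^sub>m X" "has_parity i X"
  shows "monomial m X \<in> homog L i"
  using monomial_carrier[OF assms(1,2)] assms(1,3) unfolding monomial_def
  by (intro loop_homogI) (auto simp: single_def has_parity_zero)

lemma cartan_homog:
  assumes D: "D \<in> torus"
  shows "cartan D r s \<in> homog L 0"
proof -
  have "has_parity 0 D" using torus_entry[OF D] by (auto simp: has_parity_def)
  then show ?thesis using cartan_carrier[OF D] torus_matrices[OF D] unfolding cartan_def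
    by (intro loop_homogI) (auto simp: single_def has_parity_zero)
qed

lemma cls_parts:
  assumes eq: "cls X = cls Y" and X: "X \<in> matrices" and Y: "Y \<in> matrices"
  shows "cls (even_part m1 X) = cls (even_part m1 Y)" "cls (odd_part m1 X) = cls (odd_part m1 Y)"
proof -
  obtain c where c: "c \<noteq> 0 \<longrightarrow> scalar_quotient" "X = Y + c \<cdot>\<^sub>m 1\<^sub>m N"
    using eq cls_eq_iff[OF X Y] by (auto simp: congr_iff)
  have XN: "X \<in> carrier_mat N N" and YN: "Y \<in> carrier_mat N N" using X Y by simp_all
  have xe: "X $$ (i, j) = Y $$ (i, j) + (if i = j then c else 0)" if "i < N" "j < N" for i j
    unfolding c(2) by (rule add_scalar_index[OF YN that])
  have e: "even_part m1 X = even_part m1 Y + c \<cdot>\<^sub>m 1\<^sub>m N"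
  proof (rule square_mat_eqI[where n = N])
    fix i j assume ij: "i < N" "j < N"
    show "even_part m1 X $$ (i, j) = (even_part m1 Y + c \<cdot>\<^sub>m 1\<^sub>m N) $$ (i, j)"
      unfolding add_scalar_index[OF even_part_carrier[OF YN] ij] even_part_index[OF XN ij] even_part_index[OF YN ij] xe[OF ij]
      by simp
  qed (use XN in simp_all)
  show "cls (even_part m1 X) = cls (even_part m1 Y)"
    by (rule cls_eqI, rule congrI[OF matrices_even_part[OF X] matrices_even_part[OF Y] c(1) e])
  have "odd_part m1 X = odd_part m1 Y"
  proof (rule square_mat_eqI[where n = N])
    fix i j assume ij: "i < N" "j < N"
    show "odd_part m1 X $$ (i, j) = odd_part m1 Y $$ (i, j)"
      unfolding odd_part_index[OF XN ij] odd_part_index[OF YN ij] xe[OF ij] by auto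
  qed (use XN YN in simp_all)
  then show "cls (odd_part m1 X) = cls (odd_part m1 Y)" by simp
qed

lemma carrier_L_homog_decomposition:
  assumes y: "y \<in> carrier L"
  shows "\<exists>y0\<in>homog L 0. \<exists>y1\<in>homog L 1. y = y0 \<oplus>\<^bsub>L\<^esub> y1"
proof -
  obtain Y r s where Y: "\<And>b. Y b \<in> matrices" and ye: "y = loop Y r s"
    and fin: "finite {b. cls (Y b) \<noteq> cls mzero}" and sY: "\<And>b. cls (sigma_matrix (Y b)) = cls (zpow b \<cdot>\<^sub>m Y b)"
    using carrier_loop[OF y] by blast
  have YN: "\<And>b. Y b \<in> carrier_mat N N" using Y by simp
  have zp: "even_part m1 mzero = mzero" "odd_part m1 mzero = mzero"
    by (rule square_mat_eqI[where n = N]; simp add: even_part_index[of _ N] odd_part_index[of _ N])+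
  have "{b. cls (even_part m1 (Y b)) \<noteq> cls mzero} \<subseteq> {b. cls (Y b) \<noteq> cls mzero}"
    "{b. cls (odd_part m1 (Y b)) \<noteq> cls mzero} \<subseteq> {b. cls (Y b) \<noteq> cls mzero}"
    using cls_parts[OF _ Y matrices_zero] zp by auto
  then have f: "finite {b. cls (even_part m1 (Y b)) \<noteq> cls mzero}" "finite {b. cls (odd_part m1 (Y b)) \<noteq> cls mzero}"
    using fin finite_subset by blast+
  have "loop (\<lambda>b. even_part m1 (Y b)) r s \<in> carrier L"
    using f(1) cls_parts(1)[OF sY matrices_sigma_matrix[OF Y] matrices_smult[OF Y]] Y YN
    by (subst loop_carrier_iff) (auto simp: sigma_matrix_even_part even_part_smult)
  then have 1: "loop (\<lambda>b. even_part m1 (Y b)) r s \<in> homog L 0"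
    by (rule loop_homogI) (use Y YN has_parity_even_part in auto)
  have "loop (\<lambda>b. odd_part m1 (Y b)) 0 0 \<in> carrier L"
    using f(2) cls_parts(2)[OF sY matrices_sigma_matrix[OF Y] matrices_smult[OF Y]] Y YN
    by (subst loop_carrier_iff) (auto simp: sigma_matrix_odd_part odd_part_smult)
  then have 2: "loop (\<lambda>b. odd_part m1 (Y b)) 0 0 \<in> homog L 1"
    by (rule loop_homogI) (use Y YN has_parity_odd_part in auto)
  have "y = loop (\<lambda>b. even_part m1 (Y b)) r s \<oplus>\<^bsub>L\<^esub> loop (\<lambda>b. odd_part m1 (Y b)) 0 0"
    unfolding ye using Y YN by (subst loop_add) (simp_all add: even_plus_odd)
  then show ?thesis using 1 2 by blast
qed

section \<open>Nilpotency of the adjoint action and sl(2) triples\<close>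

lemma superbracket_smult:
  assumes "X \<in> carrier_mat N N" "Y \<in> carrier_mat N N"
  shows "superbracket m1 (a \<cdot>\<^sub>m X) (b \<cdot>\<^sub>m Y) = (a * b) \<cdot>\<^sub>m superbracket m1 X Y"
proof (rule square_mat_eqI[where n = N])
  have c: "a \<cdot>\<^sub>m X \<in> carrier_mat N N" "b \<cdot>\<^sub>m Y \<in> carrier_mat N N" "superbracket m1 X Y \<in> carrier_mat N N" using assms by simp_all
  fix i j assume ij: "i < N" "j < N"
  have "((a * b) \<cdot>\<^sub>m superbracket m1 X Y) $$ (i, j) = (a * b) * superbracket m1 X Y $$ (i, j)"
    using ij c(3) by simp
  then show "superbracket m1 (a \<cdot>\<^sub>m X) (b \<cdot>\<^sub>m Y) $$ (i, j) = ((a * b) \<cdot>\<^sub>m superbracket m1 X Y) $$ (i, j)"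
    unfolding superbracket_index[OF c(1,2) ij] superbracket_index[OF assms ij] sum_distrib_left
    by (simp only:) (rule sum.cong, use assms ij in \<open>simp_all add: algebra_simps\<close>)
qed (use assms in simp_all)

lemma monomial_bracket:
  assumes X: "X \<in> matrices" and Y: "\<And>b. Y b \<in> matrices"
  shows "monomial m X \<otimes>\<^bsub>L\<^esub> loop Y r s =
    loop (\<lambda>b. superbracket m1 X (Y (b - m)) + (- s * of_int b) \<cdot>\<^sub>m single m X b) (of_int m * supertrace m1 (X * Y (- m))) 0"
proof -
  have "superbracket m1 X (Y (b - m)) + (0 * of_int b) \<cdot>\<^sub>m Y b = superbracket m1 X (Y (b - m))" for b
    using X Y[of b] Y[of "b - m"] by (simp add: zero_smult_mat)
  then show ?thesis unfolding monomial_def using single_bracket[OF X, where Y = Y and m = m and r = 0 and s = 0 and r' = r and s' = s] Y by simp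
qed

lemma cls_sigma_superbracket:
  assumes "X \<in> matrices" "Y \<in> matrices" "sigma_matrix X = a \<cdot>\<^sub>m X" "cls (sigma_matrix Y) = cls (b \<cdot>\<^sub>m Y)"
  shows "cls (sigma_matrix (superbracket m1 X Y)) = cls ((a * b) \<cdot>\<^sub>m superbracket m1 X Y)"
proof -
  have "cls (sigma_matrix (superbracket m1 X Y)) = cls (a \<cdot>\<^sub>m X) \<otimes>\<^bsub>fin_alg\<^esub> cls (sigma_matrix Y)"
    using assms(1-3) by (simp add: sigma_matrix_superbracket)
  also have "\<dots> = cls (superbracket m1 (a \<cdot>\<^sub>m X) (b \<cdot>\<^sub>m Y))" using assms(1,2) by (simp add: assms(4))
  finally show ?thesis using assms(1,2) by (simp add: superbracket_smult)
qed

lemma monomial_bracket_carrier: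
  assumes X: "X \<in> matrices" and sX: "sigma_matrix X = zpow m \<cdot>\<^sub>m X" and y: "y \<in> carrier L"
  shows "monomial m X \<otimes>\<^bsub>L\<^esub> y \<in> carrier L"
proof -
  obtain Y r s where Y: "\<And>b. Y b \<in> matrices" and ye: "y = loop Y r s"
    and fin: "finite {b. cls (Y b) \<noteq> cls mzero}" and sY: "\<And>b. cls (sigma_matrix (Y b)) = cls (zpow b \<cdot>\<^sub>m Y b)"
    using carrier_loop[OF y] by blast
  let ?Z = "\<lambda>b. superbracket m1 X (Y (b - m)) + (- s * of_int b) \<cdot>\<^sub>m single m X b"
  have B: "superbracket m1 X (Y b) \<in> matrices" for b using X Y by simp
  have S: "c \<cdot>\<^sub>m single m X b \<in> matrices" for c b using X by simp
  have Z: "?Z b \<in> matrices" for b using B S by simp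
  have "cls (?Z b) = cls mzero" if "cls (Y (b - m)) = cls mzero" "b \<noteq> m" for b
  proof -
    have "cls (superbracket m1 X (Y (b - m))) = cls X \<otimes>\<^bsub>fin_alg\<^esub> cls mzero"
      using X Y by (simp add: that(1)[symmetric])
    then have "cls (superbracket m1 X (Y (b - m))) = cls mzero" using X by (simp add: superbracket_zero_right)
    then have "cls (superbracket m1 X (Y (b - m))) \<oplus>\<^bsub>fin_alg\<^esub> cls mzero = cls mzero \<oplus>\<^bsub>fin_alg\<^esub> cls mzero" by simp
    then show ?thesis using that(2) B[of "b - m"] by (simp add: single_def smult_zero_mat)
  qed
  note vanish = this
  have "{b. cls (?Z b) \<noteq> cls mzero} \<subseteq> insert m ((\<lambda>b. b + m) ` {b. cls (Y b) \<noteq> cls mzero})"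
  proof
    fix b assume "b \<in> {b. cls (?Z b) \<noteq> cls mzero}"
    then have "b = m \<or> cls (Y (b - m)) \<noteq> cls mzero" using vanish by blast
    then show "b \<in> insert m ((\<lambda>b. b + m) ` {b. cls (Y b) \<noteq> cls mzero})"
      by (elim disjE) (auto intro!: image_eqI[of _ _ "b - m"])
  qed
  then have f: "finite {b. cls (?Z b) \<noteq> cls mzero}" using fin by (meson finite_imageI finite_insert finite_subset)
  have "cls (sigma_matrix (?Z b)) = cls (zpow b \<cdot>\<^sub>m ?Z b)" for b
  proof -
    have 1: "cls (sigma_matrix (superbracket m1 X (Y (b - m)))) = cls (zpow b \<cdot>\<^sub>m superbracket m1 X (Y (b - m)))"
      using cls_sigma_superbracket[OF X Y sX sY, of "b - m"] zpow_add[of m "b - m"] by simp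
    have 2: "sigma_matrix ((- s * of_int b) \<cdot>\<^sub>m single m X b) = zpow b \<cdot>\<^sub>m ((- s * of_int b) \<cdot>\<^sub>m single m X b)"
      using X sX by (auto simp: single_def sigma_matrix_smult smult_smult_mat smult_zero_mat sigma_matrix_zero mult.commute)
    have "cls (sigma_matrix (?Z b)) = cls (sigma_matrix (superbracket m1 X (Y (b - m))))
        \<oplus>\<^bsub>fin_alg\<^esub> cls (sigma_matrix ((- s * of_int b) \<cdot>\<^sub>m single m X b))"
      using B S by (simp add: sigma_matrix_add)
    also have "\<dots> = cls (zpow b \<cdot>\<^sub>m superbracket m1 X (Y (b - m)) + zpow b \<cdot>\<^sub>m ((- s * of_int b) \<cdot>\<^sub>m single m X b))"
      unfolding 1 2 using B S by simp
    also have "zpow b \<cdot>\<^sub>m superbracket m1 X (Y (b - m)) + zpow b \<cdot>\<^sub>m ((- s * of_int b) \<cdot>\<^sub>m single m X b) = zpow b \<cdot>\<^sub>m ?Z b"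
      using matrices_carrier[OF B] matrices_carrier[OF S] by (intro add_smult_distrib_left_mat[symmetric])
    finally show ?thesis .
  qed
  then show ?thesis unfolding ye monomial_bracket[OF X Y] using f Z by (subst loop_carrier_iff) auto
qed

lemma supertrace_mult_parity:
  assumes X: "X \<in> carrier_mat N N" and Y: "Y \<in> carrier_mat N N" and "has_parity i X" "has_parity j Y" "(i = 0) \<noteq> (j = 0)"
  shows "supertrace m1 (X * Y) = 0"
  unfolding supertrace_mult[OF X Y]
proof (intro sum.neutral ballI)
  fix a assume a: "a \<in> {..<N}"
  have "X $$ (a, b) * Y $$ (b, a) = 0" if "b \<in> {..<N}" for b
  proof (rule ccontr)
    assume "X $$ (a, b) * Y $$ (b, a) \<noteq> 0"
    then have "X $$ (a, b) \<noteq> 0" "Y $$ (b, a) \<noteq> 0" by auto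
    then have "((a < m1) = (b < m1)) = (i = 0)" "((b < m1) = (a < m1)) = (j = 0)"
      using assms(3,4) a that unfolding has_parity_def by blast+
    then show False using assms(5) by blast
  qed
  then have "(\<Sum>b<N. X $$ (a, b) * Y $$ (b, a)) = 0" by (rule sum.neutral[OF ballI])
  then show "parity_sign a * (\<Sum>b<N. X $$ (a, b) * Y $$ (b, a)) = 0" by simp
qed

lemma superbracket_parity:
  assumes X: "X \<in> carrier_mat N N" and Y: "Y \<in> carrier_mat N N" and "has_parity i X" "has_parity j Y"
    and i: "i \<in> {0, 1}" and j: "j \<in> {0, 1}"
  shows "has_parity ((i + j) mod 2) (superbracket m1 X Y)"
  unfolding has_parity_def
proof (intro allI impI)
  fix a b assume ab: "a < N" "b < N" and nz: "superbracket m1 X Y $$ (a, b) \<noteq> 0"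
  obtain c where "c < N" "X $$ (a, c) * Y $$ (c, b) - bracket_sign m1 a c b * (Y $$ (a, c) * X $$ (c, b)) \<noteq> 0"
    using nz sum.not_neutral_contains_not_neutral unfolding superbracket_index[OF X Y ab] by blast
  then consider "X $$ (a, c) \<noteq> 0" "Y $$ (c, b) \<noteq> 0" | "Y $$ (a, c) \<noteq> 0" "X $$ (c, b) \<noteq> 0" by fastforce
  moreover have mod2: "(i + j) mod 2 = 0 \<longleftrightarrow> (i = 0) = (j = 0)" using i j by auto
  ultimately show "((a < m1) = (b < m1)) = ((i + j) mod 2 = 0)"
  proof cases
    case 1
    have "((a < m1) = (c < m1)) = (i = 0)" using assms(3) ab(1) \<open>c < N\<close> 1(1) by (simp add: has_parity_def)
    moreover have "((c < m1) = (b < m1)) = (j = 0)" using assms(4) ab(2) \<open>c < N\<close> 1(2) by (simp add: has_parity_def)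
    ultimately show ?thesis unfolding mod2 by argo
  next
    case 2
    have "((a < m1) = (c < m1)) = (j = 0)" using assms(4) ab(1) \<open>c < N\<close> 2(1) by (simp add: has_parity_def)
    moreover have "((c < m1) = (b < m1)) = (i = 0)" using assms(3) ab(2) \<open>c < N\<close> 2(2) by (simp add: has_parity_def)
    ultimately show ?thesis unfolding mod2 by argo
  qed
qed

lemma monomial_bracket_homog:
  assumes X: "X \<in> matrices" and sX: "sigma_matrix X = zpow m \<cdot>\<^sub>m X" and p: "has_parity i X"
    and i: "i \<in> {0, 1}" and j: "j \<in> {0, 1}" and y: "y \<in> homog L j"
  shows "monomial m X \<otimes>\<^bsub>L\<^esub> y \<in> homog L ((i + j) mod 2)"
proof -
  obtain Y r s where Y: "\<And>b. Y b \<in> matrices" and ye: "y = loop Y r s" and pY: "\<And>b. has_parity j (Y b)"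
    and rs: "j \<noteq> 0 \<longrightarrow> r = 0 \<and> s = 0"
    using homog_L_loop[OF y] by blast
  let ?Z = "\<lambda>b. superbracket m1 X (Y (b - m)) + (- s * of_int b) \<cdot>\<^sub>m single m X b"
  have "loop ?Z (of_int m * supertrace m1 (X * Y (- m))) 0 \<in> homog L ((i + j) mod 2)"
  proof (rule loop_homogI)
    show "loop ?Z (of_int m * supertrace m1 (X * Y (- m))) 0 \<in> carrier L"
      using monomial_bracket_carrier[OF X sX homog_L_carrier[OF y]] unfolding ye monomial_bracket[OF X Y] .
    show "?Z b \<in> matrices" for b using X Y by simp
    show "has_parity ((i + j) mod 2) (?Z b)" for b
    proof -
      have 1: "has_parity ((i + j) mod 2) (superbracket m1 X (Y (b - m)))"
        using superbracket_parity[OF _ _ p pY i j] X Y by simp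
      have sc: "superbracket m1 X (Y (b - m)) \<in> carrier_mat N N" "single m X b \<in> carrier_mat N N"
        using X Y[of "b - m"] by simp_all
      show ?thesis
      proof (cases "s = 0")
        case True
        then show ?thesis using 1 sc by (simp add: zero_smult_mat)
      next
        case False
        then have "j = 0" using rs by blast
        then have "has_parity ((i + j) mod 2) (single m X b)" using p i by (auto simp: single_def has_parity_zero)
        then have 2: "has_parity ((i + j) mod 2) (single m X b)" .
        show ?thesis
          unfolding has_parity_def
        proof (intro allI impI)
          fix c d assume cd: "c < N" "d < N" and nz: "?Z b $$ (c, d) \<noteq> 0"
          have "?Z b $$ (c, d) = superbracket m1 X (Y (b - m)) $$ (c, d) + (- s * of_int b) * single m X b $$ (c, d)"
            using cd sc by simp
          then have "superbracket m1 X (Y (b - m)) $$ (c, d) \<noteq> 0 \<or> single m X b $$ (c, d) \<noteq> 0" using nz by auto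
          then show "((c < m1) = (d < m1)) = ((i + j) mod 2 = 0)"
            by (elim disjE) (rule has_parityD[OF 1 cd], assumption, rule has_parityD[OF 2 cd], assumption)
        qed
      qed
    qed
    assume "(i + j) mod 2 \<noteq> 0"
    then have "(i = 0) \<noteq> (j = 0)" using i j by auto
    then show "of_int m * supertrace m1 (X * Y (- m)) = 0 \<and> (0::complex) = 0"
      using supertrace_mult_parity[OF _ _ p pY] X Y by simp
  qed
  then show ?thesis unfolding ye monomial_bracket[OF X Y] .
qed

text \<open>Choose \<open>D\<close> in the torus with nonzero value \<open>w\<close> of the root. An application of the adjoint map adds \<open>w\<close>
to the weights of \<open>D\<close> that occur, and there are finitely many differences of entries of \<open>D\<close>; so all
matrix coefficients vanish eventually. The first application removes the component along \<open>d\<close> and the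
last one the component along \<open>c\<close>.\<close>

lemma ad_monomial_nilpotent:
  assumes rv: "root_vector \<beta> m X" and fin: "finite_part_nonzero \<beta>" and y: "y \<in> carrier L"
  shows "\<exists>n. ((\<lambda>y. monomial m X \<otimes>\<^bsub>L\<^esub> y) ^^ n) y = \<zero>\<^bsub>L\<^esub>"
proof -
  have X: "X \<in> matrices" "X \<in> carrier_mat N N" using rv by (auto simp: root_vector_def)
  obtain D where D: "D \<in> torus" "\<beta> (cartan D 0 0) \<noteq> 0" using fin by (auto simp: finite_part_nonzero_def)
  define w where "w = \<beta> (cartan D 0 0)"
  have w: "w \<noteq> 0" using D by (simp add: w_def)
  have wX: "D $$ (a, a) - D $$ (b, b) = w" if "a < N" "b < N" "X $$ (a, b) \<noteq> 0" for a b
    using rv D(1) that unfolding root_vector_def has_weight_iff[OF X(2)] w_def by blast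
  define \<Delta> where "\<Delta> = (\<lambda>(a, b). D $$ (a, a) - D $$ (b, b)) ` ({..<N} \<times> {..<N})"
  have fin\<Delta>: "finite \<Delta>" by (simp add: \<Delta>_def)
  define ad where "ad = (\<lambda>y. monomial m X \<otimes>\<^bsub>L\<^esub> y)"
  obtain Y r s where Y: "\<And>b. Y b \<in> matrices" "y = loop Y r s" using carrier_loop[OF y] by blast
  define Z where "Z = (\<lambda>b. superbracket m1 X (Y (b - m)) + (- s * of_int b) \<cdot>\<^sub>m single m X b)"
  have Z: "ad y = loop Z (of_int m * supertrace m1 (X * Y (- m))) 0"
    unfolding ad_def Y(2) Z_def by (rule monomial_bracket[OF X(1) Y(1)])
  have ZM: "\<And>b. Z b \<in> matrices" unfolding Z_def using X(1) Y(1) by simp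
  have it: "\<exists>Z r. (ad ^^ p) (ad y) = loop Z r 0 \<and> (\<forall>b. Z b \<in> matrices) \<and>
      (\<forall>b. \<forall>i<N. \<forall>j<N. Z b $$ (i, j) \<noteq> 0 \<longrightarrow> (\<exists>\<delta>\<in>\<Delta>. D $$ (i, i) - D $$ (j, j) = \<delta> + of_nat p * w))" for p
  proof (induction p)
    case 0
    have "\<exists>\<delta>\<in>\<Delta>. D $$ (i, i) - D $$ (j, j) = \<delta> + of_nat 0 * w" if "i < N" "j < N" for i j
      using that by (auto simp: \<Delta>_def)
    then show ?case using Z ZM by (intro exI[of _ Z] exI conjI) auto
  next
    case (Suc p)
    then obtain Z r where IH: "(ad ^^ p) (ad y) = loop Z r 0" "\<And>b. Z b \<in> matrices"
      "\<And>b i j. i < N \<Longrightarrow> j < N \<Longrightarrow> Z b $$ (i, j) \<noteq> 0 \<Longrightarrow> \<exists>\<delta>\<in>\<Delta>. D $$ (i, i) - D $$ (j, j) = \<delta> + of_nat p * w"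
      by blast
    let ?Z = "\<lambda>b. superbracket m1 X (Z (b - m))"
    have "(ad ^^ Suc p) (ad y) = ad (loop Z r 0)" using IH(1) by simp
    also have "\<dots> = loop ?Z (of_int m * supertrace m1 (X * Z (- m))) 0"
    proof -
      have "superbracket m1 X (Z (b - m)) + (- 0 * of_int b) \<cdot>\<^sub>m single m X b = superbracket m1 X (Z (b - m))" for b
        using X IH(2)[of "b - m"] zero_smult_mat[OF matrices_carrier[OF single_matrices[OF X(1)]]] by simp
      then show ?thesis unfolding ad_def monomial_bracket[OF X(1) IH(2)] by simp
    qed
    finally have e: "(ad ^^ Suc p) (ad y) = loop ?Z (of_int m * supertrace m1 (X * Z (- m))) 0" .
    have "\<exists>\<delta>\<in>\<Delta>. D $$ (i, i) - D $$ (j, j) = \<delta> + of_nat (Suc p) * w"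
      if ij: "i < N" "j < N" and nz: "?Z b $$ (i, j) \<noteq> 0" for b i j
    proof -
      obtain c where c: "c < N" "X $$ (i, c) * Z (b - m) $$ (c, j) - bracket_sign m1 i c j * (Z (b - m) $$ (i, c) * X $$ (c, j)) \<noteq> 0"
        using nz sum.not_neutral_contains_not_neutral
        unfolding superbracket_index[OF X(2) matrices_carrier[OF IH(2)] ij] by blast
      then consider "X $$ (i, c) \<noteq> 0" "Z (b - m) $$ (c, j) \<noteq> 0" | "Z (b - m) $$ (i, c) \<noteq> 0" "X $$ (c, j) \<noteq> 0" by fastforce
      then show ?thesis
      proof cases
        case 1
        then obtain \<delta> where "\<delta> \<in> \<Delta>" "D $$ (c, c) - D $$ (j, j) = \<delta> + of_nat p * w" using IH(3) c(1) ij by blast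
        moreover have "D $$ (i, i) - D $$ (c, c) = w" using wX 1 c(1) ij by blast
        ultimately show ?thesis by (intro bexI[of _ \<delta>]) (simp_all add: algebra_simps)
      next
        case 2
        then obtain \<delta> where "\<delta> \<in> \<Delta>" "D $$ (i, i) - D $$ (c, c) = \<delta> + of_nat p * w" using IH(3) c(1) ij by blast
        moreover have "D $$ (c, c) - D $$ (j, j) = w" using wX 2 c(1) ij by blast
        ultimately show ?thesis by (intro bexI[of _ \<delta>]) (simp_all add: algebra_simps)
      qed
    qed
    then show ?case using e X(1) IH(2) by (intro exI[of _ ?Z] exI conjI) auto
  qed
  have "finite ((\<lambda>(\<delta>, \<delta>'). (\<delta> - \<delta>') / w) ` (\<Delta> \<times> \<Delta>))" using fin\<Delta> by simp
  moreover have "infinite (range (of_nat :: nat \<Rightarrow> complex))"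
    using range_inj_infinite[of "of_nat :: nat \<Rightarrow> complex"] by (simp add: inj_def)
  ultimately obtain p :: nat where p: "(of_nat p :: complex) \<notin> (\<lambda>(\<delta>, \<delta>'). (\<delta> - \<delta>') / w) ` (\<Delta> \<times> \<Delta>)"
    by (meson finite_subset image_subsetI)
  obtain Z r where Zp: "(ad ^^ p) (ad y) = loop Z r 0" "\<And>b. Z b \<in> matrices"
      "\<And>b i j. i < N \<Longrightarrow> j < N \<Longrightarrow> Z b $$ (i, j) \<noteq> 0 \<Longrightarrow> \<exists>\<delta>\<in>\<Delta>. D $$ (i, i) - D $$ (j, j) = \<delta> + of_nat p * w"
    using it[of p] by blast
  have "Z b = mzero" for b
  proof (rule square_mat_eqI[OF matrices_carrier[OF Zp(2)] zero_carrier_mat])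
    fix i j assume ij: "i < N" "j < N"
    have "Z b $$ (i, j) = 0"
    proof (rule ccontr)
      assume "Z b $$ (i, j) \<noteq> 0"
      then obtain \<delta> where \<delta>: "\<delta> \<in> \<Delta>" "D $$ (i, i) - D $$ (j, j) = \<delta> + of_nat p * w" using Zp(3) ij by blast
      have "D $$ (i, i) - D $$ (j, j) \<in> \<Delta>" using ij by (auto simp: \<Delta>_def)
      moreover have "of_nat p = (D $$ (i, i) - D $$ (j, j) - \<delta>) / w" using \<delta>(2) w by simp
      ultimately show False using p \<delta>(1) by force
    qed
    then show "Z b $$ (i, j) = mzero $$ (i, j)" using ij by simp
  qed
  then have Z0: "Z = (\<lambda>_. mzero)" by blast
  have "ad (loop Z r 0) = \<zero>\<^bsub>L\<^esub>"
  proof -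
    have "supertrace m1 (X * mzero) = 0"
      using supertrace_mult_torus[OF X(2) torus_zero] by simp
    then show ?thesis
      unfolding Z0 ad_def monomial_bracket[OF X(1) matrices_zero] zero_L loop_eq_iff
      using X(2) by (auto simp: superbracket_zero_right single_def smult_zero_mat zero_smult_mat)
  qed
  then have "(ad ^^ Suc p) (ad y) = \<zero>\<^bsub>L\<^esub>" using Zp(1) by simp
  then have "(ad ^^ Suc (Suc p)) y = \<zero>\<^bsub>L\<^esub>" by (simp only: funpow_Suc_right comp_apply)
  then show ?thesis unfolding ad_def by blast
qed

lemma monomial_conj_transpose_bracket:
  assumes X: "X \<in> block_matrices i"
  shows "monomial m X \<otimes>\<^bsub>L\<^esub> monomial (- m) (conj_transpose X) = cartan (coroot X) (of_int m * norm_form X) 0"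
proof -
  have X': "X \<in> matrices" "conj_transpose X \<in> matrices" "X \<in> carrier_mat N N"
    using X block_matrices_matrices[OF X] block_matrices_matrices[OF block_matrices_conj_transpose[OF X]] by auto
  have "superbracket m1 X (single (- m) (conj_transpose X) (b - m)) + (- 0 * of_int b) \<cdot>\<^sub>m single m X b = single 0 (coroot X) b" for b
    using X' zero_smult_mat[OF matrices_carrier[OF single_matrices[OF X'(1)]]]
    by (auto simp: single_def coroot_def superbracket_zero_right zero_smult_mat smult_zero_mat)
  then have "monomial m X \<otimes>\<^bsub>L\<^esub> monomial (- m) (conj_transpose X) =
     loop (single 0 (coroot X)) (of_int m * supertrace m1 (X * single (- m) (conj_transpose X) (- m))) 0"
    using monomial_bracket[OF X'(1), of "single (- m) (conj_transpose X)" m 0 0] X'(2) by (simp add: monomial_def)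
  moreover have "supertrace m1 (X * single (- m) (conj_transpose X) (- m)) = norm_form X"
    by (simp add: single_def norm_form_def)
  ultimately show ?thesis by (simp add: cartan_def)
qed

end

section \<open>Root vectors acting on the module\<close>

lemma internal_direct_sum_parity:
  fixes scale :: "complex \<Rightarrow> 'v::ab_group_add \<Rightarrow> 'v"
  assumes dir: "internal_direct_sum {0, 1} V" and vs: "vector_space scale"
    and sub: "\<And>i. i \<in> {0, 1::nat} \<Longrightarrow> Modules.module.subspace scale (V i)"
  shows "\<exists>v0\<in>V 0. \<exists>v1\<in>V 1. v = v0 + v1"
    and "a \<in> V 0 \<Longrightarrow> b \<in> V 1 \<Longrightarrow> a + b = 0 \<Longrightarrow> a = 0 \<and> b = 0"
proof -
  interpret vector_space scale by (rule vs)
  have z: "0 \<in> V 0" "0 \<in> V 1" using sub subspace_0 by auto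
  have sum2: "(\<Sum>i | u i \<noteq> 0. u i) = u 0 + u 1" if "\<forall>i. i \<notin> {0, 1} \<longrightarrow> u i = 0" for u :: "nat \<Rightarrow> 'v"
  proof -
    have "(\<Sum>i | u i \<noteq> 0. u i) = (\<Sum>i\<in>{0, 1}. u i)"
      by (rule sum.mono_neutral_left) (use that in auto)
    then show ?thesis by simp
  qed
  obtain u where u: "\<forall>i. if i \<in> {0, 1} then u i \<in> V i else u i = 0" "v = (\<Sum>i | u i \<noteq> 0. u i)"
    using dir unfolding internal_direct_sum_def by blast
  have "v = u 0 + u 1" using u sum2[of u] by auto
  moreover have "u 0 \<in> V 0" "u 1 \<in> V 1" using u(1)[rule_format, of 0] u(1)[rule_format, of 1] by auto
  ultimately show "\<exists>v0\<in>V 0. \<exists>v1\<in>V 1. v = v0 + v1" by blast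
  show "a = 0 \<and> b = 0" if ab: "a \<in> V 0" "b \<in> V 1" "a + b = 0"
  proof -
    define P where "P = (\<lambda>u. (\<forall>i. if i \<in> {0, 1} then u i \<in> V i else u i = 0) \<and> finite {i. u i \<noteq> 0} \<and> 0 = (\<Sum>i | u i \<noteq> 0. u i))"
    define u where "u = (\<lambda>i::nat. if i = 0 then a else if i = 1 then b else 0)"
    have "{i. u i \<noteq> 0} \<subseteq> {0, 1}" by (auto simp: u_def split: if_splits)
    then have "finite {i. u i \<noteq> 0}" by (rule finite_subset) simp
    moreover have "(\<Sum>i | u i \<noteq> 0. u i) = 0" using sum2[of u] ab(3) by (simp add: u_def)
    moreover have "\<forall>i. if i \<in> {0, 1} then u i \<in> V i else u i = 0" using ab(1,2) by (auto simp: u_def)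
    ultimately have "P u" by (simp add: P_def)
    moreover have "P (\<lambda>_. 0)" using z by (auto simp: P_def)
    moreover have "\<exists>!u. P u" using dir[unfolded internal_direct_sum_def, rule_format, of 0] unfolding P_def .
    ultimately have "u = (\<lambda>_. 0)" by blast
    then have "u 0 = 0" "u 1 = 0" by simp_all
    then show ?thesis by (simp add: u_def)
  qed
qed

locale irreducible_finite_weight_module = twisted_affine_setting T k l \<zeta> + vector_space scale
  for T :: twisted_type and k l :: nat and \<zeta> :: complex
    and scale :: "complex \<Rightarrow> 'v::ab_group_add \<Rightarrow> 'v" +
  fixes V :: "nat \<Rightarrow> 'v set" and act :: "complex mat set affine \<Rightarrow> 'v \<Rightarrow> 'v"
  assumes irreducible: "irreducible_lie_supermodule L scale V act"
    and finite_weight: "finite_weight_module scale act"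
begin

lemma supermodule: "lie_supermodule L scale V act"
  using irreducible by (simp add: irreducible_lie_supermodule_def)

lemma act_linear: "x \<in> carrier L \<Longrightarrow> Vector_Spaces.linear scale scale (act x)"
  using supermodule by (simp add: lie_supermodule_def)

lemma act_add: "x \<in> carrier L \<Longrightarrow> act x (u + v) = act x u + act x v"
proof -
  assume "x \<in> carrier L"
  then interpret f: Vector_Spaces.linear scale scale "act x" by (rule act_linear)
  show ?thesis by (rule f.add)
qed

lemma act_scale: "x \<in> carrier L \<Longrightarrow> act x (scale c v) = scale c (act x v)"
  using act_linear[of x] by (simp add: module_hom.scale Vector_Spaces.linear_def)

lemma act_0 [simp]: "x \<in> carrier L \<Longrightarrow> act x 0 = 0"
  using act_scale[of x 0 0] by simp

lemma act_sum: "x \<in> carrier L \<Longrightarrow> y \<in> carrier L \<Longrightarrow> act (x \<oplus>\<^bsub>L\<^esub> y) v = act x v + act y v"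
  using supermodule by (simp add: lie_supermodule_def)

lemma act_smult: "x \<in> carrier L \<Longrightarrow> act (c \<odot>\<^bsub>L\<^esub> x) v = scale c (act x v)"
  using supermodule by (simp add: lie_supermodule_def)

lemma act_parity: "x \<in> homog L i \<Longrightarrow> v \<in> V j \<Longrightarrow> i \<in> {0, 1} \<Longrightarrow> j \<in> {0, 1} \<Longrightarrow> act x v \<in> V ((i + j) mod 2)"
  using supermodule unfolding lie_supermodule_def by blast

lemma act_bracket:
  "x \<in> homog L i \<Longrightarrow> y \<in> homog L j \<Longrightarrow> i \<in> {0, 1} \<Longrightarrow> j \<in> {0, 1} \<Longrightarrow>
    act (x \<otimes>\<^bsub>L\<^esub> y) v = act x (act y v) - scale ((-1) ^ (i * j)) (act y (act x v))"
  using supermodule unfolding lie_supermodule_def by blast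

lemma act_zero: "act \<zero>\<^bsub>L\<^esub> v = 0"
proof -
  have c: "\<zero>\<^bsub>L\<^esub> \<in> carrier L" using zero_root_space by (simp add: root_space_def)
  have "0 \<odot>\<^bsub>L\<^esub> \<zero>\<^bsub>L\<^esub> = \<zero>\<^bsub>L\<^esub>"
    unfolding zero_L by (subst loop_smult) (simp_all add: smult_zero_mat)
  then show ?thesis using act_smult[OF c, of 0 v] by simp
qed

lemma parity_subspace: "i \<in> {0, 1} \<Longrightarrow> subspace (V i)"
  using supermodule unfolding lie_supermodule_def by blast

lemma parity_direct: "internal_direct_sum {0, 1} V"
  using supermodule unfolding lie_supermodule_def by blast

lemmas parity_decomposition = internal_direct_sum_parity(1)[OF parity_direct vector_space_axioms parity_subspace]
lemmas parity_independent = internal_direct_sum_parity(2)[OF parity_direct vector_space_axioms parity_subspace]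

lemma act_pow_add: "x \<in> carrier L \<Longrightarrow> (act x ^^ n) (u + v) = (act x ^^ n) u + (act x ^^ n) v"
  by (induction n) (simp_all add: act_add)

lemma act_pow_scale: "x \<in> carrier L \<Longrightarrow> (act x ^^ n) (scale c v) = scale c ((act x ^^ n) v)"
  by (induction n) (simp_all add: act_scale)

lemma act_pow_0: "x \<in> carrier L \<Longrightarrow> (act x ^^ n) 0 = 0"
  by (induction n) simp_all

lemma act_pow_monomial:
  assumes "x \<in> carrier L" "(act x ^^ n) v = 0" "n \<le> m"
  shows "(act x ^^ m) v = 0"
proof -
  have "(act x ^^ m) v = (act x ^^ (m - n)) ((act x ^^ n) v)"
    using assms(3) by (metis comp_apply funpow_add le_add_diff_inverse2)
  then show ?thesis using assms act_pow_0 by simp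
qed

text \<open>Moving one factor \<open>x\<close> past \<open>y\<close> produces the bracket \<open> [x, y] \<close>, which has used up one of \<open>n\<close> adjoint
steps, and a term in which \<open>x\<close> acts on \<open>v\<close>, which has used up one of \<open>p\<close> steps. This treats even
and odd root vectors alike.\<close>

lemma act_pow_vanish:
  assumes x: "x \<in> homog L i" "i \<in> {0, 1}"
    and ad: "\<And>j y. y \<in> homog L j \<Longrightarrow> j \<in> {0, 1} \<Longrightarrow> x \<otimes>\<^bsub>L\<^esub> y \<in> homog L ((i + j) mod 2)"
  shows "y \<in> homog L j \<Longrightarrow> j \<in> {0, 1} \<Longrightarrow> ((\<lambda>y. x \<otimes>\<^bsub>L\<^esub> y) ^^ n) y = \<zero>\<^bsub>L\<^esub> \<Longrightarrow> (act x ^^ p) v = 0 \<Longrightarrow>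
    (act x ^^ (n + p)) (act y v) = 0"
proof (induction "n + p" arbitrary: n p y j v)
  case 0
  then show ?case by (simp add: act_zero)
next
  case (Suc N)
  have xc: "x \<in> carrier L" and yc: "y \<in> carrier L" using x(1) Suc.prems(1) homog_L_carrier by auto
  consider "n = 0" | "p = 0" | n' p' where "n = Suc n'" "p = Suc p'" by (metis not0_implies_Suc)
  then show ?case
  proof cases
    case 1
    then show ?thesis using Suc.prems(3) act_pow_0[OF xc] by (simp add: act_zero)
  next
    case 2
    then show ?thesis using Suc.prems(4) yc act_pow_0[OF xc] by simp
  next
    case 3
    have N: "N = n' + p" "N = n + p'" using 3 Suc.hyps(2) by auto
    have eq: "act x (act y v) = act (x \<otimes>\<^bsub>L\<^esub> y) v + scale ((-1) ^ (i * j)) (act y (act x v))"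
      using act_bracket[OF x(1) Suc.prems(1) x(2) Suc.prems(2)] by simp
    have m2: "(i + j) mod 2 \<in> {0, 1}" by auto
    have 1: "(act x ^^ N) (act (x \<otimes>\<^bsub>L\<^esub> y) v) = 0"
      unfolding N(1)
      by (rule Suc.hyps(1)[OF N(1) ad[OF Suc.prems(1,2)] m2 _ Suc.prems(4)])
        (use Suc.prems(3) 3(1) in \<open>simp add: funpow_swap1\<close>)
    have 2: "(act x ^^ N) (act y (act x v)) = 0"
      unfolding N(2)
      by (rule Suc.hyps(1)[OF N(2) Suc.prems(1,2,3)])
        (use Suc.prems(4) 3(2) in \<open>simp add: funpow_swap1\<close>)
    have "(act x ^^ (n + p)) (act y v) = (act x ^^ N) (act x (act y v))"
      using Suc.hyps(2)[symmetric] by (simp add: funpow_swap1)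
    also have "\<dots> = 0" unfolding eq act_pow_add[OF xc] act_pow_scale[OF xc] 1 2 by simp
    finally show ?thesis .
  qed
qed

lemma root_vector_homog:
  assumes "root_vector \<beta> m X" "has_parity i X"
  shows "monomial m X \<in> homog L i"
  using assms by (intro monomial_homog) (auto simp: root_vector_def)

lemma root_vector_carrier: "root_vector \<beta> m X \<Longrightarrow> monomial m X \<in> carrier L"
  by (rule monomial_carrier) (auto simp: root_vector_def)

text \<open>The vectors that some power of the root vector kills form a graded submodule, because the adjoint
action of the root vector is locally nilpotent. By irreducibility it is zero or everything.\<close>

lemma injective_or_locally_nilpotent:
  assumes rv: "root_vector \<beta> m X" and p: "has_parity i X" and i: "i \<in> {0, 1}" and fin: "finite_part_nonzero \<beta>"
  shows "inj (act (monomial m X)) \<or> (\<forall>v. \<exists>n. (act (monomial m X) ^^ n) v = 0)"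
proof -
  let ?x = "monomial m X"
  have x: "?x \<in> homog L i" by (rule root_vector_homog[OF rv p])
  have xc: "?x \<in> carrier L" by (rule root_vector_carrier[OF rv])
  have ad: "?x \<otimes>\<^bsub>L\<^esub> y \<in> homog L ((i + j) mod 2)" if "y \<in> homog L j" "j \<in> {0, 1}" for j y
    using monomial_bracket_homog[OF _ _ p i that(2,1)] rv by (simp add: root_vector_def)
  define W where "W = {v. \<exists>n. (act ?x ^^ n) v = 0}"
  have Wadd: "u + v \<in> W" if uv: "u \<in> W" "v \<in> W" for u v
  proof -
    obtain a b where "(act ?x ^^ a) u = 0" "(act ?x ^^ b) v = 0" using uv unfolding W_def by blast
    then have "(act ?x ^^ max a b) (u + v) = 0" by (simp add: act_pow_add[OF xc] act_pow_monomial[OF xc])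
    then show ?thesis by (auto simp: W_def)
  qed
  have sub: "subspace W"
  proof (rule subspaceI)
    show "0 \<in> W" using act_pow_0[OF xc] by (auto simp: W_def)
    show "scale c v \<in> W" if "v \<in> W" for c v using that by (auto simp: W_def act_pow_scale[OF xc])
  qed (rule Wadd)
  have pow_parity: "(act ?x ^^ n) v \<in> V ((i * n + j) mod 2)" if "v \<in> V j" "j \<in> {0, 1}" for n v j
  proof (induction n)
    case 0
    then show ?case using that by auto
  next
    case (Suc n)
    have "act ?x ((act ?x ^^ n) v) \<in> V ((i + (i * n + j) mod 2) mod 2)"
      by (rule act_parity[OF x Suc i]) auto
    moreover have "(i + (i * n + j) mod 2) mod 2 = (i * Suc n + j) mod 2"
      by (simp add: mod_add_right_eq algebra_simps)
    ultimately show ?case by simp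
  qed
  have graded: "\<exists>w0\<in>W \<inter> V 0. \<exists>w1\<in>W \<inter> V 1. w = w0 + w1" if w: "w \<in> W" for w
  proof -
    obtain w0 w1 where w01: "w0 \<in> V 0" "w1 \<in> V 1" "w = w0 + w1" using parity_decomposition by blast
    obtain n where n: "(act ?x ^^ n) w0 + (act ?x ^^ n) w1 = 0"
      using w w01(3) by (auto simp: W_def act_pow_add[OF xc])
    have a: "(act ?x ^^ n) w0 \<in> V ((i * n) mod 2)" "(act ?x ^^ n) w1 \<in> V ((i * n + 1) mod 2)"
      using pow_parity[OF w01(1), of n] pow_parity[OF w01(2), of n] by simp_all
    have "(act ?x ^^ n) w0 = 0 \<and> (act ?x ^^ n) w1 = 0"
    proof (cases "even (i * n)")
      case True
      then have "(i * n) mod 2 = 0" "(i * n + 1) mod 2 = 1" by presburger+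
      then show ?thesis using parity_independent[of "(act ?x ^^ n) w0" "(act ?x ^^ n) w1"] a n by simp
    next
      case False
      then have "(i * n) mod 2 = 1" "(i * n + 1) mod 2 = 0" by presburger+
      then show ?thesis using parity_independent[of "(act ?x ^^ n) w1" "(act ?x ^^ n) w0"] a n by (simp add: add.commute)
    qed
    then show ?thesis using w01 by (auto simp: W_def)
  qed
  have stable_homog: "act y w \<in> W" if y: "y \<in> homog L j" "j \<in> {0, 1}" and w: "w \<in> W" for y j w
  proof -
    obtain a where a: "(act ?x ^^ a) w = 0" using w by (auto simp: W_def)
    obtain n where n: "((\<lambda>y. ?x \<otimes>\<^bsub>L\<^esub> y) ^^ n) y = \<zero>\<^bsub>L\<^esub>"
      using ad_monomial_nilpotent[OF rv fin homog_L_carrier[OF y(1)]] by blast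
    show ?thesis using act_pow_vanish[OF x i ad y n a] by (auto simp: W_def)
  qed
  have stable: "act y w \<in> W" if y: "y \<in> carrier L" and w: "w \<in> W" for y w
  proof -
    obtain y0 y1 where y01: "y0 \<in> homog L 0" "y1 \<in> homog L 1" "y = y0 \<oplus>\<^bsub>L\<^esub> y1"
      using carrier_L_homog_decomposition[OF y] by blast
    then have "act y w = act y0 w + act y1 w" using act_sum homog_L_carrier by blast
    then show ?thesis using Wadd stable_homog[OF y01(1) _ w] stable_homog[OF y01(2) _ w] by simp
  qed
  have "lie_subsupermodule L scale V act W"
    unfolding lie_subsupermodule_def using sub graded stable by blast
  then have "W = {0} \<or> W = UNIV" using irreducible unfolding irreducible_lie_supermodule_def by blast
  then show ?thesis
  proof
    assume W0: "W = {0}"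
    have "u = v" if "act ?x u = act ?x v" for u v
    proof -
      have "act ?x (u + scale (- 1) v) = 0" unfolding act_add[OF xc] act_scale[OF xc] that by simp
      then have "(act ?x ^^ 1) (u + scale (- 1) v) = 0" by simp
      then have "u + scale (- 1) v \<in> W" unfolding W_def by blast
      then show ?thesis using W0 by simp
    qed
    then show ?thesis by (simp add: inj_def)
  qed (auto simp: W_def)
qed

definition supp :: "(complex mat set affine \<Rightarrow> complex) set" where
  "supp = {\<mu> \<in> h_dual. \<exists>v\<in>weight_space scale act \<mu>. v \<noteq> 0}"

lemma weight_space_finite: "\<mu> \<in> h_dual \<Longrightarrow> \<exists>B. finite B \<and> weight_space scale act \<mu> \<subseteq> span B"
  using finite_weight unfolding finite_weight_module_def by fastforce

lemma weight_decomposition: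
  "\<exists>u. finite {\<mu>. u \<mu> \<noteq> 0} \<and> (\<forall>\<mu>. u \<mu> \<noteq> 0 \<longrightarrow> \<mu> \<in> h_dual \<and> u \<mu> \<in> weight_space scale act \<mu>) \<and> v = (\<Sum>\<mu> | u \<mu> \<noteq> 0. u \<mu>)"
proof -
  have "internal_direct_sum h_dual (weight_space scale act)"
    using finite_weight by (simp add: finite_weight_module_def)
  then obtain u where "\<forall>i. if i \<in> h_dual then u i \<in> weight_space scale act i else u i = 0"
     "finite {i. u i \<noteq> 0}" "v = (\<Sum>i | u i \<noteq> 0. u i)"
    unfolding internal_direct_sum_def by blast
  then show ?thesis by (intro exI[of _ u]) (metis (no_types, lifting))
qed

lemma supp_nonempty: "\<exists>\<mu>. \<mu> \<in> supp"
proof (rule ccontr)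
  assume none: "\<nexists>\<mu>. \<mu> \<in> supp"
  have "v = 0" for v :: 'v
  proof -
    obtain u where u: "\<forall>\<mu>. u \<mu> \<noteq> 0 \<longrightarrow> \<mu> \<in> h_dual \<and> u \<mu> \<in> weight_space scale act \<mu>" "v = (\<Sum>\<mu> | u \<mu> \<noteq> 0. u \<mu>)"
      using weight_decomposition by blast
    have "u \<mu> = 0" for \<mu> using u(1) none by (auto simp: supp_def)
    then show ?thesis using u(2) by simp
  qed
  then show False using irreducible unfolding irreducible_lie_supermodule_def by blast
qed

lemma act_weight_homog:
  assumes \<beta>: "\<beta> \<in> h_dual" and rv: "root_vector \<beta> m X" and p: "has_parity i X" and i: "i \<in> {0, 1}"
    and v: "v \<in> weight_space scale act \<mu>"
  shows "act (monomial m X) v \<in> weight_space scale act (\<lambda>x. \<mu> x + \<beta> x)"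
  unfolding weight_space_def
proof (intro CollectI ballI)
  fix y assume y: "y \<in> h"
  let ?x = "monomial m X"
  have x: "?x \<in> homog L i" "?x \<in> carrier L" using root_vector_homog[OF rv p] root_vector_carrier[OF rv] by auto
  have yh: "y \<in> homog L 0" using y cartan_homog by (auto simp: h_eq)
  have "y \<otimes>\<^bsub>L\<^esub> ?x = \<beta> y \<odot>\<^bsub>L\<^esub> ?x" using root_vector_root_space(1)[OF \<beta> rv] y by (simp add: root_space_def)
  moreover have "act (y \<otimes>\<^bsub>L\<^esub> ?x) v = act y (act ?x v) - act ?x (act y v)"
    using act_bracket[OF yh x(1) _ i] by simp
  moreover have "act y v = scale (\<mu> y) v" using v y by (simp add: weight_space_def)
  ultimately have "act y (act ?x v) = scale (\<beta> y) (act ?x v) + scale (\<mu> y) (act ?x v)"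
    using act_smult[OF x(2)] act_scale[OF x(2)] by (simp add: algebra_simps)
  then show "act y (act ?x v) = scale (\<mu> y + \<beta> y) (act ?x v)" by (simp add: scale_left_distrib add.commute)
qed

lemma h_carrier: "y \<in> h \<Longrightarrow> y \<in> carrier L"
  using cartan_carrier by (auto elim: hE)

lemma zero_weight_space: "0 \<in> weight_space scale act \<mu>"
  using h_carrier by (simp add: weight_space_def)

lemma weight_space_add: "u \<in> weight_space scale act \<mu> \<Longrightarrow> v \<in> weight_space scale act \<mu> \<Longrightarrow> u + v \<in> weight_space scale act \<mu>"
  using h_carrier by (simp add: weight_space_def act_add scale_right_distrib)

lemma act_weight:
  assumes \<beta>: "\<beta> \<in> h_dual" and rv: "root_vector \<beta> m X" and v: "v \<in> weight_space scale act \<mu>"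
  shows "act (monomial m X) v \<in> weight_space scale act (\<lambda>x. \<mu> x + \<beta> x)"
proof -
  have X: "X \<in> matrices" "X \<in> carrier_mat N N" using rv by (auto simp: root_vector_def)
  have zc: "monomial m mzero = \<zero>\<^bsub>L\<^esub>" by (simp add: monomial_eq_zero_iff upper_trace_zero)
  have zcar: "\<zero>\<^bsub>L\<^esub> \<in> carrier L" using zero_root_space by (simp add: root_space_def)
  have part: "monomial m Z \<in> carrier L \<and> act (monomial m Z) v \<in> weight_space scale act (\<lambda>x. \<mu> x + \<beta> x)"
    if "Z = mzero \<or> root_vector \<beta> m Z" "has_parity i Z" "i \<in> {0, 1}" for Z i
    using that act_weight_homog[OF \<beta> _ that(2,3) v] root_vector_carrier zc zcar zero_weight_space by (auto simp: act_zero)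
  have 0: "monomial m (even_part m1 X) \<in> carrier L \<and> act (monomial m (even_part m1 X)) v \<in> weight_space scale act (\<lambda>x. \<mu> x + \<beta> x)"
    by (rule part[of _ 0]) (use root_vector_even_part[OF rv] has_parity_even_part[OF X(2)] in auto)
  have 1: "monomial m (odd_part m1 X) \<in> carrier L \<and> act (monomial m (odd_part m1 X)) v \<in> weight_space scale act (\<lambda>x. \<mu> x + \<beta> x)"
    by (rule part[of _ 1]) (use root_vector_odd_part[OF rv] has_parity_odd_part[OF X(2)] in auto)
  have "monomial m X = monomial m (even_part m1 X) \<oplus>\<^bsub>L\<^esub> monomial m (odd_part m1 X)"
    using X by (simp add: monomial_add even_plus_odd)
  then show ?thesis using 0 1 act_sum weight_space_add by simp
qed

lemma supp_add_injective:
  assumes \<beta>: "\<beta> \<in> h_dual" and rv: "root_vector \<beta> m X" and inj: "inj (act (monomial m X))" and \<mu>: "\<mu> \<in> supp"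
  shows "(\<lambda>x. \<mu> x + \<beta> x) \<in> supp"
proof -
  obtain v where v: "\<mu> \<in> h_dual" "v \<in> weight_space scale act \<mu>" "v \<noteq> 0" using \<mu> by (auto simp: supp_def)
  have "act (monomial m X) v \<noteq> 0"
    using inj v(3) act_0[OF root_vector_carrier[OF rv]] by (metis injD)
  then show ?thesis using act_weight[OF \<beta> rv v(2)] h_dual_add[OF v(1) \<beta>] by (auto simp: supp_def)
qed

text \<open>The conjugate transpose in the opposite degree completes the root vector to an \<open>sl(2)\<close> triple, and the
weight spaces along the string have finite dimension.\<close>

lemma locally_nilpotent_finite_string:
  assumes \<beta>: "\<beta> \<in> h_dual" and rv: "root_vector \<beta> m X" and X: "X \<in> block_matrices i" and i: "i \<in> {1, 2}"
    and fin: "finite_part_nonzero \<beta>" and nil: "\<And>v. \<exists>n. (act (monomial m X) ^^ n) v = 0" and \<mu>: "\<mu> \<in> h_dual"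
  shows "finite {n. (\<lambda>x. \<mu> x + of_nat n * \<beta> x) \<in> supp}"
proof -
  let ?e = "monomial m X" and ?f = "monomial (- m) (conj_transpose X)"
  let ?Z = "cartan (coroot X) (of_int m * norm_form X) 0"
  define U where "U n = weight_space scale act (\<lambda>x. \<mu> x + of_nat n * \<beta> x)" for n :: nat
  have U_dual: "(\<lambda>x. \<mu> x + of_nat n * \<beta> x) \<in> h_dual" for n by (intro h_dual_add h_dual_scale \<beta> \<mu>)
  have rvf: "root_vector (\<lambda>x. - \<beta> x) (- m) (conj_transpose X)" by (rule root_vector_conj_transpose[OF \<beta> rv X])
  have nb: "(\<lambda>x. - \<beta> x) \<in> h_dual" using h_dual_scale[OF \<beta>, of "-1"] by simp
  have e: "?e \<in> homog L 0" "?e \<in> carrier L" using root_vector_homog[OF rv has_parity_block[OF X]] root_vector_carrier[OF rv] by auto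
  have f: "?f \<in> homog L 0" "?f \<in> carrier L"
    using root_vector_homog[OF rvf has_parity_block[OF block_matrices_conj_transpose[OF X]]] root_vector_carrier[OF rvf] by auto
  have rvs: "\<beta> cc = 0" "X \<noteq> mzero" "sigma_matrix X = zpow m \<cdot>\<^sub>m X" "has_weight X (\<lambda>D. \<beta> (cartan D 0 0))"
    using rv by (auto simp: root_vector_def)
  note Z = dual_form_nonzero(1,2)[OF \<beta> rvs(1) fin X rvs(2) i rvs(3,4)]
  have \<beta>Z: "\<beta> ?Z \<noteq> 0"
    unfolding h_dual_cartan[OF \<beta> Z(1), of "of_int m * norm_form X" 0] using Z(2) rvs(1) by simp
  have "finite {n. \<exists>v\<in>U n. v \<noteq> 0}"
  proof (rule sl2_string_finite[OF vector_space_axioms act_linear[OF e(2)] act_linear[OF f(2)], where a = "\<mu> ?Z" and b = "\<beta> ?Z"])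
    show "\<exists>B. finite B \<and> U n \<subseteq> span B" for n unfolding U_def by (rule weight_space_finite[OF U_dual])
    show "act ?e v \<in> U (Suc n)" if "v \<in> U n" for n v
      using act_weight[OF \<beta> rv that[unfolded U_def]] by (simp add: U_def algebra_simps)
    show "act ?f v \<in> U n" if "v \<in> U (Suc n)" for n v
      using act_weight[OF nb rvf that[unfolded U_def]] by (simp add: U_def algebra_simps)
    show "act ?e (act ?f v) - act ?f (act ?e v) = scale (\<mu> ?Z + of_nat n * \<beta> ?Z) v" if "v \<in> U n" for n v
    proof -
      have "act ?e (act ?f v) - act ?f (act ?e v) = act (?e \<otimes>\<^bsub>L\<^esub> ?f) v"
        using act_bracket[OF e(1) f(1)] by simp
      also have "\<dots> = act ?Z v" by (simp only: monomial_conj_transpose_bracket[OF X])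
      finally show ?thesis using that Z(1) by (simp add: U_def weight_space_def)
    qed
  qed (use \<beta>Z nil in auto)
  then show ?thesis using U_dual by (simp add: U_def supp_def)
qed

text \<open>A root vector moves weight vectors along the string and every vector is a finite sum of weight vectors.\<close>

lemma finite_strings_locally_nilpotent:
  assumes \<beta>: "\<beta> \<in> h_dual" and rv: "root_vector \<beta> m X"
    and fin: "\<And>\<mu>. \<mu> \<in> h_dual \<Longrightarrow> finite {n. (\<lambda>x. \<mu> x + of_nat n * \<beta> x) \<in> supp}"
  shows "\<exists>n. (act (monomial m X) ^^ n) v = 0"
proof -
  let ?x = "monomial m X"
  have xc: "?x \<in> carrier L" by (rule root_vector_carrier[OF rv])
  have wt: "\<exists>n. (act ?x ^^ n) v = 0" if \<mu>: "\<mu> \<in> h_dual" and v: "v \<in> weight_space scale act \<mu>" for \<mu> v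
  proof -
    have mem: "(act ?x ^^ n) v \<in> weight_space scale act (\<lambda>x. \<mu> x + of_nat n * \<beta> x)" for n
    proof (induction n)
      case (Suc n)
      then show ?case using act_weight[OF \<beta> rv Suc] by (simp add: algebra_simps)
    qed (simp add: v)
    obtain n where "n \<notin> {n. (\<lambda>x. \<mu> x + of_nat n * \<beta> x) \<in> supp}"
      using ex_new_if_finite[OF infinite_UNIV_nat fin[OF \<mu>]] by blast
    moreover have "(\<lambda>x. \<mu> x + of_nat n * \<beta> x) \<in> h_dual" by (intro h_dual_add h_dual_scale \<beta> \<mu>)
    ultimately show ?thesis using mem[of n] by (auto simp: supp_def)
  qed
  obtain u where u: "finite {\<mu>. u \<mu> \<noteq> 0}" "\<forall>\<mu>. u \<mu> \<noteq> 0 \<longrightarrow> \<mu> \<in> h_dual \<and> u \<mu> \<in> weight_space scale act \<mu>"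
    "v = (\<Sum>\<mu> | u \<mu> \<noteq> 0. u \<mu>)" using weight_decomposition by blast
  have "\<exists>n. (act ?x ^^ n) (\<Sum>\<mu>\<in>A. u \<mu>) = 0" if "finite A" "A \<subseteq> {\<mu>. u \<mu> \<noteq> 0}" for A
    using that
  proof (induction A rule: finite_induct)
    case (insert \<mu> A)
    obtain a where "(act ?x ^^ a) (\<Sum>\<mu>\<in>A. u \<mu>) = 0" using insert by auto
    moreover obtain b where "(act ?x ^^ b) (u \<mu>) = 0" using wt u(2) insert.prems by blast
    ultimately have "(act ?x ^^ max a b) (u \<mu> + (\<Sum>\<mu>\<in>A. u \<mu>)) = 0"
      by (simp add: act_pow_add[OF xc] act_pow_monomial[OF xc])
    then show ?case using insert.hyps by auto
  qed (use act_pow_0[OF xc] in auto)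
  then show ?thesis using u by auto
qed

text \<open>An arbitrary root vector need not be homogeneous, and the dichotomy concerns homogeneous ones. If its
even part is nonzero, it belongs to an \<open>sl(2)\<close> triple: were it locally nilpotent, all strings in this
direction would be finite, and then every root vector for this root would be locally nilpotent.\<close>

lemma not_locally_nilpotent_injective:
  assumes \<alpha>: "\<alpha> \<in> R_part_re i" and i: "i \<in> {1, 2}" and R: "shift \<alpha> n \<in> R" and nl: "shift \<alpha> n \<notin> R_ln act"
  shows "\<exists>m X. root_vector (shift \<alpha> n) m X \<and> inj (act (monomial m X))"
proof -
  let ?\<beta> = "shift \<alpha> n"
  obtain m' A where 1: "\<alpha> \<in> h_dual" "root_vector \<alpha> m' A" "A \<in> block_matrices i" "finite_part_nonzero \<alpha>"
    using R_part_reE[OF \<alpha> i] .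
  have \<beta>: "?\<beta> \<in> h_dual" by (rule shift_h_dual[OF 1(1)])
  have fin: "finite_part_nonzero ?\<beta>" using 1(4) by simp
  obtain x v where x: "x \<in> root_space ?\<beta>" "x \<noteq> \<zero>\<^bsub>L\<^esub>" and xv: "\<And>p. (act x ^^ p) v \<noteq> 0"
    using nl shift_R_re[OF \<alpha> i R] unfolding R_ln_def by blast
  obtain m X where rv: "root_vector ?\<beta> m X" and xe: "x = monomial m X"
    using root_space_root_vector[OF \<beta> x fin] by blast
  have X: "X \<in> carrier_mat N N" using rv by (simp add: root_vector_def)
  show ?thesis
  proof (cases "even_part m1 X = mzero")
    case True
    then have "has_parity 1 X" using has_parity_iff[OF X, of 1] by simp
    then show ?thesis using injective_or_locally_nilpotent[OF rv _ _ fin, of 1] xv rv unfolding xe by blast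
  next
    case False
    have rv0: "root_vector ?\<beta> m (even_part m1 X)" by (rule root_vector_even_part[OF rv False])
    have b0: "even_part m1 X \<in> block_matrices i" by (rule even_part_block[OF \<alpha> i rv])
    have "inj (act (monomial m (even_part m1 X)))"
    proof (rule ccontr)
      assume "\<not> ?thesis"
      then have "\<And>v. \<exists>p. (act (monomial m (even_part m1 X)) ^^ p) v = 0"
        using injective_or_locally_nilpotent[OF rv0 has_parity_block[OF b0] _ fin] by blast
      then have "\<And>\<mu>. \<mu> \<in> h_dual \<Longrightarrow> finite {n. (\<lambda>x. \<mu> x + of_nat n * ?\<beta> x) \<in> supp}"
        using locally_nilpotent_finite_string[OF \<beta> rv0 b0 i fin] by blast
      then show False using finite_strings_locally_nilpotent[OF \<beta> rv] xv unfolding xe by blast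
    qed
    then show ?thesis using rv0 by blast
  qed
qed

text \<open>The class of \<open>\<alpha>\<close> modulo \<open>\<int> \<delta>\<close> is not contained in the set of locally nilpotent roots.\<close>

lemma hybrid_injective:
  assumes hy: "hybrid act i" and \<alpha>: "\<alpha> \<in> R_part_re i" and i: "i \<in> {1, 2}"
  shows "\<exists>n m X. shift \<alpha> n \<in> R_part_re i \<and> root_vector (shift \<alpha> n) m X \<and> inj (act (monomial m X))"
proof -
  obtain m' A where 1: "\<alpha> \<in> h_dual" "root_vector \<alpha> m' A" "A \<in> block_matrices i" "finite_part_nonzero \<alpha>"
    using R_part_reE[OF \<alpha> i] .
  obtain n where n: "shift \<alpha> n \<in> R_part i" "shift \<alpha> n \<notin> R_ln act"
    using hy \<alpha> unfolding hybrid_def tight_def by blast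
  have "finite_part_nonzero (shift \<alpha> n)" using 1(4) by simp
  then obtain m X where "shift \<alpha> n \<in> h_dual" "root_vector (shift \<alpha> n) m X" "X \<in> block_matrices i"
    using R_part_memE[OF n(1) _ i] by blast
  then have R: "shift \<alpha> n \<in> R" using root_vector_root_space R_memI by blast
  have "shift \<alpha> n \<in> R_part_re i" using n(1) shift_R_re[OF \<alpha> i R] by (simp add: R_part_re_def)
  then show ?thesis using not_locally_nilpotent_injective[OF \<alpha> i R n(2)] by blast
qed

section \<open>Hybrid root systems\<close>

text \<open>If \<open>R(j')\<close> is hybrid but not up-nilpotent, the set of weights is closed under a translation by
\<open>p \<delta>\<close> with \<open>p > 0\<close>. This translation carries a single injective translate of a root of \<open>R(j)\<close> to
arbitrarily high ones, and all of these have infinite strings.\<close>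

theorem up_nilpotent_transfer:
  assumes j: "j \<in> {1, 2}" and j': "j' \<in> {1, 2}" and up: "up_nilpotent_hybrid act j" and hy': "hybrid act j'"
  shows "up_nilpotent_hybrid act j'"
proof (rule ccontr)
  assume "\<not> up_nilpotent_hybrid act j'"
  then have "R_part j' \<inter> K1 act \<noteq> R_part_re j'" using hy' by (simp add: up_nilpotent_hybrid_def)
  moreover have "R_part j' \<inter> K1 act \<subseteq> R_part_re j'" by (auto simp: R_part_re_def K1_def)
  ultimately obtain \<alpha>' where \<alpha>': "\<alpha>' \<in> R_part_re j'" "\<alpha>' \<notin> K1 act" by (auto simp: R_part_re_def)
  have big: "\<exists>n\<ge>N. shift \<alpha>' n \<in> R \<and> shift \<alpha>' n \<notin> R_ln act" for N
    using \<alpha>' unfolding K1_def R_part_re_def by blast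
  have h': "\<alpha>' \<in> h_dual" using R_part_reE[OF \<alpha>'(1) j'] by blast
  have neg': "(\<lambda>x. - \<alpha>' x) \<in> R_part_re j'" by (rule R_part_re_neg[OF \<alpha>'(1) j'])
  have hneg': "(\<lambda>x. - \<alpha>' x) \<in> h_dual" using h_dual_scale[OF h', of "-1"] by simp
  obtain n2 m2' X2 where n2: "root_vector (shift (\<lambda>x. - \<alpha>' x) n2) m2' X2" "inj (act (monomial m2' X2))"
    using hybrid_injective[OF hy' neg' j'] by blast
  obtain n1 where n1: "n1 \<ge> 1 - n2" "shift \<alpha>' n1 \<in> R" "shift \<alpha>' n1 \<notin> R_ln act" using big by blast
  obtain m1' X1 where x1: "root_vector (shift \<alpha>' n1) m1' X1" "inj (act (monomial m1' X1))"
    using not_locally_nilpotent_injective[OF \<alpha>'(1) j' n1(2,3)] by blast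
  define p where "p = n1 + n2"
  have p: "p \<ge> 1" using n1(1) by (simp add: p_def)
  have up_delta: "(\<lambda>x. \<mu> x + of_int p * delta x) \<in> supp" if "\<mu> \<in> supp" for \<mu>
  proof -
    have "(\<lambda>x. (\<mu> x + shift \<alpha>' n1 x) + shift (\<lambda>x. - \<alpha>' x) n2 x) \<in> supp"
      by (intro supp_add_injective[OF shift_h_dual[OF hneg'] n2] supp_add_injective[OF shift_h_dual[OF h'] x1] that)
    moreover have "(\<lambda>x. (\<mu> x + shift \<alpha>' n1 x) + shift (\<lambda>x. - \<alpha>' x) n2 x) = (\<lambda>x. \<mu> x + of_int p * delta x)"
      by (simp add: fun_eq_iff shift_def p_def algebra_simps)
    ultimately show ?thesis by simp
  qed
  have up_deltas: "(\<lambda>x. \<mu> x + of_nat c * (of_int p * delta x)) \<in> supp" if \<mu>: "\<mu> \<in> supp" for \<mu> c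
  proof (induction c)
    case (Suc c)
    then show ?case using up_delta[OF Suc] by (simp add: algebra_simps)
  qed (simp add: \<mu>)
  obtain \<alpha> where \<alpha>: "\<alpha> \<in> R_part_re j" using R_part_re_nonempty[OF j] by blast
  have h: "\<alpha> \<in> h_dual" using R_part_reE[OF \<alpha> j] by blast
  have "hybrid act j" and K: "\<alpha> \<in> K1 act" using up \<alpha> by (auto simp: up_nilpotent_hybrid_def)
  then obtain n0 m0 X0 where n0: "shift \<alpha> n0 \<in> R_part_re j" "root_vector (shift \<alpha> n0) m0 X0" "inj (act (monomial m0 X0))"
    using hybrid_injective[OF _ \<alpha> j] by blast
  obtain B where B: "shift \<alpha> ` {B..} \<inter> R \<subseteq> R_ln act" using K by (auto simp: K1_def)
  define c where "c = nat (B - n0)"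
  \<comment> \<open>The factor \<open>period\<close> keeps the translate inside \<open>R(j)\<close>.\<close>
  define s where "s = n0 + int period * (p * int c)"
  let ?\<gamma> = "shift \<alpha> s"
  have "1 * int c \<le> (int period * p) * int c"
    using p period_pos by (intro mult_right_mono) (auto simp: mult_ge1_I int_one_le_iff_zero_less)
  moreover have "B - n0 \<le> int c" by (simp add: c_def)
  moreover have "s = n0 + (int period * p) * int c" by (simp add: s_def mult.assoc)
  ultimately have "s \<ge> B" by linarith
  have \<gamma>eq: "?\<gamma> = shift (shift \<alpha> n0) (int period * (p * int c))"
    by (simp add: shift_def s_def fun_eq_iff algebra_simps)
  have \<gamma>: "?\<gamma> \<in> R_part_re j" unfolding \<gamma>eq by (rule R_part_re_shift[OF n0(1) j])
  then have "?\<gamma> \<in> R_ln act" using B \<open>s \<ge> B\<close> by (auto simp: R_part_re_def R_re_def)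
  obtain m X where g: "?\<gamma> \<in> h_dual" "root_vector ?\<gamma> m X" "X \<in> block_matrices j" "finite_part_nonzero ?\<gamma>"
    using R_part_reE[OF \<gamma> j] .
  have nil: "\<And>v. \<exists>n. (act (monomial m X) ^^ n) v = 0"
    using \<open>?\<gamma> \<in> R_ln act\<close> root_vector_root_space[OF g(1,2)] unfolding R_ln_def by blast
  obtain \<mu> where \<mu>: "\<mu> \<in> supp" using supp_nonempty by blast
  have "(\<lambda>x. \<mu> x + of_nat i * ?\<gamma> x) \<in> supp" for i
  proof (induction i)
    case (Suc i)
    have "(\<lambda>x. (\<mu> x + of_nat i * ?\<gamma> x) + shift \<alpha> n0 x) \<in> supp"
      by (rule supp_add_injective[OF shift_h_dual[OF h] n0(2,3) Suc])
    then have "(\<lambda>x. ((\<mu> x + of_nat i * ?\<gamma> x) + shift \<alpha> n0 x) + of_nat (period * c) * (of_int p * delta x)) \<in> supp"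
      by (rule up_deltas)
    moreover have "(\<lambda>x. ((\<mu> x + of_nat i * ?\<gamma> x) + shift \<alpha> n0 x) + of_nat (period * c) * (of_int p * delta x))
      = (\<lambda>x. \<mu> x + of_nat (Suc i) * ?\<gamma> x)"
      by (simp add: fun_eq_iff shift_def s_def algebra_simps)
    ultimately show ?case by simp
  qed (simp add: \<mu>)
  then have "{i. (\<lambda>x. \<mu> x + of_nat i * ?\<gamma> x) \<in> supp} = UNIV" by blast
  moreover have "finite {i. (\<lambda>x. \<mu> x + of_nat i * ?\<gamma> x) \<in> supp}"
    by (rule locally_nilpotent_finite_string[OF g(1,2,3) j g(4) nil]) (use \<mu> in \<open>simp add: supp_def\<close>)
  ultimately show False by simp
qed

end

theorem lemma5p6:
  fixes T :: twisted_type and k l :: nat and \<zeta> :: complex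
    and scale :: "complex \<Rightarrow> 'v::ab_group_add \<Rightarrow> 'v"
    and V :: "nat \<Rightarrow> 'v set"
    and act :: "complex mat set affine \<Rightarrow> 'v \<Rightarrow> 'v"
    and j j' :: nat
  assumes "k \<ge> 1" and "l \<ge> 1"
    and "T = A_odd_odd \<Longrightarrow> (k, l) \<noteq> (1, 1)"
    and "\<zeta> ^ twist_order T = 1" and "\<forall>m. 0 < m \<and> m < twist_order T \<longrightarrow> \<zeta> ^ m \<noteq> 1"
    and "irreducible_lie_supermodule (twisted_affine.L T k l \<zeta>) scale V act"
    and "twisted_affine.finite_weight_module T k l \<zeta> scale act"
    and "j \<in> {1, 2}" and "j' \<in> {1, 2}" and "j \<noteq> j'"
  shows "(twisted_affine.up_nilpotent_hybrid T k l \<zeta> act j \<longrightarrow>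
            twisted_affine.tight T k l \<zeta> act j' \<or> twisted_affine.up_nilpotent_hybrid T k l \<zeta> act j') \<and>
         (twisted_affine.down_nilpotent_hybrid T k l \<zeta> act j \<longrightarrow>
            twisted_affine.tight T k l \<zeta> act j' \<or> twisted_affine.down_nilpotent_hybrid T k l \<zeta> act j')"
proof -
  have vs: "vector_space scale"
    using assms(6) by (simp add: irreducible_lie_supermodule_def lie_supermodule_def)
  interpret irreducible_finite_weight_module T k l \<zeta> scale V act
    using vs assms(1,2,4-7)
    by (intro irreducible_finite_weight_module.intro twisted_affine_setting.intro
        irreducible_finite_weight_module_axioms.intro) auto
  show ?thesis
    using up_nilpotent_transfer[OF assms(8,9)] up_nilpotent_transfer[OF assms(9,8)]
    by (auto simp: hybrid_def down_nilpotent_hybrid_def)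
qed

end
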